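(* Let $g:\mathbb T\to\mathbb C$ be of bounded variation. Then for almost every $t\in\mathbb R$, $e^{it\partial_{xx}}g$ is a continuous function of $x$. Moreover, if in addition $g\notin\bigcup_{\epsilon>0}H^{r_0+\epsilon}(\mathbb T)$ for some $r_0\in[\frac12,\frac34)$, then for almost all $t$ both the graph of the real part and the graph of the imaginary part of $x\mapsto e^{it\partial_{xx}}g(x)$ have upper Minkowski dimension $D\in[\frac52-2r_0,\frac32]$. In particular, for $r_0=\frac12$, $D=\frac32$.
   Context: $\mathbb T=\mathbb R/2\pi\mathbb Z$. Fourier coefficients are $\widehat g(k)=\frac1{2\pi}\int_0^{2\pi}g(x)e^{-ikx}\,dx$, and $e^{it\partial_{xx}}g=\sum_{k\in\mathbb Z}e^{-itk^2+ikx}\widehat g(k)$ is the solution of the linear Schr\"odinger equation $iu_t+u_{xx}=0$, $u(x,0)=g(x)$, on $\mathbb T$ (continuity is understood up to a.e. equality in $x$, and graphs are those of the continuous representative). $H^s(\mathbb T)$ is the Sobolev space with norm $\|g\|_{H^s}^2\approx\sum_k(1+|k|)^{2s}|\widehat g(k)|^2$. The upper Minkowski dimension of a bounded set $E$ is $\limsup_{\epsilon\to0}\frac{\log\mathcal N(E,\epsilon)}{\log(1/\epsilon)}$, where $\mathcal N(E,\epsilon)$ is the minimum number of $\epsilon$-balls required to cover $E$. *)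

theory Defs
  imports "HOL-Analysis.Analysis"
begin

text \<open>
  Functions on the torus \<open>\<real>/2\<pi>\<int>\<close> are represented by \<open>2\<pi>\<close>-periodic functions on the reals.
\<close>

definition torus_fun :: "(real \<Rightarrow> 'a) \<Rightarrow> bool" where
  "torus_fun f \<longleftrightarrow> (\<forall>x. f (x + 2 * pi) = f x)"

text \<open>
  Finite total variation over all finite partitions \<open>x\<^sub>0 \<le> \<dots> \<le> x\<^sub>n\<close> with points in \<open>[a, b]\<close>. For a
  \<open>2\<pi>\<close>-periodic function, bounded variation on the torus is bounded variation on \<open>[0, 2\<pi>]\<close>.
\<close>

definition bounded_variation_on :: "real \<Rightarrow> real \<Rightarrow> (real \<Rightarrow> 'a::real_normed_vector) \<Rightarrow> bool" where
  "bounded_variation_on a b f \<longleftrightarrow>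
     (\<exists>B. \<forall>xs. sorted xs \<and> set xs \<subseteq> {a..b} \<longrightarrow>
        (\<Sum>i<length xs - 1. norm (f (xs ! Suc i) - f (xs ! i))) \<le> B)"

definition L2_torus :: "(real \<Rightarrow> complex) set" where
  "L2_torus = {f. torus_fun f \<and> f \<in> borel_measurable lebesgue \<and>
     set_integrable lebesgue {0..2 * pi} (\<lambda>x. (norm (f x))\<^sup>2)}"

definition fourier_coeff :: "(real \<Rightarrow> complex) \<Rightarrow> int \<Rightarrow> complex" where
  "fourier_coeff f k =
     1 / (2 * of_real pi) *
       (LINT x:{0..2 * pi}|lebesgue. f x * exp (- (\<i> * of_int k * of_real x)))"

text \<open>
  The Sobolev space \<open>H\<^sup>s\<close>, used only for \<open>s \<ge> 0\<close>, where its elements are square-integrable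
  functions (for negative \<open>s\<close> one would need distributions).
\<close>

definition sobolev_torus :: "real \<Rightarrow> (real \<Rightarrow> complex) set" where
  "sobolev_torus s = {f \<in> L2_torus.
     (\<lambda>k::int. (1 + \<bar>real_of_int k\<bar>) powr (2 * s) * (norm (fourier_coeff f k))\<^sup>2) summable_on UNIV}"

text \<open>
  The element \<open>e\<^bsup>it\<partial>\<^sub>x\<^sub>x\<^esup> g\<close> of \<open>L\<^sup>2\<close> of the torus, as the class of all functions (equal to one another
  almost everywhere) to which the series \<open>\<Sum>\<^sub>k e\<^bsup>-itk\<^sup>2+ikx\<^esup> g\<^sub>k\<close>, with \<open>g\<^sub>k\<close> the Fourier coefficients
  of \<open>g\<close>, converges unconditionally in \<open>L\<^sup>2\<close>. Its continuous members all coincide.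
\<close>

definition schroedinger_evolution :: "real \<Rightarrow> (real \<Rightarrow> complex) \<Rightarrow> (real \<Rightarrow> complex) set" where
  "schroedinger_evolution t g = {u \<in> L2_torus.
     ((\<lambda>F. LINT x:{0..2 * pi}|lebesgue.
         (norm (u x - (\<Sum>k\<in>F. exp (- (\<i> * of_real t * (of_int k)\<^sup>2) + \<i> * of_int k * of_real x)
                                * fourier_coeff g k)))\<^sup>2)
      \<longlongrightarrow> 0) (finite_subsets_at_top (UNIV :: int set))}"

definition torus_graph :: "(real \<Rightarrow> real) \<Rightarrow> (real \<times> real) set" where
  "torus_graph f = (\<lambda>x. (x, f x)) ` {0..2 * pi}"

text \<open>
  The minimum is attained whenever \<open>E\<close> is totally bounded; in \<open>\<real>\<^sup>2\<close>, whenever \<open>E\<close> is bounded.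
\<close>

definition covering_number :: "'a::metric_space set \<Rightarrow> real \<Rightarrow> nat" where
  "covering_number E \<epsilon> = (LEAST n. \<exists>C. finite C \<and> card C = n \<and> E \<subseteq> (\<Union>c\<in>C. ball c \<epsilon>))"

definition upper_minkowski_dim :: "'a::metric_space set \<Rightarrow> ereal" where
  "upper_minkowski_dim E =
     Limsup (at_right 0) (\<lambda>\<epsilon>. ereal (ln (real (covering_number E \<epsilon>)) / ln (1 / \<epsilon>)))"

end

theory Submission
  imports Defs
begin

text \<open>
  Write \<open>u = e\<^bsup>it\<partial>\<^sub>x\<^sub>x\<^esup> g\<close>. Two properties of \<open>u\<close> at almost every time determine the dimension.

  Regularity. For almost every \<open>t\<close> the quadratic Weyl sums \<open>\<Sum>\<^sub>k\<^sub>\<le>\<^sub>N e\<^bsup>-itk\<^sup>2+ikx\<^esup>\<close> are \<open>O (N\<^bsup>b\<^esup>)\<close>, uniformly in \<open>x\<close>,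
  for every \<open>b > 1/2\<close> (\<open>AE_weyl_bound\<close>). Indeed, van der Corput differencing bounds their squares by
  \<open>N + 2 \<Sum>\<^sub>h\<^sub><\<^sub>N min N (1 / \<bar>sin (h t)\<bar>)\<close>, and averaging over \<open>t\<close> shows that this is \<open>O (N\<^bsup>1+2\<eta>\<^esup>)\<close> for almost every
  \<open>t\<close>, without recourse to continued fractions. Since \<open>g\<close> has bounded variation, a
  trigonometric sum weighted with its Fourier coefficients is the convolution of the measure \<open>dg\<close>
  with an integrated Weyl kernel (\<open>norm_weighted_trig_sum_le\<close>). So the partial sums of \<open>u\<close> converge
  uniformly, and comparison with the partial sum of order \<open>1 / h\<close> shows that \<open>u\<close> is Hoelder
  continuous of every exponent below \<open>1/2\<close> (\<open>evolution_hoelder\<close>). Counting squares of a grid gives the upper bound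
  \<open>3/2\<close> for the dimension of its graphs.

  Irregularity. The Fourier coefficient of \<open>Re u\<close> at \<open>k\<close> combines those of \<open>g\<close> at \<open>k\<close> and \<open>-k\<close> with
  phases that rotate in opposite directions with speed \<open>k\<^sup>2\<close>. On a set of times of positive measure the
  cross terms average out, so \<open>Re u\<close> and \<open>Im u\<close> belong to \<open>H\<^sup>s\<close> on such a set only if \<open>g\<close> does
  (\<open>AE_oscillating_sum_diverges\<close>).

  These are combined as follows (\<open>small_covering_imp_sobolev\<close>). If \<open>\<epsilon>\<^bsup>-d\<^esup>\<close> balls of radius \<open>\<epsilon>\<close> cover the graph of
  \<open>f\<close>, then \<open>f\<close> moves by \<open>O (h\<^bsup>2-d\<^esup>)\<close> in \<open>L\<^sup>1\<close> under translation by \<open>h\<close>. Interpolation with the uniform bound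
  \<open>O (h\<^bsup>a\<^esup>)\<close> of a Hoelder function gives \<open>O (h\<^bsup>2+a-d\<^esup>)\<close> for the square of the \<open>L\<^sup>2\<close> norm, and thus \<open>f\<close>
  belongs to \<open>H\<^sup>s\<close> whenever \<open>2 s < 2 + a - d\<close>. With \<open>a\<close> close to \<open>1/2\<close>, a dimension \<open>d < 5/2 - 2 r\<^sub>0\<close> of
  the graph of \<open>Re u\<close> or \<open>Im u\<close> would put this function into some \<open>H\<^sup>s\<close> with \<open>s > r\<^sub>0\<close>, to which it
  does not belong at almost every time.
\<close>

section \<open>Fourier coefficients\<close>

definition character :: "int \<Rightarrow> real \<Rightarrow> complex" where
  "character k x = cis (of_int k * x)"

lemma exp_eq_character: "exp (\<i> * of_int k * of_real x) = character k x"
  by (simp add: character_def cis_conv_exp mult.assoc)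

lemma norm_character [simp]: "norm (character k x) = 1"
  by (simp add: character_def)

lemma character_0 [simp]: "character 0 x = 1" "character k 0 = 1"
  by (simp_all add: character_def)

lemma character_add: "character k (x + y) = character k x * character k y"
  by (simp add: character_def cis_mult ring_distribs)

lemma character_add_int: "character (k + l) x = character k x * character l x"
  by (simp add: character_def cis_mult ring_distribs)

lemma cnj_character: "cnj (character k x) = character (- k) x"
  by (simp add: character_def cis_cnj)

lemma character_periodic [simp]: "character k (x + 2 * pi) = character k x"
proof -
  have "cis (2 * (pi * real_of_int k)) = 1"
    using cis_multiple_2pi[of "real_of_int k"] by (simp add: mult_ac)
  then show ?thesis
    by (simp add: character_add) (simp add: character_def mult_ac)
qed

lemma character_2pi [simp]: "character k (2 * pi) = 1"
  using character_periodic[of k 0] by simp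

lemma continuous_on_character [continuous_intros]:
  "continuous_on S f \<Longrightarrow> continuous_on S (\<lambda>x. character k (f x))"
  unfolding character_def by (intro continuous_intros)

lemma character_has_vector_derivative [derivative_intros]:
  "((\<lambda>x. character k x) has_vector_derivative \<i> * of_int k * character k x) (at x within S)"
proof -
  have "((\<lambda>x. exp (x *\<^sub>R (\<i> * of_int k))) has_vector_derivative
      exp (x *\<^sub>R (\<i> * of_int k)) * (\<i> * of_int k)) (at x within S)"
    by (rule exp_scaleR_has_vector_derivative_right)
  then show ?thesis
    by (simp add: exp_eq_character[symmetric] scaleR_conv_of_real mult_ac)
qed

lemma borel_measurable_character [measurable]: "character k \<in> borel_measurable lebesgue"
proof -
  have "character k \<in> borel_measurable borel"
    by (intro borel_measurable_continuous_onI continuous_intros)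
  then have "character k \<in> borel_measurable lborel" by simp
  then show ?thesis by (rule measurable_completion)
qed

lemma set_integrable_sum:
  fixes f :: "'i \<Rightarrow> 'b \<Rightarrow> 'a::{banach, second_countable_topology}"
  assumes "\<And>i. i \<in> F \<Longrightarrow> set_integrable M A (f i)"
  shows "set_integrable M A (\<lambda>x. \<Sum>i\<in>F. f i x)"
  using assms unfolding set_integrable_def scaleR_sum_right by (intro Bochner_Integration.integrable_sum)

lemma set_integral_sum:
  fixes f :: "'i \<Rightarrow> 'b \<Rightarrow> 'a::{banach, second_countable_topology}"
  assumes "\<And>i. i \<in> F \<Longrightarrow> set_integrable M A (f i)"
  shows "(LINT x:A|M. (\<Sum>i\<in>F. f i x)) = (\<Sum>i\<in>F. LINT x:A|M. f i x)"
  using assms unfolding set_integrable_def set_lebesgue_integral_def scaleR_sum_right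
  by (intro Bochner_Integration.integral_sum)

lemma set_integral_Re:
  assumes "set_integrable M A h"
  shows "set_integrable M A (\<lambda>x. Re (h x))" and "(LINT x:A|M. Re (h x)) = Re (LINT x:A|M. h x)"
  using integrable_bounded_linear[OF bounded_linear_Re assms[unfolded set_integrable_def]]
    integral_bounded_linear[OF bounded_linear_Re assms[unfolded set_integrable_def]]
  by (simp_all add: set_integrable_def set_lebesgue_integral_def)

lemma integral_character:
  "(LINT x:{0..2*pi}|lebesgue. character k x) = (if k = 0 then 2 * of_real pi else 0)"
proof (cases "k = 0")
  case True
  then show ?thesis by (simp add: set_integral_const scaleR_conv_of_real)
next
  case False
  have "(character k has_integral
      (1 / (\<i> * of_int k) * character k (2*pi) - 1 / (\<i> * of_int k) * character k 0)) {0..2*pi}"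
  proof (rule fundamental_theorem_of_calculus)
    fix x assume "x \<in> {0..2*pi}"
    show "((\<lambda>x. 1 / (\<i> * of_int k) * character k x) has_vector_derivative character k x)
        (at x within {0..2*pi})"
      by (rule derivative_eq_intros refl)+ (use False in simp)
  qed simp
  then have "integral {0..2*pi} (character k) = 0"
    by (simp add: integral_unique)
  moreover have "set_integrable lebesgue {0..2*pi} (character k)"
    by (intro absolutely_integrable_continuous_real continuous_intros)
  ultimately show ?thesis
    using False set_lebesgue_integral_eq_integral(2)[of "{0..2*pi}" "character k"] by auto
qed

lemma fourier_coeff_eq:
  "fourier_coeff f k = (LINT x:{0..2*pi}|lebesgue. f x * character (- k) x) / (2 * of_real pi)"
proof -
  have "exp (- (\<i> * of_int k * of_real x)) = character (- k) x" for x
    by (simp add: exp_eq_character[symmetric])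
  then show ?thesis by (simp add: fourier_coeff_def)
qed

lemma L2_imp_set_integrable:
  fixes f :: "real \<Rightarrow> complex"
  assumes "f \<in> borel_measurable lebesgue"
    and "set_integrable lebesgue {0..2*pi} (\<lambda>x. (norm (f x))\<^sup>2)"
  shows "set_integrable lebesgue {0..2*pi} f"
proof (rule set_integrable_bound)
  show "set_integrable lebesgue {0..2*pi} (\<lambda>x. 1 + (norm (f x))\<^sup>2)"
    by (intro set_integral_add(1) assms absolutely_integrable_continuous_real continuous_intros)
  show "set_borel_measurable lebesgue {0..2*pi} f"
    unfolding set_borel_measurable_def using assms(1)
    by (intro borel_measurable_scaleR borel_measurable_indicator) auto
  have "norm y \<le> 1 + (norm y)\<^sup>2" for y :: complex
  proof -
    have "0 \<le> (norm y - 1)\<^sup>2 + (norm y)\<^sup>2 + 1" by simp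
    then show ?thesis by (simp add: power2_diff)
  qed
  then show "AE x in lebesgue. x \<in> {0..2*pi} \<longrightarrow> norm (f x) \<le> norm (1 + (norm (f x))\<^sup>2)"
    by (auto simp: abs_of_nonneg)
qed

lemma set_integrable_mult_character:
  fixes f :: "real \<Rightarrow> complex"
  assumes "set_integrable lebesgue {0..2*pi} f"
  shows "set_integrable lebesgue {0..2*pi} (\<lambda>x. f x * character k x)"
proof (rule set_integrable_bound[OF assms])
  have "(\<lambda>x. indicator {0..2*pi} x *\<^sub>R f x) \<in> borel_measurable lebesgue"
    using assms unfolding set_integrable_def by auto
  then have "(\<lambda>x. (indicator {0..2*pi} x *\<^sub>R f x) * character k x) \<in> borel_measurable lebesgue"
    by measurable
  then show "set_borel_measurable lebesgue {0..2*pi} (\<lambda>x. f x * character k x)"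
    unfolding set_borel_measurable_def by simp
qed (simp add: norm_mult)

text \<open>Expanding the square and using the orthogonality of the characters gives at once Bessel's
  inequality (the left hand side is nonnegative for \<open>c = fourier_coeff f\<close>) and, for \<open>f = 0\<close>,
  Parseval's identity for trigonometric polynomials.\<close>

lemma integral_norm_diff_trig_poly:
  fixes f :: "real \<Rightarrow> complex" and c :: "int \<Rightarrow> complex"
  assumes meas: "f \<in> borel_measurable lebesgue"
    and sq: "set_integrable lebesgue {0..2*pi} (\<lambda>x. (norm (f x))\<^sup>2)"
    and "finite F"
  shows "(LINT x:{0..2*pi}|lebesgue. (norm (f x - (\<Sum>k\<in>F. c k * character k x)))\<^sup>2) =
    (LINT x:{0..2*pi}|lebesgue. (norm (f x))\<^sup>2) - 2 * pi * (\<Sum>k\<in>F. (norm (fourier_coeff f k))\<^sup>2)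
    + 2 * pi * (\<Sum>k\<in>F. (norm (c k - fourier_coeff f k))\<^sup>2)"
proof -
  let ?I = "\<lambda>h. (LINT x:{0..2*pi}|lebesgue. h x)"
  have f: "set_integrable lebesgue {0..2*pi} f"
    by (rule L2_imp_set_integrable[OF meas sq])
  define cross where "cross x = (\<Sum>k\<in>F. cnj (c k) * (f x * character (- k) x))" for x
  define P where "P x = (\<Sum>k\<in>F. \<Sum>l\<in>F. c k * cnj (c l) * character (k - l) x)" for x
  have cross_i: "set_integrable lebesgue {0..2*pi} cross"
    unfolding cross_def
    by (intro set_integrable_sum set_integrable_mult_right set_integrable_mult_character f)
  have P_i: "set_integrable lebesgue {0..2*pi} P"
    unfolding P_def by (intro absolutely_integrable_continuous_real continuous_intros)
  have int_cross: "?I cross = 2 * pi * (\<Sum>k\<in>F. cnj (c k) * fourier_coeff f k)"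
  proof -
    have "?I cross = (\<Sum>k\<in>F. ?I (\<lambda>x. cnj (c k) * (f x * character (- k) x)))"
      unfolding cross_def
      by (intro set_integral_sum set_integrable_mult_right set_integrable_mult_character f)
    also have "\<dots> = (\<Sum>k\<in>F. cnj (c k) * (2 * pi * fourier_coeff f k))"
      by (simp only: set_integral_mult_right) (simp add: fourier_coeff_eq)
    finally show ?thesis by (simp add: sum_distrib_left mult_ac)
  qed
  have int_P: "?I P = 2 * pi * (\<Sum>k\<in>F. c k * cnj (c k))"
  proof -
    have "?I P = (\<Sum>k\<in>F. \<Sum>l\<in>F. ?I (\<lambda>x. c k * cnj (c l) * character (k - l) x))"
      unfolding P_def
      by (simp only: set_integral_sum absolutely_integrable_continuous_real continuous_intros)
    also have "\<dots> = (\<Sum>k\<in>F. \<Sum>l\<in>F. if k = l then c k * cnj (c l) * (2 * pi) else 0)"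
      by (intro sum.cong refl) (simp add: integral_character)
    also have "\<dots> = (\<Sum>k\<in>F. c k * cnj (c k) * (2 * pi))"
      using \<open>finite F\<close> by (intro sum.cong refl) (simp add: sum.delta)
    finally show ?thesis by (simp add: sum_distrib_left mult_ac)
  qed
  have expand: "(norm (f x - (\<Sum>k\<in>F. c k * character k x)))\<^sup>2 =
      (norm (f x))\<^sup>2 - 2 * Re (cross x) + Re (P x)" for x
  proof -
    let ?p = "\<Sum>k\<in>F. c k * character k x"
    have cr: "cross x = f x * cnj ?p"
      by (simp add: cross_def cnj_character sum_distrib_left mult_ac)
    have Px: "P x = ?p * cnj ?p"
    proof -
      have "character (k - l) x = character k x * character (- l) x" for k l
        using character_add_int[of k "- l" x] by simp
      then show ?thesis
        unfolding P_def by (simp add: cnj_character sum_product mult_ac)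
    qed
    have "(norm (z - w))\<^sup>2 = (norm z)\<^sup>2 - 2 * Re (z * cnj w) + Re (w * cnj w)" for z w :: complex
      by (simp only: cmod_power2) (simp add: power2_eq_square algebra_simps)
    then show ?thesis unfolding cr Px .
  qed
  have "?I (\<lambda>x. (norm (f x - (\<Sum>k\<in>F. c k * character k x)))\<^sup>2) =
      ?I (\<lambda>x. (norm (f x))\<^sup>2) - 2 * Re (?I cross) + Re (?I P)"
    unfolding expand using sq set_integral_Re[OF cross_i] set_integral_Re[OF P_i] by (simp add: set_integral_add set_integral_diff)
  also have "\<dots> = ?I (\<lambda>x. (norm (f x))\<^sup>2) + 2 * pi *
      (\<Sum>k\<in>F. Re (c k * cnj (c k)) - 2 * Re (cnj (c k) * fourier_coeff f k))"
    unfolding int_cross int_P by (simp add: sum_subtractf sum_distrib_left algebra_simps)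
  also have "(\<Sum>k\<in>F. Re (c k * cnj (c k)) - 2 * Re (cnj (c k) * fourier_coeff f k)) =
      (\<Sum>k\<in>F. (norm (c k - fourier_coeff f k))\<^sup>2 - (norm (fourier_coeff f k))\<^sup>2)"
    by (intro sum.cong refl, simp only: cmod_power2) (simp add: power2_eq_square algebra_simps)
  finally show ?thesis by (simp add: sum_subtractf algebra_simps)
qed

lemma bessel:
  assumes "f \<in> borel_measurable lebesgue"
    and "set_integrable lebesgue {0..2*pi} (\<lambda>x. (norm (f x))\<^sup>2)"
    and "finite F"
  shows "2 * pi * (\<Sum>k\<in>F. (norm (fourier_coeff f k))\<^sup>2) \<le>
    (LINT x:{0..2*pi}|lebesgue. (norm (f x))\<^sup>2)"
proof -
  have "0 \<le> (LINT x:{0..2*pi}|lebesgue.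
      (norm (f x - (\<Sum>k\<in>F. fourier_coeff f k * character k x)))\<^sup>2)"
    unfolding set_lebesgue_integral_def by (rule Bochner_Integration.integral_nonneg) simp
  then show ?thesis
    by (simp add: integral_norm_diff_trig_poly[OF assms])
qed

lemma parseval_trig_poly:
  assumes "finite F"
  shows "(LINT x:{0..2*pi}|lebesgue. (norm (\<Sum>k\<in>F. c k * character k x))\<^sup>2) =
    2 * pi * (\<Sum>k\<in>F. (norm (c k))\<^sup>2)"
proof -
  have "fourier_coeff (\<lambda>x. 0) k = 0" for k
    by (simp add: fourier_coeff_def)
  then show ?thesis
    using integral_norm_diff_trig_poly[of "\<lambda>x. 0" F c] assms
    by (simp add: absolutely_integrable_continuous_real)
qed

section \<open>Functions of bounded variation\<close>

text \<open>The total variation on the intervals starting at \<open>a\<close> is a monotone function that controls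
  all increments of \<open>f\<close>.\<close>

lemma bounded_variation_on_dominated:
  fixes f :: "real \<Rightarrow> 'a::real_normed_vector"
  assumes "bounded_variation_on a b f"
  obtains V :: "real \<Rightarrow> real"
  where "\<And>x y. a \<le> x \<Longrightarrow> x \<le> y \<Longrightarrow> y \<le> b \<Longrightarrow> norm (f y - f x) \<le> V y - V x"
proof -
  define var where "var xs = (\<Sum>i<length xs - 1. norm (f (xs ! Suc i) - f (xs ! i)))" for xs
  define P where "P x = {xs. sorted xs \<and> set xs \<subseteq> {a..x}}" for x
  define V where "V x = Sup (var ` P x)" for x
  obtain B where B: "\<And>xs. xs \<in> P b \<Longrightarrow> var xs \<le> B"
    using assms unfolding bounded_variation_on_def P_def var_def by blast
  have ne: "[] \<in> P x" for x by (simp add: P_def)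
  have bdd: "bdd_above (var ` P x)" if "x \<le> b" for x
  proof -
    have "P x \<subseteq> P b" using that by (force simp: P_def)
    then show ?thesis using B by (intro bdd_aboveI2[where M = B]) blast
  qed
  have "norm (f y - f x) \<le> V y - V x" if xy: "a \<le> x" "x \<le> y" "y \<le> b" for x y
  proof -
    have "V x \<le> V y - norm (f y - f x)"
      unfolding V_def[of x]
    proof (rule cSup_least)
      fix v assume "v \<in> var ` P x"
      then obtain xs where xs: "xs \<in> P x" "v = var xs" by blast
      let ?ys = "xs @ [x, y]" and ?m = "length xs"
      have "?ys \<in> P y"
        using xs(1) xy unfolding P_def by (auto simp: sorted_append)
      then have le: "var ?ys \<le> V y"
        unfolding V_def using bdd[OF xy(3)] by (intro cSup_upper) auto
      have "v + norm (f y - f x) =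
          (\<Sum>i<?m - 1. norm (f (?ys ! Suc i) - f (?ys ! i))) +
          (\<Sum>i\<in>{?m}. norm (f (?ys ! Suc i) - f (?ys ! i)))"
        unfolding xs(2) var_def by (auto simp: nth_append intro!: sum.cong)
      also have "\<dots> = (\<Sum>i\<in>{..<?m - 1} \<union> {?m}. norm (f (?ys ! Suc i) - f (?ys ! i)))"
        by (rule sum.union_disjoint[symmetric]) auto
      also have "\<dots> \<le> var ?ys"
        unfolding var_def by (intro sum_mono2) auto
      finally show "v \<le> V y - norm (f y - f x)" using le by simp
    qed (use ne in blast)
    then show ?thesis by simp
  qed
  then show ?thesis by (rule that)
qed

text \<open>From here on \<open>V\<close> is such a dominating function on one period.\<close>

locale torus_bv =
  fixes g :: "real \<Rightarrow> complex" and V :: "real \<Rightarrow> real"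
  assumes periodic: "torus_fun g"
    and dominated: "\<And>x y. 0 \<le> x \<Longrightarrow> x \<le> y \<Longrightarrow> y \<le> 2 * pi \<Longrightarrow> norm (g y - g x) \<le> V y - V x"
begin

definition total_var :: real where "total_var = V (2 * pi) - V 0"

lemma V_mono: "0 \<le> x \<Longrightarrow> x \<le> y \<Longrightarrow> y \<le> 2 * pi \<Longrightarrow> V x \<le> V y"
  using order_trans[OF norm_ge_zero dominated[of x y]] by simp

lemma total_var_nonneg: "0 \<le> total_var"
  using V_mono[of 0 "2*pi"] unfolding total_var_def by simp

lemma periodic_ends: "g (2 * pi) = g 0"
  using periodic unfolding torus_fun_def by (metis add_0)

lemma periodic_int: "g (x + 2 * pi * of_int n) = g x"
proof -
  have nat: "g (x + 2 * pi * of_nat n) = g x" for x n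
  proof (induction n)
    case (Suc n)
    have "g (x + 2 * pi * of_nat (Suc n)) = g ((x + 2 * pi * of_nat n) + 2 * pi)"
      by (simp add: algebra_simps)
    then show ?case using Suc periodic unfolding torus_fun_def by simp
  qed simp
  show ?thesis
  proof (cases n)
    case (nonneg m)
    then show ?thesis using nat by simp
  next
    case (neg m)
    have "x + 2 * pi * of_int n + 2 * pi * of_nat (Suc m) = x"
      unfolding neg by (simp add: algebra_simps)
    then show ?thesis using nat[of "x + 2 * pi * of_int n" "Suc m"] by metis
  qed
qed

text \<open>\<open>V\<close> dominates the increments of the real and imaginary parts, so \<open>Re g + V\<close> and \<open>Im g + V\<close>
  are monotone, hence measurable, on one period.\<close>

lemma borel_measurable_g: "g \<in> borel_measurable borel"
proof -
  let ?S = "{0..2*pi}"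
  have mono: "mono_on ?S V" "mono_on ?S (\<lambda>x. Re (g x) + V x)" "mono_on ?S (\<lambda>x. Im (g x) + V x)"
  proof -
    have *: "\<bar>Re (g y) - Re (g x)\<bar> \<le> V y - V x" "\<bar>Im (g y) - Im (g x)\<bar> \<le> V y - V x"
      if "x \<in> ?S" "y \<in> ?S" "x \<le> y" for x y
      using that dominated[of x y] abs_Re_le_cmod[of "g y - g x"] abs_Im_le_cmod[of "g y - g x"]
      by simp_all
    show "mono_on ?S V" "mono_on ?S (\<lambda>x. Re (g x) + V x)" "mono_on ?S (\<lambda>x. Im (g x) + V x)"
      by (intro mono_onI, frule *, assumption+, linarith)+
  qed
  note m = mono[THEN borel_measurable_mono_on_fnc]
  have "(\<lambda>x. Re (g x) + V x - V x) \<in> borel_measurable (restrict_space borel ?S)"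
       "(\<lambda>x. Im (g x) + V x - V x) \<in> borel_measurable (restrict_space borel ?S)"
    by (intro borel_measurable_diff m)+
  then have "g \<in> borel_measurable (restrict_space borel ?S)"
    unfolding borel_measurable_complex_iff by simp
  then have "(\<lambda>x. indicator ?S x *\<^sub>R g x) \<in> borel_measurable borel"
    by (subst (asm) borel_measurable_restrict_space_iff) auto
  moreover have "(\<lambda>x::real. x - 2 * pi * of_int \<lfloor>x / (2 * pi)\<rfloor>) \<in> borel_measurable borel"
    by measurable
  ultimately have "(\<lambda>x. (\<lambda>x. indicator ?S x *\<^sub>R g x) (x - 2 * pi * of_int \<lfloor>x / (2 * pi)\<rfloor>))
      \<in> borel_measurable borel"
    by (rule measurable_compose[rotated])
  moreover have "x - 2 * pi * of_int \<lfloor>x / (2 * pi)\<rfloor> \<in> ?S" for x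
  proof -
    define n where "n = \<lfloor>x / (2 * pi)\<rfloor>"
    have "of_int n \<le> x / (2 * pi)" "x / (2 * pi) \<le> of_int n + 1"
      unfolding n_def by linarith+
    then have "2 * pi * of_int n \<le> x" "x \<le> 2 * pi * of_int n + 2 * pi"
      by (auto simp: field_simps)
    then show ?thesis unfolding n_def by simp
  qed
  moreover have "g (x - 2 * pi * of_int \<lfloor>x / (2 * pi)\<rfloor>) = g x" for x
    using periodic_int[of x "- \<lfloor>x / (2 * pi)\<rfloor>"] by simp
  ultimately show ?thesis by simp
qed

lemma g_measurable_lebesgue: "g \<in> borel_measurable lebesgue"
  using borel_measurable_g by (intro measurable_completion) simp

lemma norm_g_le: "x \<in> {0..2*pi} \<Longrightarrow> norm (g x) \<le> norm (g 0) + total_var"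
  using dominated[of 0 x] V_mono[of x "2*pi"] norm_triangle_sub[of "g x" "g 0"]
  unfolding total_var_def by auto

lemma g_L2: "g \<in> L2_torus"
proof -
  have "set_integrable lebesgue {0..2*pi} (\<lambda>x. (norm (g x))\<^sup>2)"
  proof (rule set_integrable_bound)
    show "set_integrable lebesgue {0..2*pi} (\<lambda>x. (norm (g 0) + total_var)\<^sup>2)"
      by (intro absolutely_integrable_continuous_real continuous_intros)
    show "set_borel_measurable lebesgue {0..2*pi} (\<lambda>x. (norm (g x))\<^sup>2)"
      unfolding set_borel_measurable_def
      by (intro borel_measurable_scaleR borel_measurable_indicator borel_measurable_power
          measurable_compose[OF g_measurable_lebesgue borel_measurable_norm]) auto
    show "AE x in lebesgue. x \<in> {0..2*pi} \<longrightarrow>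
        norm ((norm (g x))\<^sup>2) \<le> norm ((norm (g 0) + total_var)\<^sup>2)"
      using norm_g_le total_var_nonneg by (intro AE_I2) (auto intro!: power_mono)
  qed
  then show ?thesis
    unfolding L2_torus_def using periodic g_measurable_lebesgue by simp
qed

lemma g_set_integrable: "set_integrable lebesgue {0..2*pi} g"
  using g_L2 unfolding L2_torus_def by (intro L2_imp_set_integrable) auto

text \<open>Integration by parts against the measure \<open>dg\<close>, in the form of an inequality. On a partition of
  mesh \<open>\<delta>\<close> replace \<open>g\<close> by its left end values: the error is at most \<open>\<delta> sup \<bar>\<psi>\<bar>\<close> times the variation of
  \<open>g\<close>, and summation by parts, with no boundary term by periodicity, applies to the step function.\<close>

lemma norm_integral_mult_deriv_le:
  fixes \<phi> \<psi> :: "real \<Rightarrow> complex"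
  assumes deriv: "\<And>x. (\<phi> has_vector_derivative \<psi> x) (at x)"
    and cont: "continuous_on UNIV \<psi>"
    and per: "\<phi> (2 * pi) = \<phi> 0"
    and bound: "\<And>x. norm (\<phi> x) \<le> M"
  shows "norm (integral {0..2*pi} (\<lambda>x. g x * \<psi> x)) \<le> M * total_var"
proof -
  obtain D where D: "\<And>x. x \<in> {0..2*pi} \<Longrightarrow> norm (\<psi> x) \<le> D"
  proof -
    have "compact (\<psi> ` {0..2*pi})"
      by (intro compact_continuous_image continuous_on_subset[OF cont]) auto
    then obtain D where "\<forall>z \<in> \<psi> ` {0..2*pi}. norm z \<le> D"
      using compact_imp_bounded bounded_iff by blast
    then show ?thesis using that by blast
  qed
  have D0: "0 \<le> D" using D[of 0] norm_ge_zero[of "\<psi> 0"] by (simp del: norm_ge_zero)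
  have M0: "0 \<le> M" using bound[of 0] norm_ge_zero[of "\<phi> 0"] by (simp del: norm_ge_zero)
  have int: "(\<lambda>x. g x * \<psi> x) integrable_on {0..2*pi}"
  proof -
    have "set_integrable lebesgue {0..2*pi} (\<lambda>x. g x * \<psi> x)"
    proof (rule set_integrable_bound)
      show "set_integrable lebesgue {0..2*pi} (\<lambda>x. of_real D * g x)"
        using g_set_integrable by simp
      have "\<psi> \<in> borel_measurable lebesgue"
        using borel_measurable_continuous_onI[OF cont] by (intro measurable_completion) simp
      then show "set_borel_measurable lebesgue {0..2*pi} (\<lambda>x. g x * \<psi> x)"
        unfolding set_borel_measurable_def
        by (intro borel_measurable_scaleR borel_measurable_indicator borel_measurable_times
            g_measurable_lebesgue) auto
      show "AE x in lebesgue. x \<in> {0..2*pi} \<longrightarrow>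
          norm (g x * \<psi> x) \<le> norm (of_real D * g x)"
        using D D0 by (intro AE_I2) (auto simp: norm_mult mult.commute intro!: mult_right_mono)
    qed
    then show ?thesis by (rule set_lebesgue_integral_eq_integral(1))
  qed
  have step: "norm (integral {a..b} (\<lambda>x. g x * \<psi> x) - g a * (\<phi> b - \<phi> a)) \<le> D * (b - a) * (V b - V a)"
    if ab: "0 \<le> a" "a \<le> b" "b \<le> 2 * pi" for a b
  proof -
    have sub: "(\<lambda>x. g x * \<psi> x) integrable_on {a..b}"
      by (rule integrable_on_subinterval[OF int]) (use ab in auto)
    have ft: "(\<psi> has_integral (\<phi> b - \<phi> a)) {a..b}"
      using ab by (intro fundamental_theorem_of_calculus has_vector_derivative_at_within[OF deriv])
    have "((\<lambda>x. g x * \<psi> x - g a * \<psi> x) has_integral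
        (integral {a..b} (\<lambda>x. g x * \<psi> x) - g a * (\<phi> b - \<phi> a))) {a..b}"
      by (intro has_integral_diff integrable_integral sub has_integral_mult_right ft)
    moreover have "norm (g x * \<psi> x - g a * \<psi> x) \<le> (V b - V a) * D" if "x \<in> {a..b}" for x
    proof -
      have "norm (g x - g a) \<le> V b - V a"
        using dominated[of a x] V_mono[of x b] that ab by auto
      moreover have "norm (\<psi> x) \<le> D" using D that ab by auto
      ultimately have "norm (g x - g a) * norm (\<psi> x) \<le> (V b - V a) * D"
        using V_mono[of a b] ab by (intro mult_mono) auto
      then show ?thesis by (simp add: norm_mult[symmetric] algebra_simps)
    qed
    ultimately have "norm (integral {a..b} (\<lambda>x. g x * \<psi> x) - g a * (\<phi> b - \<phi> a)) \<le>
        (V b - V a) * D * measure lborel (cbox a b)"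
      using D0 V_mono[of a b] ab
      by (intro has_integral_bound[where f = "\<lambda>x. g x * \<psi> x - g a * \<psi> x"])
         auto
    then show ?thesis using ab by (simp add: mult_ac)
  qed
  have partition: "norm (integral {0..2*pi} (\<lambda>x. g x * \<psi> x)) \<le> M * total_var + D * (2 * pi / n) * total_var"
    if n: "0 < n" for n :: nat
  proof -
    define y where "y i = 2 * pi * real i / real n" for i
    have y0: "y 0 = 0" and yn: "y n = 2 * pi" using n by (simp_all add: y_def)
    have ymono: "y i \<le> y (Suc i)" for i by (simp add: y_def divide_right_mono)
    have ydiff: "y (Suc i) - y i = 2 * pi / n" for i by (simp add: y_def add_divide_distrib[symmetric] diff_divide_distrib[symmetric] algebra_simps)
    have ynn: "0 \<le> y i" for i by (simp add: y_def)
    have yle: "y i \<le> 2 * pi" if "i \<le> n" for i using that n by (simp add: y_def divide_le_eq)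
    have approx: "m \<le> n \<Longrightarrow> norm (integral {0..y m} (\<lambda>x. g x * \<psi> x) -
        (\<Sum>i<m. g (y i) * (\<phi> (y (Suc i)) - \<phi> (y i)))) \<le> D * (2 * pi / n) * (V (y m) - V 0)" for m
    proof (induction m)
      case (Suc m)
      have "integral {0..y (Suc m)} (\<lambda>x. g x * \<psi> x) =
          integral {0..y m} (\<lambda>x. g x * \<psi> x) + integral {y m..y (Suc m)} (\<lambda>x. g x * \<psi> x)"
        by (rule Henstock_Kurzweil_Integration.integral_combine[symmetric])
           (use ynn ymono yle[of "Suc m"] Suc.prems in
            \<open>auto intro: integrable_on_subinterval[OF int]\<close>)
      moreover have "norm (integral {y m..y (Suc m)} (\<lambda>x. g x * \<psi> x) -
          g (y m) * (\<phi> (y (Suc m)) - \<phi> (y m))) \<le> D * (2 * pi / n) * (V (y (Suc m)) - V (y m))"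
        using step[of "y m" "y (Suc m)"] ynn ymono yle[of "Suc m"] Suc.prems by (simp add: ydiff)
      moreover note Suc.IH
      ultimately show ?case
        using Suc.prems
          norm_triangle_le[of "integral {0..y m} (\<lambda>x. g x * \<psi> x) -
              (\<Sum>i<m. g (y i) * (\<phi> (y (Suc i)) - \<phi> (y i)))"
            "integral {y m..y (Suc m)} (\<lambda>x. g x * \<psi> x) - g (y m) * (\<phi> (y (Suc m)) - \<phi> (y m))"]
        by (simp add: right_diff_distrib add_diff_add)
    qed (simp add: y0)
    have parts: "(\<Sum>i<m. g (y i) * (\<phi> (y (Suc i)) - \<phi> (y i))) =
        g (y m) * \<phi> (y m) - g (y 0) * \<phi> (y 0) - (\<Sum>i<m. \<phi> (y (Suc i)) * (g (y (Suc i)) - g (y i)))" for m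
      by (induction m) (simp_all add: algebra_simps)
    have "norm (\<Sum>i<n. \<phi> (y (Suc i)) * (g (y (Suc i)) - g (y i))) \<le>
        (\<Sum>i<n. M * (V (y (Suc i)) - V (y i)))"
    proof (rule sum_norm_le)
      fix i assume "i \<in> {..<n}"
      then show "norm (\<phi> (y (Suc i)) * (g (y (Suc i)) - g (y i))) \<le> M * (V (y (Suc i)) - V (y i))"
        using dominated[of "y i" "y (Suc i)"] ynn ymono yle[of "Suc i"] M0
        unfolding norm_mult by (intro mult_mono bound) auto
    qed
    also have "\<dots> = M * total_var"
      by (simp add: sum_distrib_left[symmetric] sum_lessThan_telescope[of "\<lambda>i. V (y i)"] y0 yn
          total_var_def)
    finally have "norm (\<Sum>i<n. g (y i) * (\<phi> (y (Suc i)) - \<phi> (y i))) \<le> M * total_var"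
      unfolding parts y0 yn periodic_ends per by simp
    moreover have "norm (integral {0..2*pi} (\<lambda>x. g x * \<psi> x) -
        (\<Sum>i<n. g (y i) * (\<phi> (y (Suc i)) - \<phi> (y i)))) \<le> D * (2 * pi / n) * total_var"
      using approx[of n] by (simp add: yn total_var_def)
    ultimately show ?thesis
      using norm_triangle_sub[of "integral {0..2*pi} (\<lambda>x. g x * \<psi> x)"
          "\<Sum>i<n. g (y i) * (\<phi> (y (Suc i)) - \<phi> (y i))"] by linarith
  qed
  have "(\<lambda>n. M * total_var + D * (2 * pi / real n) * total_var) \<longlonglongrightarrow> M * total_var + D * 0 * total_var"
    by (intro tendsto_intros lim_const_over_n)
  then have "norm (integral {0..2*pi} (\<lambda>x. g x * \<psi> x)) \<le> M * total_var + D * 0 * total_var"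
    using partition by (intro LIMSEQ_le_const) (auto intro!: exI[of _ 1])
  then show ?thesis by simp
qed

text \<open>The Fourier coefficients of \<open>dg\<close> are \<open>\<i> k\<close> times those of \<open>g\<close>: a trigonometric sum weighted with
  the coefficients of \<open>g\<close> is the convolution of \<open>dg\<close> with the kernel \<open>\<Sum> c\<^sub>k e\<^sub>k / (\<i> k)\<close>.\<close>

lemma norm_weighted_trig_sum_le:
  assumes "finite F" and "0 \<notin> F"
    and bound: "\<And>y. norm (\<Sum>k\<in>F. c k / (\<i> * of_int k) * character k y) \<le> M"
  shows "norm (\<Sum>k\<in>F. c k * character k x * fourier_coeff g k) \<le> total_var / (2 * pi) * M"
proof -
  define \<phi> where "\<phi> y = - (\<Sum>k\<in>F. c k / (\<i> * of_int k) * (character k x * character (- k) y))" for y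
  define \<psi> where "\<psi> y = (\<Sum>k\<in>F. c k * character k x * character (- k) y)" for y
  have \<phi>_eq: "\<phi> y = - (\<Sum>k\<in>F. c k / (\<i> * of_int k) * character k (x - y))" for y
  proof -
    have "character k (x - y) = character k x * character (- k) y" for k
      using character_add[of k x "- y"] by (simp add: character_def)
    then show ?thesis by (simp add: \<phi>_def)
  qed
  have "(\<phi> has_vector_derivative \<psi> y) (at y)" for y
  proof -
    have "(\<phi> has_vector_derivative - (\<Sum>k\<in>F. c k / (\<i> * of_int k) *
        (character k x * (\<i> * of_int (- k) * character (- k) y)))) (at y)"
      unfolding \<phi>_def by (intro derivative_intros has_vector_derivative_mult_right)
    moreover have "- (\<Sum>k\<in>F. c k / (\<i> * of_int k) *
        (character k x * (\<i> * of_int (- k) * character (- k) y))) = \<psi> y"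
      unfolding \<psi>_def sum_negf[symmetric] using \<open>0 \<notin> F\<close> by (intro sum.cong) auto
    ultimately show ?thesis by simp
  qed
  moreover have "continuous_on UNIV \<psi>"
    unfolding \<psi>_def by (intro continuous_intros)
  moreover have "\<phi> (2 * pi) = \<phi> 0" by (simp add: \<phi>_def)
  moreover have "norm (\<phi> y) \<le> M" for y
    unfolding \<phi>_eq using bound by simp
  ultimately have "norm (integral {0..2*pi} (\<lambda>y. g y * \<psi> y)) \<le> M * total_var"
    by (rule norm_integral_mult_deriv_le)
  moreover have "integral {0..2*pi} (\<lambda>y. g y * \<psi> y) =
      2 * pi * (\<Sum>k\<in>F. c k * character k x * fourier_coeff g k)"
  proof -
    have i: "set_integrable lebesgue {0..2*pi} (\<lambda>y. c k * character k x * (g y * character (- k) y))" for k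
      by (intro set_integrable_mult_right set_integrable_mult_character g_set_integrable)
    have eq: "(\<lambda>y. g y * \<psi> y) = (\<lambda>y. \<Sum>k\<in>F. c k * character k x * (g y * character (- k) y))"
      by (simp add: \<psi>_def sum_distrib_left mult_ac)
    have "integral {0..2*pi} (\<lambda>y. g y * \<psi> y) =
        (LINT y:{0..2*pi}|lebesgue. \<Sum>k\<in>F. c k * character k x * (g y * character (- k) y))"
      unfolding eq by (intro set_lebesgue_integral_eq_integral(2)[symmetric] set_integrable_sum i)
    also have "\<dots> = (\<Sum>k\<in>F. c k * character k x * (2 * pi * fourier_coeff g k))"
      by (simp only: set_integral_sum i set_integral_mult_right) (simp add: fourier_coeff_eq)
    finally show ?thesis by (simp add: sum_distrib_left mult_ac)
  qed
  ultimately have "2 * pi * norm (\<Sum>k\<in>F. c k * character k x * fourier_coeff g k) \<le> M * total_var"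
    by (simp add: norm_mult)
  then show ?thesis by (simp add: field_simps)
qed

end

section \<open>Quadratic Weyl sums for almost every time\<close>

text \<open>Van der Corput differencing: in \<open>\<bar>\<Sum> a\<^sub>k\<bar>\<^sup>2\<close> collect the terms with a fixed difference \<open>h\<close> of
  the two indices.\<close>

lemma norm_sum_squared_le_correlations:
  fixes a :: "nat \<Rightarrow> complex"
  shows "(norm (\<Sum>k<N. a k))\<^sup>2 \<le>
    (\<Sum>k<N. (norm (a k))\<^sup>2) + 2 * (\<Sum>h\<in>{1..<N}. norm (\<Sum>l<N - h. a (l + h) * cnj (a l)))"
proof -
  define T where "T = (\<Sum>k<N. \<Sum>l<k. a k * cnj (a l))"
  have "(norm (\<Sum>k<N. a k))\<^sup>2 = (\<Sum>k<N. (norm (a k))\<^sup>2) + 2 * Re T"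
    unfolding T_def
  proof (induction N)
    case (Suc N)
    have sq: "(norm (z + w))\<^sup>2 = (norm z)\<^sup>2 + (norm w)\<^sup>2 + 2 * Re (w * cnj z)" for z w :: complex
      by (simp only: cmod_power2) (simp add: power2_eq_square algebra_simps)
    show ?case
      unfolding sum.lessThan_Suc sq Suc.IH by (simp add: sum_distrib_left cnj_sum)
  qed simp
  moreover have "T = (\<Sum>h\<in>{1..<N}. \<Sum>l<N - h. a (l + h) * cnj (a l))"
  proof -
    have "T = (\<Sum>(k, l)\<in>Sigma {..<N} (\<lambda>k. {..<k}). a k * cnj (a l))"
      unfolding T_def by (simp add: sum.Sigma)
    also have "\<dots> = (\<Sum>(h, l)\<in>Sigma {1..<N} (\<lambda>h. {..<N - h}). a (l + h) * cnj (a l))"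
      by (rule sum.reindex_bij_witness[of _ "\<lambda>(h, l). (l + h, l)" "\<lambda>(k, l). (k - l, l)"]) auto
    also have "\<dots> = (\<Sum>h\<in>{1..<N}. \<Sum>l<N - h. a (l + h) * cnj (a l))"
      by (simp add: sum.Sigma)
    finally show ?thesis .
  qed
  moreover have "Re T \<le> norm T" by (rule complex_Re_le_cmod)
  ultimately show ?thesis
    using norm_sum[of "\<lambda>h. \<Sum>l<N - h. a (l + h) * cnj (a l)" "{1..<N}"] by simp
qed

lemma norm_geometric_cis_le:
  assumes "sin s \<noteq> 0"
  shows "norm (\<Sum>l<m. cis (- (2 * s)) ^ l) \<le> 1 / \<bar>sin s\<bar>"
proof -
  let ?w = "cis (- (2 * s))"
  have "(norm (1 - ?w))\<^sup>2 = (2 * \<bar>sin s\<bar>)\<^sup>2"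
  proof -
    have "(norm (1 - ?w))\<^sup>2 = (1 - cos (2 * s))\<^sup>2 + (sin (2 * s))\<^sup>2"
      by (simp add: cmod_power2)
    also have "\<dots> = (2 * sin s * sin s)\<^sup>2 + (2 * sin s * cos s)\<^sup>2"
      by (simp add: cos_double_sin sin_double power2_eq_square)
    also have "\<dots> = 4 * (sin s)\<^sup>2"
    proof -
      have "(2 * a * a)\<^sup>2 + (2 * a * b)\<^sup>2 = 4 * a\<^sup>2 * (a\<^sup>2 + b\<^sup>2)" for a b :: real
        by (simp add: power2_eq_square algebra_simps)
      then show ?thesis by simp
    qed
    finally show ?thesis by (simp add: power_mult_distrib)
  qed
  then have n: "norm (1 - ?w) = 2 * \<bar>sin s\<bar>"
    by (rule power2_eq_imp_eq) auto
  then have "?w \<noteq> 1" using assms by auto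
  then have "norm (\<Sum>l<m. ?w ^ l) = norm (1 - ?w ^ m) / (2 * \<bar>sin s\<bar>)"
    using sum_gp_strict[of ?w m] n by (simp add: norm_divide)
  also have "norm (1 - ?w ^ m) \<le> 2"
    using norm_triangle_ineq4[of 1 "?w ^ m"] by (simp add: norm_power)
  finally show ?thesis using assms by (simp add: divide_right_mono field_simps)
qed

definition weyl_sum :: "real \<Rightarrow> nat \<Rightarrow> real \<Rightarrow> complex" where
  "weyl_sum t N x = (\<Sum>k=1..N. cis (real k * x - t * (real k)\<^sup>2))"

text \<open>The bound \<open>min N (1 / s)\<close> of a geometric sum is traded for a product: a power of \<open>N\<close> as small as
  desired and a function of \<open>s\<close> alone that is integrable at \<open>0\<close>. This makes a single convergent
  series in \<open>t\<close> control all \<open>N\<close>.\<close>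

lemma min_le_interpolation:
  fixes s \<eta> :: real
  assumes "0 < s" "0 < \<eta>" "\<eta> < 1" and y: "0 \<le> y" "y \<le> real N" "y \<le> 1 / s" and "0 < N"
  shows "y \<le> real N powr \<eta> * s powr (\<eta> - 1)"
proof -
  have "y = y powr \<eta> * y powr (1 - \<eta>)"
    using y by (cases "y = 0") (simp_all add: powr_add[symmetric])
  also have "\<dots> \<le> real N powr \<eta> * (1 / s) powr (1 - \<eta>)"
    using assms by (intro mult_mono powr_mono2) auto
  also have "(1 / s) powr (1 - \<eta>) = s powr (\<eta> - 1)"
    using assms by (simp add: powr_divide powr_minus_divide[symmetric])
  finally show ?thesis .
qed

text \<open>The phase of a correlation of the Weyl sum is linear in the summation index, and \<open>x\<close> only contributes a constant
  factor: hence the uniformity in \<open>x\<close>.\<close>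

lemma norm_weyl_sum_squared_le:
  assumes ns: "\<And>h::nat. 1 \<le> h \<Longrightarrow> sin (real h * t) \<noteq> 0" and "0 < \<eta>" "\<eta> < 1"
  shows "(norm (weyl_sum t N x))\<^sup>2 \<le>
    real N + 2 * (real N powr \<eta> * (\<Sum>h\<in>{1..<N}. \<bar>sin (real h * t)\<bar> powr (\<eta> - 1)))"
proof -
  define a where "a k = cis (real (Suc k) * x - t * (real (Suc k))\<^sup>2)" for k
  have norm_a: "norm (a k) = 1" for k by (simp add: a_def)
  have "weyl_sum t N x = (\<Sum>k<N. a k)"
    unfolding weyl_sum_def a_def by (rule sum.reindex_bij_witness[of _ Suc "\<lambda>k. k - 1"]) auto
  moreover have "norm (\<Sum>l<N - h. a (l + h) * cnj (a l)) \<le> real N powr \<eta> * \<bar>sin (real h * t)\<bar> powr (\<eta> - 1)"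
    if h: "h \<in> {1..<N}" for h
  proof -
    have "a (l + h) * cnj (a l) =
        cis (real h * x - t * (real h)\<^sup>2 - 2 * (real h * t)) * cis (- (2 * (real h * t))) ^ l" for l
      unfolding a_def Complex.DeMoivre cis_cnj cis_mult
      by (rule arg_cong[of _ _ cis]) (simp add: power2_eq_square algebra_simps)
    then have eq: "norm (\<Sum>l<N - h. a (l + h) * cnj (a l)) = norm (\<Sum>l<N - h. cis (- (2 * (real h * t))) ^ l)"
      by (simp add: sum_distrib_left[symmetric] norm_mult)
    have "norm (\<Sum>l<N - h. cis (- (2 * (real h * t))) ^ l) \<le> real N"
      by (rule order_trans[OF norm_sum]) (simp add: norm_power)
    moreover have "norm (\<Sum>l<N - h. cis (- (2 * (real h * t))) ^ l) \<le> 1 / \<bar>sin (real h * t)\<bar>"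
      using ns h by (intro norm_geometric_cis_le) auto
    ultimately show ?thesis
      unfolding eq using ns[of h] h assms by (intro min_le_interpolation) auto
  qed
  then have "(\<Sum>h\<in>{1..<N}. norm (\<Sum>l<N - h. a (l + h) * cnj (a l))) \<le>
      (\<Sum>h\<in>{1..<N}. real N powr \<eta> * \<bar>sin (real h * t)\<bar> powr (\<eta> - 1))"
    by (rule sum_mono)
  ultimately show ?thesis
    using norm_sum_squared_le_correlations[of a N] norm_a by (simp add: sum_distrib_left[symmetric])
qed

lemma half_le_sin:
  assumes "0 \<le> s" "s \<le> pi / 2"
  shows "s / 2 \<le> sin s"
proof (cases "s \<le> pi / 3")
  case True
  have "\<exists>d\<ge>1/2. sin s - sin 0 = d * (s - 0)" if "0 < s"
  proof -
    have "\<exists>z. 0 < z \<and> z < s \<and> sin s - sin 0 = (s - 0) * cos z"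
      by (intro MVT2) (use that in \<open>auto intro!: derivative_eq_intros\<close>)
    then obtain z where z: "0 < z" "z < s" "sin s - sin 0 = (s - 0) * cos z" by blast
    have "cos (pi / 3) \<le> cos z"
      using z True by (intro cos_monotone_0_pi_le) auto
    then show ?thesis using z by (auto simp: cos_60 mult.commute)
  qed
  then show ?thesis using assms
    by (cases "s = 0") (auto simp: mult.commute[of _ s] intro: mult_left_mono[of "1/2", simplified])
next
  case False
  have "s / 2 \<le> 4 / 5" using assms pi_less_4 pi_approx by simp
  also have "4 / 5 \<le> sqrt 3 / 2"
    using real_le_rsqrt[of "8/5" 3] by (simp add: power2_eq_square)
  also have "\<dots> = sin (pi / 3)" by (simp add: sin_60)
  also have "\<dots> \<le> sin s"
    using False assms by (intro sin_monotone_2pi_le) auto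
  finally show ?thesis .
qed

lemma nn_integral_sin_powr_period_finite:
  assumes "0 < \<eta>" "\<eta> < 1"
  shows "(\<integral>\<^sup>+s. ennreal (\<bar>sin s\<bar> powr (\<eta> - 1)) * indicator {- (pi/2)..pi/2} s \<partial>lborel) < \<infinity>"
proof -
  let ?H = "\<lambda>s. ennreal (indicator {0..pi/2} s * (2 powr (1 - \<eta>) * s powr (\<eta> - 1)))"
  have "((\<lambda>s. s powr (\<eta> - 1)) has_integral ((pi/2) powr \<eta> / \<eta>)) {0..pi/2}"
    using has_integral_powr_from_0[of "\<eta> - 1" "pi/2"] assms by simp
  then have "((\<lambda>s. 2 powr (1 - \<eta>) * s powr (\<eta> - 1)) has_integral (2 powr (1 - \<eta>) * ((pi/2) powr \<eta> / \<eta>))) {0..pi/2}"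
    by (rule has_integral_mult_right)
  then have fin: "integral\<^sup>N lborel ?H < \<infinity>"
    by (subst nn_integral_has_integral_lebesgue) auto
  have refl: "integral\<^sup>N lborel (\<lambda>s. ?H (- s)) = integral\<^sup>N lborel ?H"
    using nn_integral_real_affine[of ?H "-1" 0] by simp
  have "(\<integral>\<^sup>+s. ennreal (\<bar>sin s\<bar> powr (\<eta> - 1)) * indicator {- (pi/2)..pi/2} s \<partial>lborel) \<le>
      (\<integral>\<^sup>+s. ?H s + ?H (- s) \<partial>lborel)"
  proof (rule nn_integral_mono)
    fix s :: real
    have pos: "\<bar>sin s\<bar> powr (\<eta> - 1) \<le> 2 powr (1 - \<eta>) * s powr (\<eta> - 1)" if "0 \<le> s" "s \<le> pi/2" for s :: real
    proof (cases "s = 0")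
      case False
      have "\<bar>sin s\<bar> powr (\<eta> - 1) \<le> (s / 2) powr (\<eta> - 1)"
        using half_le_sin[of s] that False assms by (intro powr_mono2') auto
      also have "\<dots> = 2 powr (1 - \<eta>) * s powr (\<eta> - 1)"
        using that by (simp add: powr_divide powr_minus_divide[of 2 "1 - \<eta>", simplified] field_simps)
      finally show ?thesis .
    qed simp
    show "ennreal (\<bar>sin s\<bar> powr (\<eta> - 1)) * indicator {- (pi/2)..pi/2} s \<le> ?H s + ?H (- s)"
    proof (cases "s \<in> {- (pi/2)..pi/2}")
      case True
      show ?thesis
      proof (cases "0 \<le> s")
        case pos': True
        have "ennreal (\<bar>sin s\<bar> powr (\<eta> - 1)) * indicator {- (pi/2)..pi/2} s \<le> ?H s"
          using pos[of s] True pos' by (auto intro!: ennreal_leI)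
        then show ?thesis by (simp add: add_increasing2)
      next
        case neg': False
        have "ennreal (\<bar>sin s\<bar> powr (\<eta> - 1)) * indicator {- (pi/2)..pi/2} s \<le> ?H (- s)"
          using pos[of "- s"] True neg' by (auto intro!: ennreal_leI)
        then show ?thesis by (simp add: add_increasing)
      qed
    qed simp
  qed
  also have "\<dots> = integral\<^sup>N lborel ?H + integral\<^sup>N lborel (\<lambda>s. ?H (- s))"
    by (rule nn_integral_add) auto
  also have "\<dots> < \<infinity>" using fin unfolding refl by simp
  finally show ?thesis .
qed

text \<open>After substitution the interval of integration is covered by \<open>2 n h + 1\<close> periods of \<open>\<bar>sin\<bar>\<close>, while
  the substitution gains a factor \<open>1 / h\<close>: the bound does not depend on \<open>h\<close>.\<close>

lemma nn_integral_sin_powr_scaled_le: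
  assumes "1 \<le> h"
  shows "(\<integral>\<^sup>+t. ennreal (\<bar>sin (real h * t)\<bar> powr b) * indicator {- (real n * pi)..real n * pi} t \<partial>lborel) \<le>
    (2 * of_nat n + 1) * (\<integral>\<^sup>+s. ennreal (\<bar>sin s\<bar> powr b) * indicator {- (pi/2)..pi/2} s \<partial>lborel)"
    (is "?X \<le> _ * ?I")
proof -
  let ?F = "\<lambda>s. ennreal (\<bar>sin s\<bar> powr b)"
  have shift: "(\<integral>\<^sup>+s. ?F s * indicator {of_int m * pi - pi/2..of_int m * pi + pi/2} s \<partial>lborel) = ?I" for m :: int
  proof -
    have sin_shift: "\<bar>sin (of_int m * pi + s)\<bar> = \<bar>sin s\<bar>" for s
    proof -
      have z: "sin (of_int m * pi) = 0" by (auto simp: sin_zero_iff_int2)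
      then have "(cos (of_int m * pi))\<^sup>2 = 1" by (simp add: cos_squared_eq)
      then have "\<bar>cos (of_int m * pi)\<bar> = 1" by (simp add: abs_square_eq_1)
      then show ?thesis by (simp add: sin_add z abs_mult)
    qed
    have "(\<integral>\<^sup>+s. ?F s * indicator {of_int m * pi - pi/2..of_int m * pi + pi/2} s \<partial>lborel) =
       (\<integral>\<^sup>+s. ?F (of_int m * pi + s) * indicator {of_int m * pi - pi/2..of_int m * pi + pi/2} (of_int m * pi + s) \<partial>lborel)"
      using nn_integral_real_affine[of "\<lambda>s. ?F s * indicator {of_int m * pi - pi/2..of_int m * pi + pi/2} s" 1 "of_int m * pi"]
      by simp
    also have "\<dots> = ?I"
      by (intro nn_integral_cong) (auto simp: sin_shift indicator_def)
    finally show ?thesis .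
  qed
  define p where "p = n * h"
  have scale: "?X = ennreal (1 / real h) * (\<integral>\<^sup>+s. ?F s * indicator {- (real p * pi)..real p * pi} s \<partial>lborel)"
  proof -
    have "?X = ennreal \<bar>1 / real h\<bar> * (\<integral>\<^sup>+s. ennreal (\<bar>sin (real h * (0 + 1 / real h * s))\<bar> powr b) *
        indicator {- (real n * pi)..real n * pi} (0 + 1 / real h * s) \<partial>lborel)"
      using assms by (intro nn_integral_real_affine) auto
    also have "(\<lambda>s. ennreal (\<bar>sin (real h * (0 + 1 / real h * s))\<bar> powr b) *
        indicator {- (real n * pi)..real n * pi} (0 + 1 / real h * s)) =
        (\<lambda>s. ?F s * (indicator {- (real p * pi)..real p * pi} s :: ennreal))"
    proof
      fix s :: real
      have "- (real n * pi) \<le> s / real h \<longleftrightarrow> - (real p * pi) \<le> s"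
           "s / real h \<le> real n * pi \<longleftrightarrow> s \<le> real p * pi"
        using assms by (simp_all add: pos_le_divide_eq pos_divide_le_eq p_def mult_ac)
      then show "ennreal (\<bar>sin (real h * (0 + 1 / real h * s))\<bar> powr b) *
        indicator {- (real n * pi)..real n * pi} (0 + 1 / real h * s) =
        ?F s * (indicator {- (real p * pi)..real p * pi} s :: ennreal)"
        using assms by (simp add: indicator_def)
    qed
    finally show ?thesis by simp
  qed
  have "(\<integral>\<^sup>+s. ?F s * indicator {- (real p * pi)..real p * pi} s \<partial>lborel) \<le>
      (\<integral>\<^sup>+s. (\<Sum>m\<in>{- int p..int p}. ?F s * indicator {of_int m * pi - pi/2..of_int m * pi + pi/2} s) \<partial>lborel)"
  proof (rule nn_integral_mono)
    fix s :: real
    show "?F s * indicator {- (real p * pi)..real p * pi} s \<le>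
      (\<Sum>m\<in>{- int p..int p}. ?F s * indicator {of_int m * pi - pi/2..of_int m * pi + pi/2} s)"
    proof (cases "s \<in> {- (real p * pi)..real p * pi}")
      case True
      define m where "m = round (s / pi)"
      have "\<bar>of_int m - s / pi\<bar> \<le> 1 / 2" unfolding m_def by (rule of_int_round_abs_le)
      then have "of_int m - 1/2 \<le> s / pi" "s / pi \<le> of_int m + 1/2" by linarith+
      then have "(of_int m - 1/2) * pi \<le> s" "s \<le> (of_int m + 1/2) * pi"
        using pos_le_divide_eq[OF pi_gt_zero] pos_divide_le_eq[OF pi_gt_zero] by blast+
      then have s: "s \<in> {of_int m * pi - pi/2..of_int m * pi + pi/2}"
        by (simp add: algebra_simps)
      have "- real p \<le> s / pi" "s / pi \<le> real p"
        using True by (simp_all add: pos_le_divide_eq pos_divide_le_eq)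
      then have "round (of_int (- int p) :: real) \<le> m" "m \<le> round (of_int (int p) :: real)"
        unfolding m_def by (intro round_mono; simp)+
      then have m: "m \<in> {- int p..int p}" by (simp only: round_of_int) simp
      have "?F s * indicator {- (real p * pi)..real p * pi} s =
          (\<Sum>m\<in>{m}. ?F s * indicator {of_int m * pi - pi/2..of_int m * pi + pi/2} s)"
        using True s by simp
      also have "\<dots> \<le> (\<Sum>m\<in>{- int p..int p}. ?F s * indicator {of_int m * pi - pi/2..of_int m * pi + pi/2} s)"
        using m by (intro sum_mono2) auto
      finally show ?thesis .
    qed simp
  qed
  also have "\<dots> = (\<Sum>m\<in>{- int p..int p}.
      \<integral>\<^sup>+s. ?F s * indicator {of_int m * pi - pi/2..of_int m * pi + pi/2} s \<partial>lborel)"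
    by (rule nn_integral_sum) simp
  also have "\<dots> = (\<Sum>m\<in>{- int p..int p}. ?I)"
    by (intro sum.cong refl shift)
  also have "\<dots> = ennreal (2 * real p + 1) * ?I"
  proof -
    have "nat (2 * int p + 1) = 2 * p + 1" by simp
    moreover have "ennreal (2 * real p + 1) = of_nat (2 * p + 1)"
      unfolding ennreal_of_nat_eq_real_of_nat by simp
    ultimately show ?thesis by (simp add: add.commute)
  qed
  finally have "?X \<le> ennreal (1 / real h) * (ennreal (2 * real p + 1) * ?I)"
    unfolding scale by (intro mult_left_mono) auto
  also have "\<dots> = ennreal (1 / real h * (2 * real p + 1)) * ?I"
    by (subst ennreal_mult) (simp_all only: mult.assoc, simp_all)
  also have "\<dots> \<le> ennreal (2 * real n + 1) * ?I"
    using assms by (intro mult_right_mono ennreal_leI) (simp_all add: p_def field_simps)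
  also have "ennreal (2 * real n + 1) = 2 * of_nat n + 1"
  proof -
    have "ennreal (2 * real n + 1) = of_nat (2 * n + 1)"
      unfolding ennreal_of_nat_eq_real_of_nat by simp
    then show ?thesis by (simp add: add.commute)
  qed
  finally show ?thesis .
qed

lemma AE_sin_multiples_nonzero: "AE t in lborel. \<forall>h::nat. 1 \<le> h \<longrightarrow> sin (real h * t) \<noteq> 0"
proof -
  have "AE t in lborel. 1 \<le> h \<longrightarrow> sin (real h * t) \<noteq> 0" for h :: nat
  proof (cases "1 \<le> h")
    case True
    have "{t. sin (real h * t) = 0} \<subseteq> range (\<lambda>m::int. of_int m * pi / real h)"
      using True by (auto simp: sin_zero_iff_int2 field_simps intro!: image_eqI)
    then have "countable {t. sin (real h * t) = 0}"
      by (rule countable_subset) simp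
    then show ?thesis
      using True countable_imp_null_set_lborel by (intro AE_I'[of "{t. sin (real h * t) = 0}"]) auto
  qed simp
  then show ?thesis by (simp add: AE_all_countable)
qed

text \<open>By Tonelli the series \<open>\<Sum> h\<^bsup>-1-\<eta>\<^esup> \<bar>sin (h t)\<bar>\<^bsup>\<eta>-1\<^esup>\<close> has a finite integral over every bounded set, so
  it converges almost everywhere.\<close>

lemma AE_summable_sin_powr:
  assumes "0 < \<eta>" "\<eta> < 1"
  shows "AE t in lborel. summable (\<lambda>h. real h powr (- 1 - \<eta>) * \<bar>sin (real h * t)\<bar> powr (\<eta> - 1))"
proof -
  define f where "f h t = real h powr (- 1 - \<eta>) * \<bar>sin (real h * t)\<bar> powr (\<eta> - 1)" for h :: nat and t
  have [measurable]: "f h \<in> borel_measurable borel" for h unfolding f_def by measurable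
  let ?I = "(\<integral>\<^sup>+s. ennreal (\<bar>sin s\<bar> powr (\<eta> - 1)) * indicator {- (pi/2)..pi/2} s \<partial>lborel)"
  have "AE t in lborel. (\<Sum>h. ennreal (f h t) * indicator {- (real n * pi)..real n * pi} t) \<noteq> \<infinity>" for n :: nat
  proof (rule nn_integral_PInf_AE)
    have "(\<integral>\<^sup>+t. (\<Sum>h. ennreal (f h t) * indicator {- (real n * pi)..real n * pi} t) \<partial>lborel) =
        (\<Sum>h. \<integral>\<^sup>+t. ennreal (f h t) * indicator {- (real n * pi)..real n * pi} t \<partial>lborel)"
      by (rule nn_integral_suminf) measurable
    also have "\<dots> \<le> (\<Sum>h. ennreal (real h powr (- 1 - \<eta>)) * ((2 * of_nat n + 1) * ?I))"
    proof (intro suminf_le summableI)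
      fix h :: nat
      have "(\<integral>\<^sup>+t. ennreal (f h t) * indicator {- (real n * pi)..real n * pi} t \<partial>lborel) =
          ennreal (real h powr (- 1 - \<eta>)) * (\<integral>\<^sup>+t. ennreal (\<bar>sin (real h * t)\<bar> powr (\<eta> - 1)) *
            indicator {- (real n * pi)..real n * pi} t \<partial>lborel)"
        by (subst nn_integral_cmult[symmetric]) (auto simp: f_def ennreal_mult mult.assoc)
      also have "\<dots> \<le> ennreal (real h powr (- 1 - \<eta>)) * ((2 * of_nat n + 1) * ?I)"
        by (cases "h = 0") (auto intro!: mult_left_mono nn_integral_sin_powr_scaled_le)
      finally show "(\<integral>\<^sup>+t. ennreal (f h t) * indicator {- (real n * pi)..real n * pi} t \<partial>lborel) \<le> \<dots>" .
    qed
    also have "\<dots> = (\<Sum>h. ennreal (real h powr (- 1 - \<eta>))) * ((2 * of_nat n + 1) * ?I)"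
      by simp
    also have "(\<Sum>h. ennreal (real h powr (- 1 - \<eta>))) = ennreal (\<Sum>h. real h powr (- 1 - \<eta>))"
      using assms by (intro suminf_ennreal2) (auto simp: summable_real_powr_iff)
    also have "ennreal (\<Sum>h. real h powr (- 1 - \<eta>)) * ((2 * of_nat n + 1) * ?I) < \<infinity>"
      using nn_integral_sin_powr_period_finite[OF assms]
      by (auto simp: ennreal_mult_less_top ennreal_mult_eq_top_iff less_top[symmetric] of_nat_less_top)
    finally show "(\<integral>\<^sup>+t. (\<Sum>h. ennreal (f h t) * indicator {- (real n * pi)..real n * pi} t) \<partial>lborel) \<noteq> \<infinity>"
      by simp
  qed measurable
  then have "AE t in lborel. \<forall>n::nat. (\<Sum>h. ennreal (f h t) * indicator {- (real n * pi)..real n * pi} t) \<noteq> \<infinity>"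
    by (simp add: AE_all_countable)
  then show ?thesis
  proof (rule AE_mp, intro AE_I2 impI)
    fix t :: real
    assume fin: "\<forall>n::nat. (\<Sum>h. ennreal (f h t) * indicator {- (real n * pi)..real n * pi} t) \<noteq> \<infinity>"
    obtain n :: nat where "\<bar>t\<bar> / pi \<le> real n" using real_arch_simple by blast
    then have "t \<in> {- (real n * pi)..real n * pi}" by (auto simp: pos_divide_le_eq)
    then have "(\<Sum>h. ennreal (f h t)) \<noteq> top" using fin[rule_format, of n] by simp
    then have "summable (\<lambda>h. f h t)"
      by (intro summable_suminf_not_top) (auto simp: f_def)
    then show "summable (\<lambda>h. real h powr (- 1 - \<eta>) * \<bar>sin (real h * t)\<bar> powr (\<eta> - 1))"
      by (simp add: f_def)
  qed
qed

definition weyl_bound :: "real \<Rightarrow> real \<Rightarrow> bool" where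
  "weyl_bound t b \<longleftrightarrow> (\<exists>C\<ge>0. \<forall>N x. norm (weyl_sum t N x) \<le> C * real N powr b)"

text \<open>If \<open>\<Phi>\<close> is the sum of the series above, then \<open>\<Sum>\<^sub>h\<^sub><\<^sub>N \<bar>sin (h t)\<bar>\<^bsup>\<eta>-1\<^esup> \<le> N\<^bsup>1+\<eta>\<^esup> \<Phi>\<close>, and the square of the Weyl sum
  is at most \<open>N + 2 N\<^bsup>\<eta>\<^esup> N\<^bsup>1+\<eta>\<^esup> \<Phi>\<close>.\<close>

lemma AE_weyl_bound_exponent:
  assumes "0 < \<eta>" "\<eta> < 1"
  shows "AE t in lborel. weyl_bound t (1 / 2 + \<eta>)"
  using AE_sin_multiples_nonzero AE_summable_sin_powr[OF assms]
proof eventually_elim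
  case (elim t)
  define f where "f h = real h powr (- 1 - \<eta>) * \<bar>sin (real h * t)\<bar> powr (\<eta> - 1)" for h :: nat
  define \<Phi> where "\<Phi> = suminf f"
  have sf: "summable f" using elim(2) by (simp add: f_def[abs_def])
  have \<Phi>0: "0 \<le> \<Phi>" unfolding \<Phi>_def by (intro suminf_nonneg sf) (simp add: f_def)
  have "(norm (weyl_sum t N x))\<^sup>2 \<le> (sqrt (1 + 2 * \<Phi>) * real N powr (1 / 2 + \<eta>))\<^sup>2" for N x
  proof (cases "N = 0")
    case True
    then show ?thesis by (simp add: weyl_sum_def)
  next
    case False
    have "(\<Sum>h\<in>{1..<N}. \<bar>sin (real h * t)\<bar> powr (\<eta> - 1)) \<le> (\<Sum>h\<in>{1..<N}. real N powr (1 + \<eta>) * f h)"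
    proof (rule sum_mono)
      fix h assume h: "h \<in> {1..<N}"
      then have "\<bar>sin (real h * t)\<bar> powr (\<eta> - 1) = real h powr (1 + \<eta>) * f h"
        by (simp add: f_def mult.assoc[symmetric] powr_add[symmetric])
      also have "\<dots> \<le> real N powr (1 + \<eta>) * f h"
        using h assms by (intro mult_right_mono powr_mono2) (auto simp: f_def)
      finally show "\<bar>sin (real h * t)\<bar> powr (\<eta> - 1) \<le> real N powr (1 + \<eta>) * f h" .
    qed
    also have "\<dots> \<le> real N powr (1 + \<eta>) * \<Phi>"
      unfolding sum_distrib_left[symmetric] \<Phi>_def
      by (intro mult_left_mono sum_le_suminf sf) (auto simp: f_def)
    finally have le: "(\<Sum>h\<in>{1..<N}. \<bar>sin (real h * t)\<bar> powr (\<eta> - 1)) \<le> real N powr (1 + \<eta>) * \<Phi>" .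
    have "(norm (weyl_sum t N x))\<^sup>2 \<le>
        real N + 2 * (real N powr \<eta> * (\<Sum>h\<in>{1..<N}. \<bar>sin (real h * t)\<bar> powr (\<eta> - 1)))"
      using elim(1) assms by (intro norm_weyl_sum_squared_le) auto
    also have "\<dots> \<le> real N + 2 * (real N powr \<eta> * (real N powr (1 + \<eta>) * \<Phi>))"
      by (intro add_left_mono mult_left_mono le) auto
    also have "\<dots> = real N + 2 * \<Phi> * real N powr (1 + 2 * \<eta>)"
    proof -
      have "real N powr \<eta> * real N powr (1 + \<eta>) = real N powr (1 + 2 * \<eta>)"
        using powr_add[of "real N" \<eta> "1 + \<eta>"] by (simp only: add.commute add.left_commute mult_2)
      then have "real N powr \<eta> * (real N powr (1 + \<eta>) * \<Phi>) = real N powr (1 + 2 * \<eta>) * \<Phi>"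
        by (metis mult.assoc)
      then show ?thesis by simp
    qed
    also have "\<dots> \<le> real N powr (1 + 2 * \<eta>) + 2 * \<Phi> * real N powr (1 + 2 * \<eta>)"
      using powr_mono[of 1 "1 + 2 * \<eta>" "real N"] False assms by simp
    also have "\<dots> = (1 + 2 * \<Phi>) * (real N powr (1 / 2 + \<eta>))\<^sup>2"
    proof -
      have "(real N powr (1 / 2 + \<eta>))\<^sup>2 = real N powr ((1 / 2 + \<eta>) + (1 / 2 + \<eta>))"
        unfolding power2_eq_square by (rule powr_add[symmetric])
      then show ?thesis by (simp add: distrib_right)
    qed
    finally show ?thesis using \<Phi>0 by (simp add: power_mult_distrib)
  qed
  then have "norm (weyl_sum t N x) \<le> sqrt (1 + 2 * \<Phi>) * real N powr (1 / 2 + \<eta>)" for N x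
    by (rule power2_le_imp_le) (use \<Phi>0 in simp)
  then show ?case
    unfolding weyl_bound_def using \<Phi>0 by (intro exI[of _ "sqrt (1 + 2 * \<Phi>)"]) simp
qed

lemma weyl_bound_mono:
  assumes "weyl_bound t b" "b \<le> b'"
  shows "weyl_bound t b'"
proof -
  obtain C where C: "C \<ge> 0" "\<And>N x. norm (weyl_sum t N x) \<le> C * real N powr b"
    using assms unfolding weyl_bound_def by blast
  have "norm (weyl_sum t N x) \<le> C * real N powr b'" for N x
  proof (cases "N = 0")
    case False
    then have "C * real N powr b \<le> C * real N powr b'"
      using C assms by (intro mult_left_mono powr_mono) auto
    then show ?thesis using C(2)[of N x] by linarith
  qed (simp add: weyl_sum_def)
  then show ?thesis unfolding weyl_bound_def using C by blast
qed

lemma AE_weyl_bound: "AE t in lebesgue. \<forall>b>1/2. weyl_bound t b"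
proof -
  have "AE t in lborel. \<forall>n::nat. weyl_bound t (1 / 2 + 1 / (real n + 2))"
    unfolding AE_all_countable by (intro allI AE_weyl_bound_exponent) auto
  then have "AE t in lborel. \<forall>b>1/2. weyl_bound t b"
  proof eventually_elim
    case (elim t)
    show ?case
    proof (intro allI impI)
      fix b :: real assume "1 / 2 < b"
      then obtain n where "inverse (of_nat (Suc n)) < b - 1 / 2"
        using reals_Archimedean[of "b - 1/2"] by auto
      moreover have "1 / (real n + 2) \<le> inverse (of_nat (Suc n))"
        by (simp add: field_simps)
      ultimately show "weyl_bound t b"
        by (intro weyl_bound_mono[OF elim[rule_format, of n]]) linarith
    qed
  qed
  then show ?thesis by (rule AE_completion)
qed

section \<open>The solution for generic times\<close>

text \<open>Abel summation: partial sums of size \<open>k\<^bsup>b\<^esup>\<close> make the tails of \<open>\<Sum> a\<^sub>k / k\<close> of size \<open>N\<^bsup>b-1\<^esup>\<close>.\<close>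

lemma powr_diff_lower_bound:
  fixes x b :: real
  assumes "1 < x" "b < 1"
  shows "x powr (b - 2) \<le> ((x - 1) powr (b - 1) - x powr (b - 1)) / (1 - b)"
proof -
  have "\<exists>z. x - 1 < z \<and> z < x \<and>
      x powr (b - 1) - (x - 1) powr (b - 1) = (x - (x - 1)) * ((b - 1) * z powr (b - 1 - 1))"
    using assms by (intro MVT2 has_real_derivative_powr) auto
  then obtain z where z: "x - 1 < z" "z < x"
      "x powr (b - 1) - (x - 1) powr (b - 1) = (b - 1) * z powr (b - 2)" by auto
  have "x powr (b - 2) \<le> z powr (b - 2)"
    using z assms by (intro powr_mono2') auto
  then have "(1 - b) * x powr (b - 2) \<le> (1 - b) * z powr (b - 2)"
    using assms by (intro mult_left_mono) auto
  also have "\<dots> = (x - 1) powr (b - 1) - x powr (b - 1)" using z(3) by (simp add: algebra_simps)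
  finally show ?thesis using assms by (simp add: pos_le_divide_eq mult.commute)
qed

lemma norm_abel_tail_le:
  fixes S :: "nat \<Rightarrow> complex"
  assumes S: "\<And>k. norm (S k) \<le> C * real k powr b" and b: "b < 1" and C: "0 \<le> C"
    and N: "1 \<le> N" "N \<le> M"
  shows "norm (\<Sum>k\<in>{N<..M}. (S k - S (k - 1)) / of_nat k) \<le> C * (2 + 1 / (1 - b)) * real N powr (b - 1)"
proof -
  have dec: "norm (S k / of_nat (Suc k)) \<le> C * real N powr (b - 1)" if "N \<le> k" for k
  proof -
    have "norm (S k / of_nat (Suc k)) \<le> C * real k powr b / real k"
      unfolding norm_divide using that N S[of k] C by (intro frac_le) (auto simp del: of_nat_Suc)
    also have "\<dots> = C * real k powr (b - 1)"
      using that N by (simp add: powr_diff)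
    also have "\<dots> \<le> C * real N powr (b - 1)"
      using that N b C by (intro mult_left_mono powr_mono2') auto
    finally show ?thesis .
  qed
  have "(\<Sum>k\<in>{N<..M}. (S k - S (k - 1)) / of_nat k) =
      S M / of_nat (Suc M) - S N / of_nat (Suc N) +
      (\<Sum>k\<in>{N<..M}. S k * (1 / of_nat k - 1 / of_nat (Suc k)))"
    using N(2)
  proof (induction M rule: dec_induct)
    case (step M)
    have "{N<..Suc M} = insert (Suc M) {N<..M}" using step by auto
    then show ?case using step.IH by (simp add: diff_divide_distrib right_diff_distrib del: of_nat_Suc)
  qed simp
  moreover have "norm (\<Sum>k\<in>{N<..M}. S k * (1 / of_nat k - 1 / of_nat (Suc k))) \<le>
      C / (1 - b) * real N powr (b - 1)"
  proof -
    have "norm (\<Sum>k\<in>{N<..M}. S k * (1 / of_nat k - 1 / of_nat (Suc k))) \<le>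
        (\<Sum>k\<in>{N<..M}. C / (1 - b) * (real (k - 1) powr (b - 1) - real k powr (b - 1)))"
    proof (rule sum_norm_le)
      fix k assume k: "k \<in> {N<..M}"
      then have k2: "1 < real k" using N by auto
      have "norm (1 / of_nat k - 1 / of_nat (Suc k) :: complex) = 1 / (real k * real (Suc k))"
      proof -
        have "(1 / of_nat k - 1 / of_nat (Suc k) :: complex) = of_real (1 / real k - 1 / real (Suc k))"
          by simp
        also have "1 / real k - 1 / real (Suc k) = 1 / (real k * real (Suc k))"
          using k2 by (simp add: field_simps)
        finally show ?thesis by (simp only: norm_of_real) simp
      qed
      also have "\<dots> \<le> 1 / (real k * real k)"
        using k2 by (intro divide_left_mono mult_left_mono) auto
      also have "\<dots> = real k powr (- 2)"
        using k2 by (simp add: powr_minus powr_numeral power2_eq_square divide_inverse)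
      finally have "norm (S k * (1 / of_nat k - 1 / of_nat (Suc k))) \<le> (C * real k powr b) * real k powr (- 2)"
        unfolding norm_mult using S[of k] C by (intro mult_mono) auto
      also have "\<dots> = C * real k powr (b - 2)"
        by (simp add: mult.assoc powr_add[symmetric])
      also have "\<dots> \<le> C * (((real k - 1) powr (b - 1) - real k powr (b - 1)) / (1 - b))"
        using k2 b C by (intro mult_left_mono powr_diff_lower_bound) auto
      also have "real k - 1 = real (k - 1)" using k by auto
      finally show "norm (S k * (1 / of_nat k - 1 / of_nat (Suc k))) \<le>
          C / (1 - b) * (real (k - 1) powr (b - 1) - real k powr (b - 1))" by simp
    qed
    also have "\<dots> = C / (1 - b) * (\<Sum>k\<in>{N<..M}. real (k - 1) powr (b - 1) - real k powr (b - 1))"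
      by (simp add: sum_distrib_left)
    also have "(\<Sum>k\<in>{N<..M}. real (k - 1) powr (b - 1) - real k powr (b - 1)) =
        real N powr (b - 1) - real M powr (b - 1)"
      using N(2)
    proof (induction M rule: dec_induct)
      case (step M)
      have "{N<..Suc M} = insert (Suc M) {N<..M}" using step by auto
      then show ?case using step.IH by simp
    qed simp
    finally show ?thesis
      using b C by (elim order_trans) (intro mult_left_mono, auto)
  qed
  ultimately have "norm (\<Sum>k\<in>{N<..M}. (S k - S (k - 1)) / of_nat k) \<le>
      C * real N powr (b - 1) + C * real N powr (b - 1) + C / (1 - b) * real N powr (b - 1)"
    using dec[of M] dec[of N] N
    by (auto intro!: norm_triangle_le norm_triangle_le_diff add_mono)
  then show ?thesis by (simp add: algebra_simps)
qed

lemma sum_symmetric_int: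
  "(\<Sum>k\<in>{k::int. int N < \<bar>k\<bar> \<and> \<bar>k\<bar> \<le> int M}. f k) = (\<Sum>k\<in>{N<..M}. f (int k) + f (- int k))"
proof -
  have "{k::int. int N < \<bar>k\<bar> \<and> \<bar>k\<bar> \<le> int M} = int ` {N<..M} \<union> (\<lambda>k. - int k) ` {N<..M}"
  proof (intro equalityI subsetI)
    fix k :: int assume "k \<in> {k. int N < \<bar>k\<bar> \<and> \<bar>k\<bar> \<le> int M}"
    then have "nat \<bar>k\<bar> \<in> {N<..M}" "k = int (nat \<bar>k\<bar>) \<or> k = - int (nat \<bar>k\<bar>)" by auto
    then show "k \<in> int ` {N<..M} \<union> (\<lambda>k. - int k) ` {N<..M}" by blast
  qed auto
  moreover have "int ` {N<..M} \<inter> (\<lambda>k. - int k) ` {N<..M} = {}" by auto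
  ultimately show ?thesis
    by (simp add: sum.union_disjoint sum.reindex inj_on_def sum.distrib)
qed

definition time_factor :: "real \<Rightarrow> int \<Rightarrow> complex" where
  "time_factor t k = cis (- (t * (of_int k)\<^sup>2))"

lemma norm_time_factor [simp]: "norm (time_factor t k) = 1"
  by (simp add: time_factor_def)

lemma time_factor_minus [simp]: "time_factor t (- k) = time_factor t k"
  by (simp add: time_factor_def)

lemma weyl_sum_increment:
  assumes "1 \<le> k"
  shows "weyl_sum t k y - weyl_sum t (k - 1) y = time_factor t (int k) * character (int k) y"
proof -
  obtain m where "k = Suc m" using assms by (cases k) auto
  then show ?thesis by (simp add: weyl_sum_def time_factor_def character_def cis_mult)
qed

lemma schroedinger_kernel_bound:
  assumes "weyl_bound t b"
  obtains C where "0 \<le> C" and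
    "\<And>N y. norm (\<Sum>k\<in>{k. int 0 < \<bar>k\<bar> \<and> \<bar>k\<bar> \<le> int N}. time_factor t k * character k y) \<le> C * real N powr b"
proof -
  obtain C where C: "0 \<le> C" "\<And>N x. norm (weyl_sum t N x) \<le> C * real N powr b"
    using assms unfolding weyl_bound_def by blast
  have "norm (\<Sum>k\<in>{k. int 0 < \<bar>k\<bar> \<and> \<bar>k\<bar> \<le> int N}. time_factor t k * character k y) \<le> 2 * C * real N powr b" for N y
  proof -
    have "{0<..N} = {1..N}" by auto
    then have "(\<Sum>k\<in>{k. int 0 < \<bar>k\<bar> \<and> \<bar>k\<bar> \<le> int N}. time_factor t k * character k y) =
        weyl_sum t N y + weyl_sum t N (- y)"
      unfolding sum_symmetric_int
      by (simp add: weyl_sum_def sum.distrib time_factor_def character_def cis_mult algebra_simps)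
    then show ?thesis using norm_triangle_le[OF add_mono[OF C(2)[of N y] C(2)[of N "- y"]]] by simp
  qed
  then show ?thesis using C(1) by (intro that[of "2 * C"]) auto
qed

lemma integrated_schroedinger_kernel_bound:
  assumes "weyl_bound t b" "b < 1"
  obtains C where "0 \<le> C" and
    "\<And>N M y. 1 \<le> N \<Longrightarrow> N \<le> M \<Longrightarrow>
      norm (\<Sum>k\<in>{k. int N < \<bar>k\<bar> \<and> \<bar>k\<bar> \<le> int M}. time_factor t k / (\<i> * of_int k) * character k y) \<le> C * real N powr (b - 1)"
proof -
  obtain C where C: "0 \<le> C" "\<And>N x. norm (weyl_sum t N x) \<le> C * real N powr b"
    using assms unfolding weyl_bound_def by blast
  let ?C = "C * (2 + 1 / (1 - b))"
  have "norm (\<Sum>k\<in>{k. int N < \<bar>k\<bar> \<and> \<bar>k\<bar> \<le> int M}. time_factor t k / (\<i> * of_int k) * character k y) \<le>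
      2 * ?C * real N powr (b - 1)" if NM: "1 \<le> N" "N \<le> M" for N M y
  proof -
    let ?T = "\<lambda>y. \<Sum>k\<in>{N<..M}. (weyl_sum t k y - weyl_sum t (k - 1) y) / of_nat k"
    have T: "norm (?T y) \<le> ?C * real N powr (b - 1)" for y
      by (rule norm_abel_tail_le[OF C(2) assms(2) C(1) NM])
    have "(\<Sum>k\<in>{k. int N < \<bar>k\<bar> \<and> \<bar>k\<bar> \<le> int M}. time_factor t k / (\<i> * of_int k) * character k y) =
        (\<Sum>k\<in>{N<..M}. (weyl_sum t k y - weyl_sum t (k - 1) y) / of_nat k / \<i>
          - (weyl_sum t k (- y) - weyl_sum t (k - 1) (- y)) / of_nat k / \<i>)"
      unfolding sum_symmetric_int
      by (intro sum.cong refl, subst (1 2) weyl_sum_increment)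
         (use NM in \<open>auto simp: character_def field_simps\<close>)
    also have "\<dots> = (?T y - ?T (- y)) / \<i>"
      by (simp only: sum_subtractf sum_divide_distrib diff_divide_distrib)
    finally have "norm (\<Sum>k\<in>{k. int N < \<bar>k\<bar> \<and> \<bar>k\<bar> \<le> int M}. time_factor t k / (\<i> * of_int k) * character k y)
        = norm (?T y - ?T (- y))" by (simp add: norm_divide norm_mult)
    also have "\<dots> \<le> ?C * real N powr (b - 1) + ?C * real N powr (b - 1)"
      by (intro norm_triangle_le_diff add_mono T)
    finally show ?thesis by (simp only: mult_2 distrib_right)
  qed
  then show ?thesis using C(1) assms(2) by (intro that[of "2 * ?C"]) auto
qed

lemma finite_int_shell [simp]: "finite {k::int. int N < \<bar>k\<bar> \<and> \<bar>k\<bar> \<le> int M}"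
  by (rule finite_subset[of _ "{- int M..int M}"]) auto

context torus_bv
begin

definition partial_sum :: "real \<Rightarrow> nat \<Rightarrow> real \<Rightarrow> complex" where
  "partial_sum t N x = (\<Sum>k\<in>{- int N..int N}. time_factor t k * fourier_coeff g k * character k x)"

text \<open>The pointwise limit of the symmetric partial sums. Its value is arbitrary where they
  diverge; it is used only at times for which they converge uniformly.\<close>

definition evolution :: "real \<Rightarrow> real \<Rightarrow> complex" where
  "evolution t x = lim (\<lambda>N. partial_sum t N x)"

lemma partial_sum_diff:
  assumes "N \<le> M"
  shows "partial_sum t M x - partial_sum t N x =
    (\<Sum>k\<in>{k. int N < \<bar>k\<bar> \<and> \<bar>k\<bar> \<le> int M}. time_factor t k * character k x * fourier_coeff g k)"
proof -
  have "{- int M..int M} = {- int N..int N} \<union> {k. int N < \<bar>k\<bar> \<and> \<bar>k\<bar> \<le> int M}"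
    using assms by auto
  moreover have "{- int N..int N} \<inter> {k. int N < \<bar>k\<bar> \<and> \<bar>k\<bar> \<le> int M} = {}" by auto
  ultimately show ?thesis
    unfolding partial_sum_def by (simp add: sum.union_disjoint mult_ac)
qed

lemma partial_sum_tail_bound:
  assumes "weyl_bound t b" "b < 1"
  obtains C where "0 \<le> C" and
    "\<And>N M x. 1 \<le> N \<Longrightarrow> N \<le> M \<Longrightarrow> norm (partial_sum t M x - partial_sum t N x) \<le> C * real N powr (b - 1)"
proof -
  obtain C where C: "0 \<le> C" "\<And>N M y. 1 \<le> N \<Longrightarrow> N \<le> M \<Longrightarrow>
      norm (\<Sum>k\<in>{k. int N < \<bar>k\<bar> \<and> \<bar>k\<bar> \<le> int M}. time_factor t k / (\<i> * of_int k) * character k y) \<le> C * real N powr (b - 1)"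
    using integrated_schroedinger_kernel_bound[OF assms] by blast
  have "norm (partial_sum t M x - partial_sum t N x) \<le> total_var / (2 * pi) * C * real N powr (b - 1)"
    if "1 \<le> N" "N \<le> M" for N M x
  proof -
    have "norm (partial_sum t M x - partial_sum t N x) \<le> total_var / (2 * pi) * (C * real N powr (b - 1))"
      unfolding partial_sum_diff[OF that(2)]
      by (rule norm_weighted_trig_sum_le[OF _ _ C(2)[OF that]]) auto
    then show ?thesis by simp
  qed
  then show ?thesis using C(1) total_var_nonneg by (intro that[of "total_var / (2 * pi) * C"]) auto
qed

lemma powr_neg_exponent_tendsto_0:
  "b < 1 \<Longrightarrow> (\<lambda>N. C * real N powr (b - 1)) \<longlonglongrightarrow> 0"
  using tendsto_mult_right_zero[OF tendsto_neg_powr[OF _ filterlim_real_sequentially, of "b - 1"]] by simp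

lemma evolution_tail_bound:
  assumes "weyl_bound t b" "b < 1"
  obtains C where "0 \<le> C" and
    "\<And>N x. 1 \<le> N \<Longrightarrow> norm (evolution t x - partial_sum t N x) \<le> C * real N powr (b - 1)"
proof -
  obtain C where C: "0 \<le> C"
    "\<And>N M x. 1 \<le> N \<Longrightarrow> N \<le> M \<Longrightarrow> norm (partial_sum t M x - partial_sum t N x) \<le> C * real N powr (b - 1)"
    using partial_sum_tail_bound[OF assms] by blast
  have lim: "(\<lambda>M. partial_sum t M x) \<longlonglongrightarrow> evolution t x" for x
  proof -
    have "Cauchy (\<lambda>M. partial_sum t M x)"
    proof (rule CauchyI')
      fix e :: real assume "0 < e"
      have "\<forall>\<^sub>F N in sequentially. C * real N powr (b - 1) < e \<and> 1 \<le> N"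
        using order_tendstoD(2)[OF powr_neg_exponent_tendsto_0[OF assms(2)] \<open>0 < e\<close>]
          eventually_ge_at_top[of 1] by (intro eventually_conj)
      then obtain N0 where N0: "\<And>N. N \<ge> N0 \<Longrightarrow> C * real N powr (b - 1) < e \<and> 1 \<le> N"
        unfolding eventually_sequentially by blast
      show "\<exists>M. \<forall>m\<ge>M. \<forall>n>m. dist (partial_sum t m x) (partial_sum t n x) < e"
      proof (intro exI[of _ N0] allI impI)
        fix m n assume mn: "N0 \<le> m" "m < n"
        have "norm (partial_sum t n x - partial_sum t m x) \<le> C * real m powr (b - 1)"
          using N0[OF mn(1)] mn by (intro C(2)) auto
        then show "dist (partial_sum t m x) (partial_sum t n x) < e"
          using N0[OF mn(1)] by (simp add: dist_norm norm_minus_commute)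
      qed
    qed
    then show ?thesis
      unfolding evolution_def by (simp add: Cauchy_convergent_iff convergent_LIMSEQ_iff)
  qed
  have "norm (evolution t x - partial_sum t N x) \<le> C * real N powr (b - 1)" if "1 \<le> N" for N x
  proof (rule LIMSEQ_le_const2)
    show "(\<lambda>M. norm (partial_sum t M x - partial_sum t N x)) \<longlonglongrightarrow> norm (evolution t x - partial_sum t N x)"
      by (intro tendsto_intros lim)
    show "\<exists>N'. \<forall>M\<ge>N'. norm (partial_sum t M x - partial_sum t N x) \<le> C * real N powr (b - 1)"
      using C(2)[OF that] by blast
  qed
  then show ?thesis using C(1) that by blast
qed

lemma continuous_partial_sum: "continuous_on S (partial_sum t N)"
  unfolding partial_sum_def[abs_def] by (intro continuous_intros)

lemma continuous_evolution:
  assumes "weyl_bound t b" "b < 1"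
  shows "continuous_on UNIV (evolution t)"
proof -
  obtain C where C: "0 \<le> C"
    "\<And>N x. 1 \<le> N \<Longrightarrow> norm (evolution t x - partial_sum t N x) \<le> C * real N powr (b - 1)"
    using evolution_tail_bound[OF assms] by blast
  have "uniform_limit UNIV (partial_sum t) (evolution t) sequentially"
  proof (rule uniform_limitI)
    fix e :: real assume "0 < e"
    show "\<forall>\<^sub>F N in sequentially. \<forall>x\<in>UNIV. dist (partial_sum t N x) (evolution t x) < e"
      using order_tendstoD(2)[OF powr_neg_exponent_tendsto_0[OF assms(2), of C] \<open>0 < e\<close>]
        eventually_ge_at_top[of 1]
    proof eventually_elim
      case (elim N)
      show ?case
      proof
        fix x
        show "dist (partial_sum t N x) (evolution t x) < e"
          using C(2)[OF elim(2), of x] elim(1) by (simp add: dist_norm norm_minus_commute)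
      qed
    qed
  qed
  then show ?thesis
    by (rule uniform_limit_theorem[rotated]) (auto intro: always_eventually continuous_partial_sum)
qed

lemma evolution_periodic: "evolution t (x + 2 * pi) = evolution t x"
  by (simp add: evolution_def partial_sum_def)

text \<open>The increment of a partial sum has the kernel \<open>\<kappa> (y + h) - \<kappa> y\<close>, where \<open>\<kappa>\<close> is a primitive of the
  symmetric Weyl kernel. The Weyl bound applies to \<open>\<kappa>'\<close>.\<close>

lemma partial_sum_shift_bound:
  assumes "weyl_bound t b"
  obtains C where "0 \<le> C" and
    "\<And>N x h. 0 \<le> h \<Longrightarrow> norm (partial_sum t N (x + h) - partial_sum t N x) \<le> C * h * real N powr b"
proof -
  obtain C where C: "0 \<le> C" "\<And>N y. norm (\<Sum>k\<in>{k. int 0 < \<bar>k\<bar> \<and> \<bar>k\<bar> \<le> int N}. time_factor t k * character k y) \<le> C * real N powr b"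
    using schroedinger_kernel_bound[OF assms] by blast
  have "norm (partial_sum t N (x + h) - partial_sum t N x) \<le> total_var / (2 * pi) * C * h * real N powr b"
    if h: "0 \<le> h" for N x h
  proof -
    let ?F = "{k::int. int 0 < \<bar>k\<bar> \<and> \<bar>k\<bar> \<le> int N}"
    define \<kappa> where "\<kappa> y = (\<Sum>k\<in>?F. time_factor t k / (\<i> * of_int k) * character k y)" for y
    have \<kappa>_deriv: "(\<kappa> has_vector_derivative (\<Sum>k\<in>?F. time_factor t k * character k y)) (at y within S)" for y S
    proof -
      have "(\<kappa> has_vector_derivative (\<Sum>k\<in>?F. time_factor t k / (\<i> * of_int k) * (\<i> * of_int k * character k y))) (at y within S)"
        unfolding \<kappa>_def by (intro derivative_intros has_vector_derivative_mult_right)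
      also have "(\<Sum>k\<in>?F. time_factor t k / (\<i> * of_int k) * (\<i> * of_int k * character k y)) =
          (\<Sum>k\<in>?F. time_factor t k * character k y)"
        by (intro sum.cong) auto
      finally show ?thesis .
    qed
    have \<kappa>: "norm (\<kappa> (y + h) - \<kappa> y) \<le> C * real N powr b * h" for y
    proof -
      have "norm (\<kappa> (y + h) - \<kappa> y) \<le> C * real N powr b * norm ((y + h) - y)"
      proof (rule differentiable_bound)
        show "convex (UNIV :: real set)" by simp
        show "(\<kappa> has_derivative (\<lambda>d. d *\<^sub>R (\<Sum>k\<in>?F. time_factor t k * character k z))) (at z within UNIV)" for z
          using \<kappa>_deriv unfolding has_vector_derivative_def .
        show "onorm (\<lambda>d. d *\<^sub>R (\<Sum>k\<in>?F. time_factor t k * character k z)) \<le> C * real N powr b" for z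
          by (rule onorm_le) (use C(2)[of z N] in \<open>auto simp: mult.commute intro: mult_left_mono\<close>)
      qed auto
      then show ?thesis using h by simp
    qed
    have "partial_sum t N (x + h) - partial_sum t N x =
        (\<Sum>k\<in>?F. time_factor t k * (character k h - 1) * character k x * fourier_coeff g k)"
    proof -
      have "partial_sum t N (x + h) - partial_sum t 0 (x + h) - (partial_sum t N x - partial_sum t 0 x) =
         (\<Sum>k\<in>?F. time_factor t k * (character k h - 1) * character k x * fourier_coeff g k)"
        unfolding partial_sum_diff[OF le0] sum_subtractf[symmetric] character_add
        by (intro sum.cong refl) (simp add: algebra_simps)
      moreover have "partial_sum t 0 (x + h) = partial_sum t 0 x" by (simp add: partial_sum_def)
      ultimately show ?thesis by simp
    qed
    also have "norm \<dots> \<le> total_var / (2 * pi) * (C * real N powr b * h)"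
    proof (rule norm_weighted_trig_sum_le)
      fix y
      have "(\<Sum>k\<in>?F. time_factor t k * (character k h - 1) / (\<i> * of_int k) * character k y) = \<kappa> (y + h) - \<kappa> y"
        unfolding \<kappa>_def sum_subtractf[symmetric] character_add
        by (intro sum.cong refl) (simp add: field_simps)
      then show "norm (\<Sum>k\<in>?F. time_factor t k * (character k h - 1) / (\<i> * of_int k) * character k y) \<le> C * real N powr b * h"
        using \<kappa> by simp
    qed (use finite_int_shell[of 0 N] in auto)
    finally show ?thesis by (simp add: mult_ac)
  qed
  then show ?thesis using C(1) total_var_nonneg by (intro that[of "total_var / (2 * pi) * C"]) auto
qed

text \<open>Compare with the partial sum of order about \<open>1 / h\<close>, for which the bounds on the increment and
  on the remainder are of the same size.\<close>

lemma evolution_hoelder: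
  assumes "weyl_bound t b" "0 \<le> b" "b < 1"
  obtains C where "0 \<le> C" and
    "\<And>x h. 0 < h \<Longrightarrow> h \<le> 1 \<Longrightarrow> norm (evolution t (x + h) - evolution t x) \<le> C * h powr (1 - b)"
proof -
  obtain C1 where C1: "0 \<le> C1"
    "\<And>N x. 1 \<le> N \<Longrightarrow> norm (evolution t x - partial_sum t N x) \<le> C1 * real N powr (b - 1)"
    using evolution_tail_bound[OF assms(1,3)] by blast
  obtain C2 where C2: "0 \<le> C2"
    "\<And>N x h. 0 \<le> h \<Longrightarrow> norm (partial_sum t N (x + h) - partial_sum t N x) \<le> C2 * h * real N powr b"
    using partial_sum_shift_bound[OF assms(1)] by blast
  have "norm (evolution t (x + h) - evolution t x) \<le> (2 * C1 + C2 * 2 powr b) * h powr (1 - b)"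
    if h: "0 < h" "h \<le> 1" for x h
  proof -
    \<comment> \<open>the order that balances \<open>N\<^bsup>b-1\<^esup>\<close> and \<open>h N\<^bsup>b\<^esup>\<close>\<close>
    define N where "N = nat \<lceil>1 / h\<rceil>"
    have hinv: "1 \<le> 1 / h" using h by simp
    have N: "1 / h \<le> real N" "real N \<le> 1 / h + 1" "1 \<le> N"
      unfolding N_def using hinv by linarith+
    have "real N \<le> 2 / h" using N(2) hinv by simp
    have tail: "norm (evolution t y - partial_sum t N y) \<le> C1 * h powr (1 - b)" for y
    proof -
      have "real N powr (b - 1) \<le> (1 / h) powr (b - 1)"
        using N(1) h assms by (intro powr_mono2') auto
      also have "\<dots> = h powr (1 - b)"
        using h powr_minus_divide[of h "b - 1"] by (simp add: powr_divide)
      finally have "C1 * real N powr (b - 1) \<le> C1 * h powr (1 - b)"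
        using C1(1) by (intro mult_left_mono)
      then show ?thesis by (rule order_trans[OF C1(2)[OF N(3)]])
    qed
    have "C2 * h * real N powr b \<le> C2 * h * (2 / h) powr b"
      using \<open>real N \<le> 2 / h\<close> assms C2(1) h by (intro mult_left_mono powr_mono2) auto
    also have "\<dots> = C2 * 2 powr b * h powr (1 - b)"
      using h by (simp add: powr_divide powr_diff)
    finally have mid: "norm (partial_sum t N (x + h) - partial_sum t N x) \<le> C2 * 2 powr b * h powr (1 - b)"
      using C2(2)[of h N x] h by linarith
    have "norm ((evolution t (x + h) - partial_sum t N (x + h)) +
          (partial_sum t N (x + h) - partial_sum t N x) - (evolution t x - partial_sum t N x))
        \<le> C1 * h powr (1 - b) + C2 * 2 powr b * h powr (1 - b) + C1 * h powr (1 - b)"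
      by (rule norm_triangle_le_diff[OF add_mono[OF norm_triangle_le[OF add_mono[OF tail mid]] tail]])
    then show ?thesis by (simp add: algebra_simps)
  qed
  then show ?thesis using C1(1) C2(1) by (intro that[of "2 * C1 + C2 * 2 powr b"]) auto
qed

lemma continuous_periodic_imp_L2:
  assumes "continuous_on UNIV u" "torus_fun u"
  shows "u \<in> L2_torus"
proof -
  have "u \<in> borel_measurable lebesgue"
    using borel_measurable_continuous_onI[OF assms(1)] by (intro measurable_completion) simp
  moreover have "set_integrable lebesgue {0..2*pi} (\<lambda>x. (norm (u x))\<^sup>2)"
    by (intro absolutely_integrable_continuous_real continuous_intros continuous_on_subset[OF assms(1)]) auto
  ultimately show ?thesis using assms unfolding L2_torus_def by simp
qed

lemma evolution_L2:
  assumes "weyl_bound t b" "b < 1"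
  shows "evolution t \<in> L2_torus"
  using continuous_periodic_imp_L2[OF continuous_evolution[OF assms]] evolution_periodic
  unfolding torus_fun_def by blast

lemma fourier_coeff_square_summable: "(\<lambda>k. (norm (fourier_coeff g k))\<^sup>2) summable_on UNIV"
proof (rule nonneg_bdd_above_summable_on)
  show "bdd_above (sum (\<lambda>k. (norm (fourier_coeff g k))\<^sup>2) ` {F. F \<subseteq> UNIV \<and> finite F})"
  proof (rule bdd_aboveI2)
    fix F :: "int set" assume "F \<in> {F. F \<subseteq> UNIV \<and> finite F}"
    then have "2 * pi * (\<Sum>k\<in>F. (norm (fourier_coeff g k))\<^sup>2) \<le> (LINT x:{0..2*pi}|lebesgue. (norm (g x))\<^sup>2)"
      using g_L2 unfolding L2_torus_def by (intro bessel) auto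
    then show "(\<Sum>k\<in>F. (norm (fourier_coeff g k))\<^sup>2) \<le> (LINT x:{0..2*pi}|lebesgue. (norm (g x))\<^sup>2) / (2 * pi)"
      by (simp add: field_simps)
  qed
qed simp

text \<open>For a finite set \<open>F\<close> inside \<open>[-N, N]\<close> compare with the partial sum of order \<open>N\<close>, which is uniformly
  close to the solution: by Parseval's identity it differs from the sum over \<open>F\<close> by a tail of the
  convergent series of the squares of the Fourier coefficients.\<close>

lemma evolution_L2_convergence:
  assumes "weyl_bound t b" "b < 1"
  shows "((\<lambda>F. LINT x:{0..2*pi}|lebesgue. (norm (evolution t x -
      (\<Sum>k\<in>F. (time_factor t k * fourier_coeff g k) * character k x)))\<^sup>2) \<longlongrightarrow> 0)
    (finite_subsets_at_top UNIV)"
proof -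
  let ?c = "\<lambda>k. time_factor t k * fourier_coeff g k"
  let ?q = "\<lambda>k. (norm (fourier_coeff g k))\<^sup>2"
  let ?E = "\<lambda>F. LINT x:{0..2*pi}|lebesgue. (norm (evolution t x - (\<Sum>k\<in>F. ?c k * character k x)))\<^sup>2"
  define A where "A = infsum ?q UNIV"
  obtain C where C: "0 \<le> C"
    "\<And>N x. 1 \<le> N \<Longrightarrow> norm (evolution t x - partial_sum t N x) \<le> C * real N powr (b - 1)"
    using evolution_tail_bound[OF assms] by blast
  have sq_int: "set_integrable lebesgue {0..2*pi} (\<lambda>x. (norm (h x))\<^sup>2)"
    if "continuous_on UNIV h" for h :: "real \<Rightarrow> complex"
    by (intro absolutely_integrable_continuous_real continuous_intros continuous_on_subset[OF that]) auto
  have bound: "?E F \<le> 4 * pi * (A - sum ?q F)" if F: "finite F" for F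
  proof -
    have ev: "?E F \<le> 4 * pi * (C * real N powr (b - 1))\<^sup>2 + 4 * pi * (A - sum ?q F)"
      if N: "1 \<le> N" "F \<subseteq> {- int N..int N}" for N
    proof -
      let ?R = "\<lambda>x. \<Sum>k\<in>{- int N..int N} - F. ?c k * character k x"
      have split: "partial_sum t N x = (\<Sum>k\<in>F. ?c k * character k x) + ?R x" for x
        unfolding partial_sum_def using sum.subset_diff[OF N(2), of "\<lambda>k. ?c k * character k x"]
        by (simp add: add.commute)
      have par: "(norm (z + w))\<^sup>2 \<le> 2 * (norm z)\<^sup>2 + 2 * (norm w)\<^sup>2" for z w :: complex
      proof -
        have "(norm (z + w))\<^sup>2 \<le> (norm z + norm w)\<^sup>2"
          by (intro power_mono norm_triangle_ineq) simp
        also have "\<dots> \<le> 2 * (norm z)\<^sup>2 + 2 * (norm w)\<^sup>2"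
          using sum_squares_bound[of "norm z" "norm w"] by (simp add: power2_sum)
        finally show ?thesis .
      qed
      have pointwise: "(norm (evolution t x - (\<Sum>k\<in>F. ?c k * character k x)))\<^sup>2 \<le>
          2 * (C * real N powr (b - 1))\<^sup>2 + 2 * (norm (?R x))\<^sup>2" for x
      proof -
        have "evolution t x - (\<Sum>k\<in>F. ?c k * character k x) = (evolution t x - partial_sum t N x) + ?R x"
          unfolding split by simp
        then have "(norm (evolution t x - (\<Sum>k\<in>F. ?c k * character k x)))\<^sup>2 \<le>
            2 * (norm (evolution t x - partial_sum t N x))\<^sup>2 + 2 * (norm (?R x))\<^sup>2"
          using par by presburger
        moreover have "(norm (evolution t x - partial_sum t N x))\<^sup>2 \<le> (C * real N powr (b - 1))\<^sup>2"
          using C(2)[OF N(1)] by (intro power_mono) auto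
        ultimately show ?thesis by linarith
      qed
      have "?E F \<le> (LINT x:{0..2*pi}|lebesgue. 2 * (C * real N powr (b - 1))\<^sup>2 + 2 * (norm (?R x))\<^sup>2)"
      proof (rule set_integral_mono)
        show "set_integrable lebesgue {0..2*pi} (\<lambda>x. (norm (evolution t x - (\<Sum>k\<in>F. ?c k * character k x)))\<^sup>2)"
          by (intro sq_int continuous_intros continuous_evolution[OF assms])
        show "set_integrable lebesgue {0..2*pi} (\<lambda>x. 2 * (C * real N powr (b - 1))\<^sup>2 + 2 * (norm (?R x))\<^sup>2)"
          by (intro absolutely_integrable_continuous_real continuous_intros)
      qed (rule pointwise)
      also have "\<dots> = 4 * pi * (C * real N powr (b - 1))\<^sup>2 + 2 * (LINT x:{0..2*pi}|lebesgue. (norm (?R x))\<^sup>2)"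
        by (subst set_integral_add(2))
           (auto intro!: absolutely_integrable_continuous_real continuous_intros simp: set_integral_const)
      also have "(LINT x:{0..2*pi}|lebesgue. (norm (?R x))\<^sup>2) = 2 * pi * sum ?q ({- int N..int N} - F)"
        by (subst parseval_trig_poly) (auto simp: norm_mult)
      also have "sum ?q ({- int N..int N} - F) \<le> A - sum ?q F"
        using finite_sum_le_infsum[OF fourier_coeff_square_summable, of "{- int N..int N}"]
          sum.subset_diff[OF N(2), of ?q] unfolding A_def by simp
      finally show ?thesis by simp
    qed
    obtain N0 where N0: "1 \<le> N0" "F \<subseteq> {- int N0..int N0}"
    proof -
      have "\<bar>k\<bar> \<le> (\<Sum>k\<in>F. \<bar>k\<bar>)" if "k \<in> F" for k
        using F that by (intro member_le_sum) auto
      then show ?thesis by (intro that[of "Suc (nat (\<Sum>k\<in>F. \<bar>k\<bar>))"]) force+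
    qed
    have "(\<lambda>N. 4 * pi * (C * real N powr (b - 1))\<^sup>2 + 4 * pi * (A - sum ?q F)) \<longlonglongrightarrow>
        4 * pi * 0\<^sup>2 + 4 * pi * (A - sum ?q F)"
      by (intro tendsto_intros powr_neg_exponent_tendsto_0 assms)
    then have "?E F \<le> 4 * pi * 0\<^sup>2 + 4 * pi * (A - sum ?q F)"
    proof (rule LIMSEQ_le_const, intro exI[of _ N0] allI impI)
      fix N assume "N0 \<le> N"
      then show "?E F \<le> 4 * pi * (C * real N powr (b - 1))\<^sup>2 + 4 * pi * (A - sum ?q F)"
        using N0 by (intro ev) force+
    qed
    then show ?thesis by simp
  qed
  have "(sum ?q \<longlongrightarrow> A) (finite_subsets_at_top UNIV)"
    using has_sum_infsum[OF fourier_coeff_square_summable] unfolding A_def has_sum_def by simp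
  then have lim: "((\<lambda>F. 4 * pi * (A - sum ?q F)) \<longlongrightarrow> 4 * pi * (A - A)) (finite_subsets_at_top UNIV)"
    by (intro tendsto_intros)
  show ?thesis
  proof (rule tendsto_sandwich[of "\<lambda>_. 0"])
    show "\<forall>\<^sub>F F in finite_subsets_at_top UNIV. 0 \<le> ?E F"
      by (intro always_eventually allI) (simp add: set_lebesgue_integral_def)
    show "\<forall>\<^sub>F F in finite_subsets_at_top UNIV. ?E F \<le> 4 * pi * (A - sum ?q F)"
      using eventually_finite_subsets_at_top_weakI[of UNIV] bound by blast
  qed (use lim in auto)
qed

lemma evolution_in_schroedinger_evolution:
  assumes "weyl_bound t b" "b < 1"
  shows "evolution t \<in> schroedinger_evolution t g"
proof -
  have eq: "exp (- (\<i> * of_real t * (of_int k)\<^sup>2) + \<i> * of_int k * of_real x) * fourier_coeff g k =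
      time_factor t k * fourier_coeff g k * character k x" for k x
  proof -
    have "exp (- (\<i> * of_real t * (of_int k)\<^sup>2)) = time_factor t k"
      by (simp add: time_factor_def cis_conv_exp mult_ac)
    then show ?thesis unfolding exp_add exp_eq_character by simp
  qed
  show ?thesis
    unfolding schroedinger_evolution_def mem_Collect_eq eq
    using evolution_L2[OF assms] evolution_L2_convergence[OF assms] by blast
qed

text \<open>By Bessel's inequality the mean square distance to a trigonometric sum dominates the distance of
  each single coefficient.\<close>

lemma fourier_coeff_evolution:
  assumes "weyl_bound t b" "b < 1"
  shows "fourier_coeff (evolution t) k = time_factor t k * fourier_coeff g k"
proof -
  let ?c = "\<lambda>k. time_factor t k * fourier_coeff g k"
  let ?E = "\<lambda>F. LINT x:{0..2*pi}|lebesgue. (norm (evolution t x - (\<Sum>k\<in>F. ?c k * character k x)))\<^sup>2"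
  have u: "evolution t \<in> borel_measurable lebesgue"
    "set_integrable lebesgue {0..2*pi} (\<lambda>x. (norm (evolution t x))\<^sup>2)"
    using evolution_L2[OF assms] unfolding L2_torus_def by auto
  have "2 * pi * (norm (?c k - fourier_coeff (evolution t) k))\<^sup>2 \<le> ?E F" if F: "finite F" "k \<in> F" for F
  proof -
    have "(norm (?c k - fourier_coeff (evolution t) k))\<^sup>2 \<le> (\<Sum>k\<in>F. (norm (?c k - fourier_coeff (evolution t) k))\<^sup>2)"
      using F by (intro member_le_sum) auto
    then have "2 * pi * (norm (?c k - fourier_coeff (evolution t) k))\<^sup>2 \<le>
        2 * pi * (\<Sum>k\<in>F. (norm (?c k - fourier_coeff (evolution t) k))\<^sup>2)"
      by (intro mult_left_mono) auto
    then show ?thesis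
      using integral_norm_diff_trig_poly[OF u F(1), of ?c] bessel[OF u F(1)] by linarith
  qed
  then have "\<forall>\<^sub>F F in finite_subsets_at_top UNIV. 2 * pi * (norm (?c k - fourier_coeff (evolution t) k))\<^sup>2 \<le> ?E F"
    unfolding eventually_finite_subsets_at_top by (intro exI[of _ "{k}"]) auto
  then have "2 * pi * (norm (?c k - fourier_coeff (evolution t) k))\<^sup>2 \<le> 0"
    using tendsto_lowerbound[OF evolution_L2_convergence[OF assms]] by simp
  then show ?thesis using pi_gt_zero by (auto simp: mult_le_0_iff)
qed

end

section \<open>Irregularity of the real and imaginary parts for generic times\<close>

lemma finite_large_fourier_coeffs:
  assumes "f \<in> borel_measurable lebesgue"
    and "set_integrable lebesgue {0..2*pi} (\<lambda>x. (norm (f x))\<^sup>2)" and "0 < \<delta>"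
  shows "finite {n. \<delta> \<le> norm (fourier_coeff f n)}"
proof (rule ccontr)
  define I where "I = (LINT x:{0..2*pi}|lebesgue. (norm (f x))\<^sup>2)"
  assume inf: "infinite {n. \<delta> \<le> norm (fourier_coeff f n)}"
  obtain m :: nat where m: "I / (2 * pi * \<delta>\<^sup>2) < real m" using reals_Archimedean2 by blast
  obtain F where F: "finite F" "card F = m" "F \<subseteq> {n. \<delta> \<le> norm (fourier_coeff f n)}"
    using infinite_arbitrarily_large[OF inf] by blast
  have "real m * \<delta>\<^sup>2 = (\<Sum>n\<in>F. \<delta>\<^sup>2)" using F by simp
  also have "\<dots> \<le> (\<Sum>n\<in>F. (norm (fourier_coeff f n))\<^sup>2)"
    using F \<open>0 < \<delta>\<close> by (intro sum_mono power_mono) auto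
  finally have "2 * pi * (real m * \<delta>\<^sup>2) \<le> 2 * pi * (\<Sum>n\<in>F. (norm (fourier_coeff f n))\<^sup>2)"
    by (intro mult_left_mono) auto
  also have "\<dots> \<le> I" unfolding I_def by (rule bessel[OF assms(1,2) F(1)])
  finally show False using m \<open>0 < \<delta>\<close> by (simp add: pos_divide_less_eq mult_ac)
qed

lemma time_factor_eq_character: "time_factor t k = character (- (k\<^sup>2)) t"
  by (simp add: time_factor_def character_def mult.commute)

lemma time_factor_periodic: "time_factor (t + 2 * pi * of_int n) k = time_factor t k"
proof -
  have "cis (2 * pi * of_int m) = 1" for m by simp
  from this[of "- (k\<^sup>2) * n"] show ?thesis
    by (simp add: time_factor_eq_character character_add) (simp add: character_def mult_ac)
qed

text \<open>Let \<open>A\<close> be a set of times in one period on which the sum of the oscillating squares is bounded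
  by \<open>M\<close>. Up to constants, the integral over \<open>A\<close> of the phase of the cross term of index \<open>k\<close> is the
  Fourier coefficient of the indicator of \<open>A\<close> at the frequency \<open>2 k\<^sup>2\<close>; by Bessel it is small for all but finitely many \<open>k\<close>. If
  \<open>A\<close> had positive measure, integrating over \<open>A\<close> would bound the sum without the cross terms.\<close>

lemma negligible_bounded_oscillating_sum:
  fixes \<alpha> \<beta> :: "int \<Rightarrow> complex" and w :: "int \<Rightarrow> real"
  defines "f \<equiv> \<lambda>k t. (norm (time_factor t k * \<alpha> k + cnj (time_factor t k) * \<beta> k))\<^sup>2"
  assumes w: "\<And>k. 0 \<le> w k"
    and div: "\<not> (\<lambda>k. w k * ((norm (\<alpha> k))\<^sup>2 + (norm (\<beta> k))\<^sup>2)) summable_on UNIV"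
  shows "negligible {t \<in> {0..2*pi}. \<forall>F. finite F \<longrightarrow> (\<Sum>k\<in>F. w k * f k t) \<le> M}"
proof -
  define A where "A = {t \<in> {0..2*pi}. \<forall>F. finite F \<longrightarrow> (\<Sum>k\<in>F. w k * f k t) \<le> M}"
  have f_cont: "continuous_on S (f k)" for k S
    unfolding f_def time_factor_eq_character by (intro continuous_intros)
  have A_eq: "A = {0..2*pi} \<inter> (\<Inter>F\<in>Collect finite. {t. (\<Sum>k\<in>F. w k * f k t) \<le> M})"
    unfolding A_def by blast
  have "closed {t. (\<Sum>k\<in>F. w k * f k t) \<le> M}" for F
    by (intro closed_Collect_le continuous_intros f_cont)
  then have "compact A"
    unfolding A_eq by (intro compact_Int_closed closed_INT compact_Icc) blast
  then have A_lm: "A \<in> lmeasurable" by (rule lmeasurable_compact)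
  then have A_sets: "A \<in> sets lebesgue" by (rule fmeasurableD)
  define \<mu> where "\<mu> = measure lebesgue A"
  define a where "a k = (norm (\<alpha> k))\<^sup>2 + (norm (\<beta> k))\<^sup>2" for k
  define iA :: "real \<Rightarrow> complex" where "iA = indicator A"
  have "\<mu> = 0"
  proof (rule ccontr)
    assume "\<mu> \<noteq> 0"
    then have \<mu>: "0 < \<mu>" unfolding \<mu>_def by (simp only: zero_less_measure_iff not_False_eq_True)
    have iA_meas: "iA \<in> borel_measurable lebesgue"
      unfolding iA_def using A_sets by (rule borel_measurable_indicator)
    have iA_sq: "set_integrable lebesgue {0..2*pi} (\<lambda>x. (norm (iA x))\<^sup>2)"
    proof (rule set_integrable_bound)
      show "set_integrable lebesgue {0..2*pi} (\<lambda>x. 1 :: real)"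
        by (intro absolutely_integrable_continuous_real continuous_intros)
      show "set_borel_measurable lebesgue {0..2*pi} (\<lambda>x. (norm (iA x))\<^sup>2)"
        unfolding set_borel_measurable_def
        by (intro borel_measurable_scaleR borel_measurable_indicator borel_measurable_power
            measurable_compose[OF iA_meas borel_measurable_norm]) auto
    qed (auto simp: iA_def indicator_def)
    \<comment> \<open>the indices of large cross terms: \<open>2\<pi>\<close> times the coefficient is the integral of the phase over \<open>A\<close>\<close>
    define K where "K = {k. \<mu> / (4 * pi) \<le> norm (fourier_coeff iA (2 * k\<^sup>2))}"
    have "finite K"
    proof -
      define S where "S = {n. \<mu> / (4 * pi) \<le> norm (fourier_coeff iA n)}"
      have S: "finite S"
        unfolding S_def using \<mu> by (intro finite_large_fourier_coeffs iA_meas iA_sq) auto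
      define B where "B = (\<Sum>n\<in>S. \<bar>n\<bar>)"
      have "K \<subseteq> {- B..B}"
      proof
        fix k assume "k \<in> K"
        then have "\<bar>2 * k\<^sup>2\<bar> \<le> B"
          unfolding B_def K_def using S by (intro member_le_sum) (auto simp: S_def)
        moreover have "\<bar>k\<bar> \<le> k\<^sup>2"
          using mult_left_mono[of 1 "\<bar>k\<bar>" "\<bar>k\<bar>"]
          by (cases "k = 0") (auto simp: power2_eq_square abs_mult_self_eq)
        ultimately show "k \<in> {- B..B}" by auto
      qed
      then show ?thesis by (rule finite_subset) simp
    qed
    have integ: "set_integrable lebesgue A h" if "continuous_on {0..2*pi} h" for h :: "real \<Rightarrow> 'x::euclidean_space"
      by (rule set_integrable_subset[OF absolutely_integrable_continuous_real[OF that] A_sets]) (auto simp: A_def)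
    have average: "(\<mu> / 2) * a k \<le> (LINT t:A|lebesgue. f k t)" if "k \<notin> K" for k
    proof -
      have f_eq: "f k t = a k + Re (2 * \<alpha> k * cnj (\<beta> k) * character (- (2 * k\<^sup>2)) t)" for t
      proof -
        let ?z = "time_factor t k"
        have zz: "?z * ?z = character (- (2 * k\<^sup>2)) t"
          by (simp add: time_factor_eq_character character_add_int[symmetric])
        have sq: "(norm (z + w))\<^sup>2 = (norm z)\<^sup>2 + (norm w)\<^sup>2 + Re (2 * z * cnj w)" for z w :: complex
          by (simp only: cmod_power2) (simp add: power2_eq_square algebra_simps)
        have "f k t = a k + Re (2 * (?z * \<alpha> k) * cnj (cnj ?z * \<beta> k))"
          by (simp only: f_def a_def sq norm_mult norm_time_factor complex_mod_cnj mult_1)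
        also have "2 * (?z * \<alpha> k) * cnj (cnj ?z * \<beta> k) = 2 * \<alpha> k * cnj (\<beta> k) * (?z * ?z)"
          by simp
        finally show ?thesis unfolding zz .
      qed
      have coeff: "(LINT t:A|lebesgue. character (- n) t) = 2 * pi * fourier_coeff iA n" for n
      proof -
        have "(LINT t:A|lebesgue. character (- n) t) = (LINT t:{0..2*pi}|lebesgue. iA t * character (- n) t)"
          unfolding set_lebesgue_integral_def
          by (intro Bochner_Integration.integral_cong) (auto simp: iA_def indicator_def A_def)
        then show ?thesis by (simp add: fourier_coeff_eq)
      qed
      have "(LINT t:A|lebesgue. f k t) =
          (LINT t:A|lebesgue. a k) + (LINT t:A|lebesgue. Re (2 * \<alpha> k * cnj (\<beta> k) * character (- (2 * k\<^sup>2)) t))"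
        unfolding f_eq by (intro set_integral_add integ continuous_intros)
      also have "(LINT t:A|lebesgue. a k) = \<mu> * a k"
        using fmeasurableD2[OF A_lm] A_sets by (subst set_integral_const) (auto simp: \<mu>_def)
      also have "(LINT t:A|lebesgue. Re (2 * \<alpha> k * cnj (\<beta> k) * character (- (2 * k\<^sup>2)) t)) =
          Re (LINT t:A|lebesgue. 2 * \<alpha> k * cnj (\<beta> k) * character (- (2 * k\<^sup>2)) t)"
        by (intro set_integral_Re(2) integ continuous_intros)
      also have "(LINT t:A|lebesgue. 2 * \<alpha> k * cnj (\<beta> k) * character (- (2 * k\<^sup>2)) t) =
          2 * \<alpha> k * cnj (\<beta> k) * (2 * pi * fourier_coeff iA (2 * k\<^sup>2))"
        by (simp only: set_integral_mult_right coeff)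
      finally have eq: "(LINT t:A|lebesgue. f k t) =
          \<mu> * a k + Re (2 * \<alpha> k * cnj (\<beta> k) * (2 * pi * fourier_coeff iA (2 * k\<^sup>2)))" .
      have "\<bar>Re (2 * \<alpha> k * cnj (\<beta> k) * (2 * pi * fourier_coeff iA (2 * k\<^sup>2)))\<bar> \<le>
          norm (2 * \<alpha> k * cnj (\<beta> k) * (2 * pi * fourier_coeff iA (2 * k\<^sup>2)))"
        by (rule abs_Re_le_cmod)
      also have "\<dots> = (2 * norm (\<alpha> k) * norm (\<beta> k)) * (2 * pi * norm (fourier_coeff iA (2 * k\<^sup>2)))"
        by (simp add: norm_mult)
      also have "\<dots> \<le> a k * (\<mu> / 2)"
      proof (rule mult_mono)
        show "2 * norm (\<alpha> k) * norm (\<beta> k) \<le> a k"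
          unfolding a_def by (rule sum_squares_bound)
        show "2 * pi * norm (fourier_coeff iA (2 * k\<^sup>2)) \<le> \<mu> / 2"
          using that by (simp add: K_def field_simps)
      qed (auto simp: a_def)
      finally have small: "\<bar>Re (2 * \<alpha> k * cnj (\<beta> k) * (2 * pi * fourier_coeff iA (2 * k\<^sup>2)))\<bar> \<le> a k * (\<mu> / 2)" .
      have half: "m / 2 * y \<le> m * y + r" if "\<bar>r\<bar> \<le> y * (m / 2)" for y r m :: real
      proof -
        have "m * y = m / 2 * y + y * (m / 2)" by simp
        then show ?thesis using abs_le_D2[OF that] by linarith
      qed
      show ?thesis unfolding eq by (rule half[OF small])
    qed
    have bound: "(\<Sum>k\<in>F. w k * a k) \<le> 2 * M + (\<Sum>k\<in>K. w k * a k)" if F: "finite F" for F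
    proof -
      have "(\<mu> / 2) * (\<Sum>k\<in>F - K. w k * a k) = (\<Sum>k\<in>F - K. w k * ((\<mu> / 2) * a k))"
        by (simp add: sum_distrib_left mult_ac)
      also have "\<dots> \<le> (\<Sum>k\<in>F - K. w k * (LINT t:A|lebesgue. f k t))"
        using average w by (intro sum_mono mult_left_mono) auto
      also have "\<dots> = (LINT t:A|lebesgue. (\<Sum>k\<in>F - K. w k * f k t))"
        by (subst set_integral_sum) (auto intro!: integ continuous_intros f_cont)
      also have "\<dots> \<le> (LINT t:A|lebesgue. M)"
        using F by (intro set_integral_mono integ continuous_intros f_cont) (auto simp: A_def)
      also have "\<dots> = \<mu> * M" 
        using fmeasurableD2[OF A_lm] A_sets by (subst set_integral_const) (auto simp: \<mu>_def)
      finally have "(\<Sum>k\<in>F - K. w k * a k) \<le> 2 * M" using \<mu> by (simp add: field_simps)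
      moreover have "(\<Sum>k\<in>F. w k * a k) \<le> (\<Sum>k\<in>(F - K) \<union> K. w k * a k)"
        using F \<open>finite K\<close> w by (intro sum_mono2) (auto simp: a_def)
      moreover have "(\<Sum>k\<in>(F - K) \<union> K. w k * a k) = (\<Sum>k\<in>F - K. w k * a k) + (\<Sum>k\<in>K. w k * a k)"
        using F \<open>finite K\<close> by (intro sum.union_disjoint) auto
      ultimately show ?thesis by linarith
    qed
    have "(\<lambda>k. w k * a k) summable_on UNIV"
    proof (rule nonneg_bdd_above_summable_on)
      show "0 \<le> w k * a k" for k using w by (simp add: a_def)
      show "bdd_above (sum (\<lambda>k. w k * a k) ` {F. F \<subseteq> UNIV \<and> finite F})"
        using bound by (intro bdd_aboveI2[where M = "2 * M + (\<Sum>k\<in>K. w k * a k)"]) simp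
    qed
    then show False using div by (simp add: a_def)
  qed
  then have "negligible A"
    using A_lm unfolding \<mu>_def negligible_iff_measure by blast
  then show ?thesis by (simp only: A_def)
qed

lemma AE_oscillating_sum_diverges:
  fixes \<alpha> \<beta> :: "int \<Rightarrow> complex" and w :: "int \<Rightarrow> real"
  assumes w: "\<And>k. 0 \<le> w k"
    and div: "\<not> (\<lambda>k. w k * ((norm (\<alpha> k))\<^sup>2 + (norm (\<beta> k))\<^sup>2)) summable_on UNIV"
  shows "AE t in lebesgue. \<not> (\<lambda>k. w k *
    (norm (time_factor t k * \<alpha> k + cnj (time_factor t k) * \<beta> k))\<^sup>2) summable_on UNIV"
proof -
  let ?f = "\<lambda>k t. (norm (time_factor t k * \<alpha> k + cnj (time_factor t k) * \<beta> k))\<^sup>2"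
  define A where "A M = {t \<in> {0..2*pi}. \<forall>F. finite F \<longrightarrow> (\<Sum>k\<in>F. w k * ?f k t) \<le> M}" for M
  define B where "B = (\<Union>m::int. \<Union>M::nat. (\<lambda>t. 2 * pi * of_int m + t) ` A (real M))"
  have "negligible (A M)" for M
    unfolding A_def by (rule negligible_bounded_oscillating_sum[OF w div])
  then have "negligible B"
    unfolding B_def by (intro negligible_countable_Union) (auto intro!: negligible_countable_Union negligible_translation)
  moreover have "t \<in> B" if sm: "(\<lambda>k. w k * ?f k t) summable_on UNIV" for t
  proof -
    define m where "m = \<lfloor>t / (2 * pi)\<rfloor>"
    define s where "s = t - 2 * pi * of_int m"
    have "of_int m \<le> t / (2 * pi)" "t / (2 * pi) \<le> of_int m + 1"
      unfolding m_def by linarith+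
    then have s: "s \<in> {0..2*pi}" unfolding s_def by (auto simp: field_simps)
    obtain M :: nat where M: "infsum (\<lambda>k. w k * ?f k t) UNIV \<le> real M" using real_arch_simple by blast
    have "time_factor t k = time_factor s k" for k
      using time_factor_periodic[of s m k] by (simp add: s_def)
    then have "(\<Sum>k\<in>F. w k * ?f k s) \<le> real M" if "finite F" for F
      using finite_sum_le_infsum[OF sm that] M w by simp
    then have "s \<in> A (real M)" using s by (simp add: A_def)
    moreover have "t = 2 * pi * of_int m + s" by (simp add: s_def)
    ultimately show ?thesis unfolding B_def by blast
  qed
  ultimately show ?thesis
    by (intro AE_I'[of B]) (auto simp: negligible_iff_null_sets)
qed

section \<open>Graphs and covering numbers\<close>

lemma covering_number_cover:
  assumes "finite C" "E \<subseteq> (\<Union>c\<in>C. ball c \<epsilon>)"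
  obtains D where "finite D" "card D = covering_number E \<epsilon>" "E \<subseteq> (\<Union>c\<in>D. ball c \<epsilon>)"
proof -
  have "\<exists>D. finite D \<and> card D = covering_number E \<epsilon> \<and> E \<subseteq> (\<Union>c\<in>D. ball c \<epsilon>)"
    unfolding covering_number_def by (rule LeastI_ex) (use assms in blast)
  then show ?thesis using that by blast
qed

lemma covering_number_le_card:
  assumes "finite C" "E \<subseteq> (\<Union>c\<in>C. ball c \<epsilon>)"
  shows "covering_number E \<epsilon> \<le> card C"
  unfolding covering_number_def by (rule Least_le) (use assms in blast)

text \<open>Over a column of width \<open>\<epsilon> / 2\<close> the graph of a Hoelder function of exponent \<open>a\<close> has height of
  order \<open>\<epsilon>\<^bsup>a\<^esup>\<close>, hence meets of order \<open>\<epsilon>\<^bsup>a-1\<^esup>\<close> squares of a grid.\<close>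

lemma hoelder_graph_cover:
  fixes f :: "real \<Rightarrow> real"
  assumes hoelder: "\<And>x h. 0 < h \<Longrightarrow> h \<le> 1 \<Longrightarrow> \<bar>f (x + h) - f x\<bar> \<le> C * h powr a"
    and C: "0 \<le> C" and a: "0 < a" "a \<le> 1" and \<epsilon>: "0 < \<epsilon>" "\<epsilon> < 1"
  obtains D where "finite D" "torus_graph f \<subseteq> (\<Union>c\<in>D. ball c \<epsilon>)"
    "real (card D) \<le> (2 * pi + 2) * (2 * C + 5) * 2 powr (2 - a) * \<epsilon> powr (a - 2)"
proof -
  \<comment> \<open>a square of side \<open>\<epsilon> / 2\<close> lies in the ball of radius \<open>\<epsilon>\<close> about its lower left corner\<close>
  define \<delta> where "\<delta> = \<epsilon> / 2"
  have \<delta>: "0 < \<delta>" "\<delta> < 1" "\<delta> \<le> 1" using \<epsilon> by (auto simp: \<delta>_def)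
  define n where "n = nat \<lceil>2 * pi / \<delta>\<rceil>"
  define m where "m = \<lceil>C * \<delta> powr a / \<delta>\<rceil>"
  define centre where "centre = (\<lambda>(j::nat, i::int). (real j * \<delta>, f (real j * \<delta>) + of_int i * \<delta>))"
  define D where "D = centre ` ({..n} \<times> {- m - 1..m})"
  have "0 \<le> C * \<delta> powr a / \<delta>" using C \<delta> by simp
  then have m0: "0 \<le> m" unfolding m_def by linarith
  have "finite D" by (simp add: D_def)
  moreover have "torus_graph f \<subseteq> (\<Union>c\<in>D. ball c \<epsilon>)"
  proof
    fix p assume "p \<in> torus_graph f"
    then obtain x where x: "x \<in> {0..2*pi}" "p = (x, f x)" by (auto simp: torus_graph_def)
    define j where "j = nat \<lfloor>x / \<delta>\<rfloor>"
    have "real j \<le> x / \<delta>" "x / \<delta> < real j + 1"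
      unfolding j_def using x \<delta> by (simp_all add: of_nat_nat)
    then have jx: "real j * \<delta> \<le> x" "x < real j * \<delta> + \<delta>"
      using \<delta> by (simp_all add: field_simps)
    have "x / \<delta> \<le> 2 * pi / \<delta>" using x \<delta> by (intro divide_right_mono) auto
    then have jn: "j \<le> n" unfolding j_def n_def by (intro nat_mono) linarith
    have osc: "\<bar>f x - f (real j * \<delta>)\<bar> \<le> C * \<delta> powr a"
    proof (cases "x = real j * \<delta>")
      case False
      define h where "h = x - real j * \<delta>"
      have h: "0 < h" "h \<le> \<delta>" using jx False by (auto simp: h_def)
      have "\<bar>f (real j * \<delta> + h) - f (real j * \<delta>)\<bar> \<le> C * h powr a"
        using h \<delta> by (intro hoelder) auto
      also have "\<dots> \<le> C * \<delta> powr a" using h C a by (intro mult_left_mono powr_mono2) auto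
      finally show ?thesis by (simp add: h_def)
    qed (use C in simp)
    define i where "i = \<lfloor>(f x - f (real j * \<delta>)) / \<delta>\<rfloor>"
    have "of_int i \<le> (f x - f (real j * \<delta>)) / \<delta>" "(f x - f (real j * \<delta>)) / \<delta> < of_int i + 1"
      unfolding i_def by linarith+
    then have iy: "of_int i * \<delta> \<le> f x - f (real j * \<delta>)" "f x - f (real j * \<delta>) < of_int i * \<delta> + \<delta>"
      using \<delta> by (simp_all add: field_simps)
    have "\<bar>(f x - f (real j * \<delta>)) / \<delta>\<bar> \<le> C * \<delta> powr a / \<delta>"
      using osc \<delta> by (simp add: divide_right_mono)
    then have im: "- m - 1 \<le> i" "i \<le> m" unfolding i_def m_def by linarith+
    have "dist (centre (j, i)) p < \<epsilon>"
    proof -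
      have "dist (centre (j, i)) p \<le> \<bar>real j * \<delta> - x\<bar> + \<bar>f (real j * \<delta>) + of_int i * \<delta> - f x\<bar>"
        using sqrt_sum_squares_le_sum_abs[of "real j * \<delta> - x" "f (real j * \<delta>) + of_int i * \<delta> - f x"]
        by (simp add: centre_def x(2) dist_Pair_Pair dist_real_def)
      also have "\<dots> < \<delta> + \<delta>" using jx iy by (intro add_strict_mono) auto
      finally show ?thesis by (simp add: \<delta>_def)
    qed
    moreover have "centre (j, i) \<in> D" unfolding D_def using jn im by auto
    ultimately show "p \<in> (\<Union>c\<in>D. ball c \<epsilon>)" by (auto simp: ball_def)
  qed
  moreover have "real (card D) \<le> (2 * pi + 2) * (2 * C + 5) * 2 powr (2 - a) * \<epsilon> powr (a - 2)"
  proof -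
    have "card D \<le> card ({..n} \<times> {- m - 1..m})" unfolding D_def by (rule card_image_le) simp
    then have "real (card D) \<le> real (card ({..n} \<times> {- m - 1..m}))" by (rule of_nat_mono)
    also have "\<dots> = (real n + 1) * (2 * of_int m + 2)" using m0 by (simp add: algebra_simps)
    also have "\<dots> \<le> ((2 * pi + 2) * \<delta> powr - 1) * ((2 * C + 5) * \<delta> powr (a - 1))"
    proof (rule mult_mono)
      have "real n \<le> 2 * pi / \<delta> + 1"
        unfolding n_def using \<delta> by (simp add: of_nat_nat)
      moreover have "1 \<le> 1 / \<delta>" using \<delta> by simp
      ultimately have "real n + 1 \<le> 2 * pi / \<delta> + 2 * (1 / \<delta>)" by linarith
      then show "real n + 1 \<le> (2 * pi + 2) * \<delta> powr - 1"
        using \<delta> by (simp add: powr_minus_divide add_divide_distrib)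
      have eq: "C * \<delta> powr a / \<delta> = C * \<delta> powr (a - 1)"
        using \<delta> by (simp add: powr_diff)
      have "of_int m \<le> C * \<delta> powr (a - 1) + 1" unfolding m_def eq by linarith
      moreover have "1 \<le> \<delta> powr (a - 1)"
        using powr_mono2'[of "a - 1" \<delta> 1] \<delta> a by simp
      ultimately have "2 * of_int m + 2 \<le> 2 * (C * \<delta> powr (a - 1)) + 5 * \<delta> powr (a - 1)" by linarith
      then show "2 * of_int m + 2 \<le> (2 * C + 5) * \<delta> powr (a - 1)" by (simp add: algebra_simps)
    qed (use m0 in auto)
    also have "\<dots> = (2 * pi + 2) * (2 * C + 5) * (\<delta> powr (- 1) * \<delta> powr (a - 1))" by (simp only: mult_ac)
    also have "\<delta> powr (- 1) * \<delta> powr (a - 1) = \<delta> powr (a - 2)" by (subst powr_add[symmetric]) simp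
    also have "\<delta> powr (a - 2) = 2 powr (2 - a) * \<epsilon> powr (a - 2)"
      using \<epsilon> powr_minus_divide[of 2 "a - 2"] by (simp add: \<delta>_def powr_divide)
    finally show ?thesis by (simp only: mult_ac)
  qed
  ultimately show ?thesis by (rule that)
qed

lemma upper_minkowski_dim_le:
  assumes "0 \<le> d" "\<And>\<epsilon>. 0 < \<epsilon> \<Longrightarrow> \<epsilon> < 1 \<Longrightarrow> real (covering_number E \<epsilon>) \<le> K * \<epsilon> powr (- d)"
  shows "upper_minkowski_dim E \<le> ereal d"
proof -
  define K' where "K' = max K 1"
  let ?r = "\<lambda>\<epsilon>. ln (real (covering_number E \<epsilon>)) / ln (1 / \<epsilon>)"
  have "upper_minkowski_dim E \<le> Limsup (at_right 0) (\<lambda>\<epsilon>. ereal (ln K' / ln (1 / \<epsilon>) + d))"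
    unfolding upper_minkowski_dim_def
  proof (rule Limsup_mono)
    have "\<forall>\<^sub>F \<epsilon> in at_right (0::real). \<epsilon> \<in> {0<..<1}" by (rule eventually_at_right_real) simp
    then show "\<forall>\<^sub>F \<epsilon> in at_right 0. ereal (?r \<epsilon>) \<le> ereal (ln K' / ln (1 / \<epsilon>) + d)"
    proof eventually_elim
      case (elim \<epsilon>)
      then have \<epsilon>: "0 < \<epsilon>" "\<epsilon> < 1" by auto
      then have L: "0 < ln (1 / \<epsilon>)" by (simp add: ln_div)
      have p1: "1 \<le> \<epsilon> powr (- d)" using powr_mono2'[of "- d" \<epsilon> 1] \<epsilon> assms(1) by simp
      have "real (covering_number E \<epsilon>) \<le> K' * \<epsilon> powr (- d)"
        using assms(2)[OF \<epsilon>] mult_right_mono[of K K' "\<epsilon> powr (- d)"] by (simp add: K'_def)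
      moreover have "1 \<le> K' * \<epsilon> powr (- d)"
        using mult_mono[of 1 K' 1 "\<epsilon> powr (- d)"] p1 by (simp add: K'_def)
      ultimately have "ln (real (covering_number E \<epsilon>)) \<le> ln (K' * \<epsilon> powr (- d))"
        by (cases "covering_number E \<epsilon> = 0") auto
      also have "\<dots> = ln K' + d * ln (1 / \<epsilon>)"
        using \<epsilon> by (simp add: ln_mult_pos K'_def ln_powr ln_div)
      finally have "?r \<epsilon> \<le> (ln K' + d * ln (1 / \<epsilon>)) / ln (1 / \<epsilon>)"
        using L by (intro divide_right_mono) auto
      also have "\<dots> = ln K' / ln (1 / \<epsilon>) + d" using L by (simp add: add_divide_distrib)
      finally show ?case by simp
    qed
  qed
  also have "\<dots> = ereal d"
  proof (rule lim_imp_Limsup)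
    have "LIM \<epsilon> at_right (0::real). - ln \<epsilon> :> at_top"
      using ln_at_0 by (simp add: filterlim_uminus_at_top)
    moreover have "\<forall>\<^sub>F \<epsilon> in at_right (0::real). - ln \<epsilon> = ln (1 / \<epsilon>)"
      using eventually_at_right_less[of 0] by eventually_elim (simp add: ln_div)
    ultimately have "LIM \<epsilon> at_right (0::real). ln (1 / \<epsilon>) :> at_top"
      by (rule filterlim_cong[OF refl refl, THEN iffD1, rotated])
    then have "((\<lambda>\<epsilon>. ln K' / ln (1 / \<epsilon>) + d) \<longlongrightarrow> 0 + d) (at_right 0)"
      by (intro tendsto_intros tendsto_divide_0[OF tendsto_const] filterlim_at_top_imp_at_infinity)
    then show "((\<lambda>\<epsilon>. ereal (ln K' / ln (1 / \<epsilon>) + d)) \<longlongrightarrow> ereal d) (at_right 0)" by simp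
  qed (simp add: trivial_limit_at_right_real)
  finally show ?thesis .
qed

lemma upper_minkowski_dim_less_imp:
  assumes "upper_minkowski_dim E < ereal d"
  obtains \<epsilon>0 where "0 < \<epsilon>0" "\<epsilon>0 \<le> 1"
    "\<And>\<epsilon>. 0 < \<epsilon> \<Longrightarrow> \<epsilon> < \<epsilon>0 \<Longrightarrow> real (covering_number E \<epsilon>) \<le> \<epsilon> powr (- d)"
proof -
  have "\<forall>\<^sub>F \<epsilon> in at_right 0. ereal (ln (real (covering_number E \<epsilon>)) / ln (1 / \<epsilon>)) < ereal d"
    using assms unfolding upper_minkowski_dim_def by (rule Limsup_lessD)
  then obtain b where b: "0 < b"
    "\<And>\<epsilon>. 0 < \<epsilon> \<Longrightarrow> \<epsilon> < b \<Longrightarrow> ln (real (covering_number E \<epsilon>)) / ln (1 / \<epsilon>) < d"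
    unfolding eventually_at_right_field by auto
  have "real (covering_number E \<epsilon>) \<le> \<epsilon> powr (- d)" if \<epsilon>: "0 < \<epsilon>" "\<epsilon> < min b 1" for \<epsilon>
  proof (cases "covering_number E \<epsilon> = 0")
    case False
    have "0 < ln (1 / \<epsilon>)" using \<epsilon> by (simp add: ln_div)
    then have "ln (real (covering_number E \<epsilon>)) \<le> d * ln (1 / \<epsilon>)"
      using b(2)[of \<epsilon>] \<epsilon> by (simp add: pos_divide_less_eq)
    also have "\<dots> = ln (\<epsilon> powr (- d))" using \<epsilon> by (simp add: ln_powr ln_div)
    finally show ?thesis using False \<epsilon> by (subst (asm) ln_le_cancel_iff) auto
  qed simp
  then show ?thesis using b(1) by (intro that[of "min b 1"]) auto
qed

lemma hoelder_graph_dim_le: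
  fixes f :: "real \<Rightarrow> real"
  assumes "\<And>x h. 0 < h \<Longrightarrow> h \<le> 1 \<Longrightarrow> \<bar>f (x + h) - f x\<bar> \<le> C * h powr a"
    and "0 \<le> C" and "0 < a" "a \<le> 1"
  shows "upper_minkowski_dim (torus_graph f) \<le> ereal (2 - a)"
proof (rule upper_minkowski_dim_le)
  fix \<epsilon> :: real assume \<epsilon>: "0 < \<epsilon>" "\<epsilon> < 1"
  obtain D where D: "finite D" "torus_graph f \<subseteq> (\<Union>c\<in>D. ball c \<epsilon>)"
    "real (card D) \<le> (2 * pi + 2) * (2 * C + 5) * 2 powr (2 - a) * \<epsilon> powr (a - 2)"
    using hoelder_graph_cover[OF assms \<epsilon>] by blast
  then show "real (covering_number (torus_graph f) \<epsilon>) \<le> ((2 * pi + 2) * (2 * C + 5) * 2 powr (2 - a)) * \<epsilon> powr - (2 - a)"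
    using covering_number_le_card[OF D(1,2)] by simp
qed (use assms in simp)

text \<open>A ball of radius \<open>h\<close> can meet the part of the graph above \<open>[x, x + h]\<close> only if \<open>x\<close> lies in an
  interval of length \<open>3 h\<close>, and it covers an interval of values of length \<open>2 h\<close>. By the intermediate
  value theorem the values between \<open>f x\<close> and \<open>f (x + h)\<close> are all covered.\<close>

lemma increment_le_cover:
  fixes f :: "real \<Rightarrow> real"
  assumes cont: "continuous_on {x..x + h} f" and h: "0 \<le> h" and D: "finite D"
    and cover: "\<And>z. z \<in> {x..x + h} \<Longrightarrow> (z, f z) \<in> (\<Union>c\<in>D. ball c h)"
  shows "\<bar>f (x + h) - f x\<bar> \<le> (\<Sum>c\<in>D. 2 * h * indicator {fst c - 2 * h<..<fst c + h} x)"
proof -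
  define J where "J = {c \<in> D. x \<in> {fst c - 2 * h<..<fst c + h}}"
  let ?S = "closed_segment (f x) (f (x + h))"
  have "?S \<subseteq> (\<Union>c\<in>J. {snd c - h..snd c + h})"
  proof
    fix v assume "v \<in> ?S"
    moreover have "connected (f ` {x..x + h})"
      by (intro connected_continuous_image cont) simp
    then have "convex (f ` {x..x + h})"
      by (simp add: is_interval_connected_1[symmetric] is_interval_convex_1)
    then have "?S \<subseteq> f ` {x..x + h}"
      using h by (intro closed_segment_subset) auto
    ultimately obtain z where z: "z \<in> {x..x + h}" "v = f z" by auto
    obtain c where c: "c \<in> D" "dist c (z, f z) < h" using cover[OF z(1)] by (auto simp: ball_def)
    have "\<bar>fst c - z\<bar> < h" "\<bar>snd c - f z\<bar> < h"
      using c(2) dist_fst_le[of c "(z, f z)"] dist_snd_le[of c "(z, f z)"] by (simp_all add: dist_real_def)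
    then have "c \<in> J" "v \<in> {snd c - h..snd c + h}"
      using c(1) z unfolding J_def by (auto simp: abs_less_iff)
    then show "v \<in> (\<Union>c\<in>J. {snd c - h..snd c + h})" by blast
  qed
  moreover have "finite J" using D by (simp add: J_def)
  moreover have "(\<Union>c\<in>J. {snd c - h..snd c + h}) \<in> fmeasurable lborel"
    using \<open>finite J\<close> by (intro fmeasurable.finite_UN) (auto intro!: fmeasurableI simp: emeasure_lborel_Icc_eq)
  ultimately have "measure lborel ?S \<le> measure lborel (\<Union>c\<in>J. {snd c - h..snd c + h})"
    by (intro measure_mono_fmeasurable) (auto simp: closed_segment_eq_real_ivl)
  also have "\<dots> \<le> (\<Sum>c\<in>J. measure lborel {snd c - h..snd c + h})"
    using \<open>finite J\<close> by (intro measure_UNION_le) auto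
  also have "\<dots> = (\<Sum>c\<in>J. 2 * h)" using h by simp
  also have "\<dots> = (\<Sum>c\<in>D. 2 * h * indicator {fst c - 2 * h<..<fst c + h} x)"
    using D unfolding J_def by (intro sum.mono_neutral_cong_left) (auto simp: indicator_def)
  finally show ?thesis by (simp add: closed_segment_eq_real_ivl abs_real_def split: if_splits)
qed

text \<open>Integrate the previous bound over \<open>x\<close>: each ball contributes at most \<open>2 h\<close> times \<open>3 h\<close>. Since \<open>x + h\<close> may lie
  beyond \<open>2\<pi>\<close>, the cover is copied to the next period, which doubles the number of balls.\<close>

lemma integral_increment_le_cover:
  fixes f :: "real \<Rightarrow> real"
  assumes cont: "continuous_on UNIV f" and per: "\<And>x. f (x + 2 * pi) = f x"
    and h: "0 < h" "h \<le> 1" and D: "finite D" and cover: "torus_graph f \<subseteq> (\<Union>c\<in>D. ball c h)"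
  shows "(LINT x:{0..2*pi}|lebesgue. \<bar>f (x + h) - f x\<bar>) \<le> 12 * h\<^sup>2 * real (card D)"
proof -
  define T where "T = D \<union> (\<lambda>c. (fst c + 2 * pi, snd c)) ` D"
  have T: "finite T" "card T \<le> 2 * card D"
    using D card_Un_le[of D "(\<lambda>c. (fst c + 2 * pi, snd c)) ` D"] card_image_le[OF D, of "\<lambda>c. (fst c + 2 * pi, snd c)"]
    by (auto simp: T_def)
  have cover2: "(z, f z) \<in> (\<Union>c\<in>T. ball c h)" if "0 \<le> z" "z \<le> 4 * pi" for z
  proof (cases "z \<le> 2 * pi")
    case True
    then have "(z, f z) \<in> torus_graph f" using that by (auto simp: torus_graph_def)
    then show ?thesis using cover unfolding T_def by blast
  next
    case False
    have "f (z - 2 * pi) = f z" using per[of "z - 2 * pi"] by simp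
    then have "(z - 2 * pi, f z) \<in> torus_graph f"
      using that False by (force simp: torus_graph_def intro!: image_eqI[of _ _ "z - 2 * pi"])
    then obtain c where c: "c \<in> D" "dist c (z - 2 * pi, f z) < h" using cover by (auto simp: ball_def)
    have "dist (fst c + 2 * pi, snd c) (z, f z) = dist c (z - 2 * pi, f z)"
      by (cases c) (simp add: dist_Pair_Pair dist_real_def algebra_simps)
    then show ?thesis using c by (auto simp: T_def ball_def intro!: bexI[of _ c])
  qed
  let ?g = "\<lambda>x. \<Sum>c\<in>T. 2 * h * indicator {fst c - 2 * h<..<fst c + h} x"
  have pointwise: "\<bar>f (x + h) - f x\<bar> \<le> ?g x" if "x \<in> {0..2*pi}" for x
  proof (rule increment_le_cover)
    fix z assume "z \<in> {x..x + h}"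
    then show "(z, f z) \<in> (\<Union>c\<in>T. ball c h)" using that h pi_ge_two by (intro cover2) auto
  qed (use T h in \<open>auto intro: continuous_on_subset[OF cont]\<close>)
  have ind: "set_integrable lebesgue {0..2*pi} (\<lambda>x. 2 * h * indicator {b - 2 * h<..<b + h} x :: real)"
    "(LINT x:{0..2*pi}|lebesgue. 2 * h * indicator {b - 2 * h<..<b + h} x :: real) \<le> 6 * h\<^sup>2" for b
  proof -
    have eq: "(\<lambda>x. indicator {0..2*pi} x *\<^sub>R (indicator {b - 2 * h<..<b + h} x :: real)) =
        indicator ({0..2*pi} \<inter> {b - 2 * h<..<b + h})"
      by (auto simp: indicator_def)
    have lm: "{0..2*pi} \<inter> {b - 2 * h<..<b + h} \<in> lmeasurable" "{b - 2 * h<..<b + h} \<in> lmeasurable"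
      by (auto intro!: fmeasurable.Int)
    have i: "set_integrable lebesgue {0..2*pi} (indicator {b - 2 * h<..<b + h} :: real \<Rightarrow> real)"
      unfolding set_integrable_def eq using lm(1) by (simp add: fmeasurable_def)
    then show "set_integrable lebesgue {0..2*pi} (\<lambda>x. 2 * h * indicator {b - 2 * h<..<b + h} x :: real)"
      by (rule set_integrable_mult_right)
    have "(LINT x:{0..2*pi}|lebesgue. indicator {b - 2 * h<..<b + h} x :: real) =
        measure lebesgue ({0..2*pi} \<inter> {b - 2 * h<..<b + h})"
      unfolding set_lebesgue_integral_def eq by simp
    also have "\<dots> \<le> measure lebesgue {b - 2 * h<..<b + h}"
      using lm by (intro measure_mono_fmeasurable) auto
    also have "\<dots> = 3 * h" using h by simp
    finally have "2 * h * (LINT x:{0..2*pi}|lebesgue. indicator {b - 2 * h<..<b + h} x :: real) \<le> 2 * h * (3 * h)"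
      using h by (intro mult_left_mono) auto
    then show "(LINT x:{0..2*pi}|lebesgue. 2 * h * indicator {b - 2 * h<..<b + h} x :: real) \<le> 6 * h\<^sup>2"
      by (simp add: power2_eq_square)
  qed
  have shift_cont: "continuous_on S (\<lambda>x. f (x + h))" "continuous_on S f" for S
    by (auto intro!: continuous_on_compose2[OF cont] continuous_intros continuous_on_subset[OF cont])
  have "(LINT x:{0..2*pi}|lebesgue. \<bar>f (x + h) - f x\<bar>) \<le> (LINT x:{0..2*pi}|lebesgue. ?g x)"
    by (intro set_integral_mono pointwise set_integrable_sum ind absolutely_integrable_continuous_real
        continuous_intros shift_cont)
  also have "\<dots> = (\<Sum>c\<in>T. LINT x:{0..2*pi}|lebesgue. 2 * h * indicator {fst c - 2 * h<..<fst c + h} x)"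
    by (intro set_integral_sum ind)
  also have "\<dots> \<le> (\<Sum>c\<in>T. 6 * h\<^sup>2)" by (intro sum_mono ind)
  also have "\<dots> = 6 * h\<^sup>2 * real (card T)" by simp
  also have "\<dots> \<le> 6 * h\<^sup>2 * (2 * real (card D))"
    using T(2) by (intro mult_left_mono) auto
  finally show ?thesis by simp
qed

lemma integral_period_shift:
  fixes F :: "real \<Rightarrow> 'a::euclidean_space"
  assumes cont: "continuous_on UNIV F" and per: "\<And>x. F (x + 2 * pi) = F x" and h: "0 \<le> h" "h \<le> 2 * pi"
  shows "(LINT x:{0..2*pi}|lebesgue. F (x + h)) = (LINT x:{0..2*pi}|lebesgue. F x)"
proof -
  have c: "continuous_on S F" "continuous_on S (\<lambda>x. F (x + h))" for S
    by (auto intro!: continuous_on_compose2[OF cont] continuous_intros continuous_on_subset[OF cont])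
  have i: "F integrable_on {a..b}" for a b by (intro integrable_continuous_real c)
  have "integral {0..2*pi} (\<lambda>x. F (x + h)) = integral {h..2*pi + h} F"
    using integral_shift_Icc_real[of 0 "2*pi" F h] by (simp add: o_def add.commute)
  also have "\<dots> = integral {h..2*pi} F + integral {2*pi..2*pi + h} F"
    using h by (intro Henstock_Kurzweil_Integration.integral_combine[symmetric] i) auto
  also have "integral {2*pi..2*pi + h} F = integral {0..h} F"
    using integral_shift_Icc_real[of 0 h F "2*pi"] per by (simp add: o_def add.commute)
  also have "integral {h..2*pi} F + integral {0..h} F = integral {0..2*pi} F"
    using Henstock_Kurzweil_Integration.integral_combine[of 0 h "2*pi" F] h i by (simp add: add.commute)
  finally show ?thesis
    by (simp add: set_lebesgue_integral_eq_integral(2) absolutely_integrable_continuous_real c)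
qed

lemma fourier_coeff_increment:
  assumes cont: "continuous_on UNIV f" and per: "\<And>x. f (x + 2 * pi) = f x" and h: "0 \<le> h" "h \<le> 2 * pi"
  shows "fourier_coeff (\<lambda>x. f (x + h) - f x) k = (character k h - 1) * fourier_coeff f k"
proof -
  have c: "continuous_on S f" "continuous_on S (\<lambda>x. f (x + h))" for S
    by (auto intro!: continuous_on_compose2[OF cont] continuous_intros continuous_on_subset[OF cont])
  have "(LINT x:{0..2*pi}|lebesgue. f (x + h) * character (- k) x) =
      (LINT x:{0..2*pi}|lebesgue. character k h * (f (x + h) * character (- k) (x + h)))"
  proof -
    have "character k h * character (- k) h = 1"
      using character_add_int[of k "- k" h] by simp
    then have eq: "f (x + h) * character (- k) x = character k h * (f (x + h) * character (- k) (x + h))" for x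
      unfolding character_add by (simp add: mult_ac)
    show ?thesis by (simp only: eq)
  qed
  also have "\<dots> = character k h * (LINT x:{0..2*pi}|lebesgue. f (x + h) * character (- k) (x + h))"
    by simp
  also have "(LINT x:{0..2*pi}|lebesgue. f (x + h) * character (- k) (x + h)) =
      (LINT x:{0..2*pi}|lebesgue. f x * character (- k) x)"
    using h by (intro integral_period_shift[of "\<lambda>x. f x * character (- k) x"]) (auto intro!: continuous_intros c simp: per)
  finally have "(LINT x:{0..2*pi}|lebesgue. (f (x + h) - f x) * character (- k) x) =
      (character k h - 1) * (LINT x:{0..2*pi}|lebesgue. f x * character (- k) x)"
    by (simp add: left_diff_distrib set_integral_diff(2) absolutely_integrable_continuous_real continuous_intros c)
  then show ?thesis by (simp add: fourier_coeff_eq)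
qed

lemma dyadic_summable:
  fixes a :: "int \<Rightarrow> real"
  assumes nonneg: "\<And>k. 0 \<le> a k" and q: "0 \<le> q" "q < 1" and K: "0 \<le> K"
    and block: "\<And>j. j0 \<le> j \<Longrightarrow> (\<Sum>k\<in>{k. 2 ^ j \<le> \<bar>k\<bar> \<and> \<bar>k\<bar> < 2 ^ Suc j}. a k) \<le> K * q ^ j"
  shows "a summable_on UNIV"
proof -
  let ?B = "\<lambda>j. {k::int. \<bar>k\<bar> < 2 ^ j}"
  have fin: "finite (?B j)" for j by (rule finite_subset[of _ "{- (2 ^ j)..2 ^ j}"]) auto
  have "j0 \<le> J \<Longrightarrow> sum a (?B J) \<le> sum a (?B j0) + K * (\<Sum>j<J. q ^ j)" for J
  proof (induction J rule: dec_induct)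
    case base
    show ?case using K q by (simp add: sum_nonneg)
  next
    case (step J)
    let ?S = "{k::int. 2 ^ J \<le> \<bar>k\<bar> \<and> \<bar>k\<bar> < 2 ^ Suc J}"
    have "finite ?S" by (rule finite_subset[OF _ fin[of "Suc J"]]) auto
    moreover have "?B (Suc J) = ?B J \<union> ?S" by auto
    moreover have "?B J \<inter> ?S = {}" by auto
    ultimately have "sum a (?B (Suc J)) = sum a (?B J) + sum a ?S"
      using fin by (simp only: sum.union_disjoint)
    then show ?case using step.IH block[OF step.hyps(1)] by (simp add: algebra_simps)
  qed
  moreover have "(\<Sum>j<J. q ^ j) \<le> 1 / (1 - q)" for J
    using sum_le_suminf[OF summable_geometric, of q "{..<J}"] q by (simp add: suminf_geometric)
  ultimately have bound: "sum a (?B J) \<le> sum a (?B j0) + K * (1 / (1 - q))" if "j0 \<le> J" for J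
    using that K by (meson add_left_mono mult_left_mono order_trans)
  show ?thesis
  proof (rule nonneg_bdd_above_summable_on)
    show "bdd_above (sum a ` {F. F \<subseteq> UNIV \<and> finite F})"
    proof (rule bdd_aboveI2)
      fix F :: "int set" assume "F \<in> {F. F \<subseteq> UNIV \<and> finite F}"
      then have F: "finite F" by simp
      \<comment> \<open>any bound for the elements of \<open>F\<close> will do, as \<open>n < 2\<^sup>n\<close>\<close>
      define n where "n = nat (\<Sum>k\<in>F. \<bar>k\<bar>)"
      have "F \<subseteq> ?B (n + j0)"
      proof
        fix k assume "k \<in> F"
        then have "\<bar>k\<bar> \<le> (\<Sum>k\<in>F. \<bar>k\<bar>)" using F by (intro member_le_sum) auto
        then have "\<bar>k\<bar> \<le> int n" by (simp add: n_def)
        also have "int n < int (2 ^ n)" by (simp only: of_nat_less_iff less_exp)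
        also have "int (2 ^ n) \<le> 2 ^ (n + j0)" by simp
        finally show "k \<in> ?B (n + j0)" by simp
      qed
      then have "sum a F \<le> sum a (?B (n + j0))" using nonneg fin by (intro sum_mono2) auto
      then show "sum a F \<le> sum a (?B j0) + K * (1 / (1 - q))" using bound[of "n + j0"] by simp
    qed
  qed (use nonneg in simp)
qed

section \<open>Dimension of the graph and Sobolev regularity\<close>

text \<open>With this step the angles \<open>k h\<close> of a dyadic block lie in the second or third quadrant.\<close>

lemma norm_character_minus_1_ge:
  fixes k :: int
  assumes k: "2 ^ j \<le> \<bar>k\<bar>" "\<bar>k\<bar> < 2 ^ Suc j" and h: "h = pi / (2 * 2 ^ j)"
  shows "1 \<le> norm (character k h - 1)"
proof -
  define \<theta> where "\<theta> = real_of_int \<bar>k\<bar> * h"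
  have "real_of_int (2 ^ j) \<le> real_of_int \<bar>k\<bar>" "real_of_int \<bar>k\<bar> \<le> real_of_int (2 ^ Suc j)"
    using k by linarith+
  then have "2 ^ j * h \<le> \<theta>" "\<theta> \<le> 2 ^ Suc j * h"
    unfolding \<theta>_def h of_int_power of_int_numeral by (intro mult_right_mono; simp)+
  then have \<theta>: "pi / 2 \<le> \<theta>" "\<theta> \<le> pi" unfolding h by simp_all
  have "cos \<theta> \<le> cos (pi / 2)" using \<theta> by (intro cos_monotone_0_pi_le) auto
  moreover have "cos (real_of_int k * h) = cos \<theta>"
    unfolding \<theta>_def by (cases "0 \<le> k") (auto simp: abs_if)
  ultimately have cos: "cos (real_of_int k * h) \<le> 0" by simp
  have "(norm (character k h - 1))\<^sup>2 = (cos (of_int k * h) - 1)\<^sup>2 + (sin (of_int k * h))\<^sup>2"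
    by (simp add: character_def cmod_power2)
  also have "\<dots> = 2 - 2 * cos (of_int k * h)"
    by (simp add: power2_diff sin_squared_eq)
  finally have "1\<^sup>2 \<le> (norm (character k h - 1))\<^sup>2" using cos by simp
  then show ?thesis by (rule power2_le_imp_le) simp
qed

text \<open>If \<open>\<epsilon>\<^bsup>-d\<^esup>\<close> balls cover the graph, the increment over \<open>h\<close> has \<open>L\<^sup>1\<close> norm of order \<open>h\<^bsup>2-d\<^esup>\<close>. Multiplied
  with the uniform bound \<open>h\<^bsup>a\<^esup>\<close> this controls its \<open>L\<^sup>2\<close> norm, hence by Bessel the Fourier coefficients
  of the dyadic block of frequencies of order \<open>1 / h\<close>.\<close>

lemma dyadic_block_le:
  fixes f :: "real \<Rightarrow> real"
  assumes cont: "continuous_on UNIV f" and per: "\<And>x. f (x + 2 * pi) = f x"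
    and hoelder: "\<And>x h. 0 < h \<Longrightarrow> h \<le> 1 \<Longrightarrow> \<bar>f (x + h) - f x\<bar> \<le> C * h powr a"
    and C: "0 \<le> C" and a: "0 < a" "a \<le> 1"
    and h: "h = pi / (2 * 2 ^ j)" "h < 1"
    and cover: "real (covering_number (torus_graph f) h) \<le> h powr (- d)"
  shows "(\<Sum>k\<in>{k. 2 ^ j \<le> \<bar>k\<bar> \<and> \<bar>k\<bar> < 2 ^ Suc j}. (norm (fourier_coeff (\<lambda>x. of_real (f x)) k))\<^sup>2)
    \<le> 12 * C * h powr (2 + a - d)"
proof -
  let ?S = "{k::int. 2 ^ j \<le> \<bar>k\<bar> \<and> \<bar>k\<bar> < 2 ^ Suc j}"
  let ?F = "\<lambda>x. complex_of_real (f x)"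
  let ?d = "\<lambda>x. ?F (x + h) - ?F x"
  have h0: "0 < h" unfolding h(1) by simp
  have "?S \<subseteq> {- (2 ^ Suc j)..2 ^ Suc j}"
  proof
    fix k assume "k \<in> ?S"
    then have "\<bar>k\<bar> < 2 ^ Suc j" by blast
    then show "k \<in> {- (2 ^ Suc j)..2 ^ Suc j}" unfolding atLeastAtMost_iff by linarith
  qed
  then have fin: "finite ?S" by (rule finite_subset) (rule finite_atLeastAtMost_int)
  have c: "continuous_on S f" "continuous_on S (\<lambda>x. f (x + h))" for S
    by (auto intro!: continuous_on_compose2[OF cont] continuous_intros continuous_on_subset[OF cont])
  obtain D0 where D0: "finite D0" "torus_graph f \<subseteq> (\<Union>c\<in>D0. ball c h)"
  proof (rule hoelder_graph_cover[of f C a h])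
    show "\<bar>f (x + t) - f x\<bar> \<le> C * t powr a" if "0 < t" "t \<le> 1" for x t
      using that by (rule hoelder)
  qed (use C a h0 h(2) that in blast)+
  obtain D where D: "finite D" "card D = covering_number (torus_graph f) h" "torus_graph f \<subseteq> (\<Union>c\<in>D. ball c h)"
    by (rule covering_number_cover[OF D0])
  have d_cont: "continuous_on S ?d" for S by (intro continuous_intros c)
  have d_meas: "?d \<in> borel_measurable lebesgue"
    using borel_measurable_continuous_onI[OF d_cont] by (intro measurable_completion) simp
  have d_sq: "set_integrable lebesgue {0..2*pi} (\<lambda>x. (norm (?d x))\<^sup>2)"
    by (intro absolutely_integrable_continuous_real continuous_intros d_cont c)
  have norm_d: "norm (?d x) = \<bar>f (x + h) - f x\<bar>" for x
    by (simp only: of_real_diff[symmetric] norm_of_real)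
  have "(\<Sum>k\<in>?S. (norm (fourier_coeff ?F k))\<^sup>2) \<le> (\<Sum>k\<in>?S. (norm (fourier_coeff ?d k))\<^sup>2)"
  proof (rule sum_mono)
    fix k assume "k \<in> ?S"
    then have "1 \<le> norm (character k h - 1)" using h(1) by (intro norm_character_minus_1_ge[of j]) auto
    then have "1 * norm (fourier_coeff ?F k) \<le> norm (character k h - 1) * norm (fourier_coeff ?F k)"
      by (intro mult_right_mono) auto
    also have "\<dots> = norm (fourier_coeff ?d k)"
      using fourier_coeff_increment[of ?F h k] h0 h(2) per pi_ge_two c
      by (simp add: norm_mult continuous_on_of_real)
    finally show "(norm (fourier_coeff ?F k))\<^sup>2 \<le> (norm (fourier_coeff ?d k))\<^sup>2"
      by (intro power_mono) auto
  qed
  also have "\<dots> \<le> 2 * pi * (\<Sum>k\<in>?S. (norm (fourier_coeff ?d k))\<^sup>2)"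
    using pi_ge_two mult_right_mono[of 1 "2 * pi" "\<Sum>k\<in>?S. (norm (fourier_coeff ?d k))\<^sup>2"]
    by (simp add: sum_nonneg)
  also have "\<dots> \<le> (LINT x:{0..2*pi}|lebesgue. (norm (?d x))\<^sup>2)"
    by (rule bessel[OF d_meas d_sq fin])
  also have "\<dots> \<le> (LINT x:{0..2*pi}|lebesgue. (C * h powr a) * \<bar>f (x + h) - f x\<bar>)"
  proof (rule set_integral_mono[OF d_sq])
    show "set_integrable lebesgue {0..2*pi} (\<lambda>x. (C * h powr a) * \<bar>f (x + h) - f x\<bar>)"
      by (intro absolutely_integrable_continuous_real continuous_intros c)
    show "(norm (?d x))\<^sup>2 \<le> (C * h powr a) * \<bar>f (x + h) - f x\<bar>" for x
      unfolding norm_d power2_eq_square using h0 h(2) by (intro mult_right_mono hoelder) auto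
  qed
  also have "\<dots> = (C * h powr a) * (LINT x:{0..2*pi}|lebesgue. \<bar>f (x + h) - f x\<bar>)"
    by (rule set_integral_mult_right)
  also have "\<dots> \<le> (C * h powr a) * (12 * h\<^sup>2 * real (card D))"
    using C h0 h(2) D by (intro mult_left_mono integral_increment_le_cover cont per) auto
  also have "\<dots> \<le> (C * h powr a) * (12 * h\<^sup>2 * h powr (- d))"
    using C cover unfolding D(2) by (intro mult_left_mono) auto
  also have "\<dots> = 12 * C * (h powr 2 * h powr a * h powr (- d))"
    using h0 by (simp add: powr_numeral)
  also have "h powr 2 * h powr a * h powr (- d) = h powr (2 + a - d)"
    by (simp only: powr_add[symmetric]) simp
  finally show ?thesis .
qed

text \<open>The block of frequencies of order \<open>2\<^sup>j\<close> contributes at most a constant times \<open>2\<^bsup>j(2s-\<gamma>)\<^esup>\<close>, where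
  \<open>\<gamma> = 2 + a - d\<close>: a convergent geometric series.\<close>

lemma small_covering_imp_sobolev:
  fixes f :: "real \<Rightarrow> real"
  assumes cont: "continuous_on UNIV f" and per: "\<And>x. f (x + 2 * pi) = f x"
    and hoelder: "\<And>x h. 0 < h \<Longrightarrow> h \<le> 1 \<Longrightarrow> \<bar>f (x + h) - f x\<bar> \<le> C * h powr a"
    and C: "0 \<le> C" and a: "0 < a" "a \<le> 1" and \<epsilon>0: "0 < \<epsilon>0"
    and cover: "\<And>\<epsilon>. 0 < \<epsilon> \<Longrightarrow> \<epsilon> < \<epsilon>0 \<Longrightarrow> real (covering_number (torus_graph f) \<epsilon>) \<le> \<epsilon> powr (- d)"
    and s: "0 \<le> s" "2 * s < 2 + a - d"
  shows "(\<lambda>k. (1 + \<bar>real_of_int k\<bar>) powr (2 * s) * (norm (fourier_coeff (\<lambda>x. of_real (f x)) k))\<^sup>2)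
    summable_on UNIV"
proof -
  define \<gamma> where "\<gamma> = 2 + a - d"
  define q where "q = 2 powr (2 * s - \<gamma>)"
  define K where "K = 4 powr (2 * s) * (12 * C * (pi / 2) powr \<gamma>)"
  have "(\<lambda>j. (pi / 2) * (1 / 2) ^ j) \<longlonglongrightarrow> (pi / 2) * 0"
    by (intro tendsto_intros LIMSEQ_power_zero) simp
  then have "\<forall>\<^sub>F j in sequentially. (pi / 2) * (1 / 2) ^ j < min \<epsilon>0 1"
    using \<epsilon>0 by (intro order_tendstoD(2)) auto
  then obtain j0 where j0: "\<And>j. j0 \<le> j \<Longrightarrow> (pi / 2) * (1 / 2) ^ j < min \<epsilon>0 1"
    unfolding eventually_sequentially by blast
  show ?thesis
  proof (rule dyadic_summable[where q = q and K = K and ?j0.0 = j0])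
    have "2 powr (2 * s - \<gamma>) < 2 powr 0"
      using s(2) unfolding \<gamma>_def by (intro powr_less_mono) auto
    then show "q < 1" by (simp add: q_def)
    show "0 \<le> q" "0 \<le> K" using C by (simp_all add: q_def K_def)
    fix j assume j: "j0 \<le> j"
    let ?S = "{k::int. 2 ^ j \<le> \<bar>k\<bar> \<and> \<bar>k\<bar> < 2 ^ Suc j}"
    define h where "h = pi / (2 * 2 ^ j)"
    have h_eq: "h = (pi / 2) * (1 / 2) ^ j" by (simp add: h_def power_divide)
    have h: "0 < h" "h < \<epsilon>0" "h < 1" using j0[OF j] unfolding h_eq by auto
    have pow: "(2 powr real j) = 2 ^ j" by (simp add: powr_realpow)
    have "(\<Sum>k\<in>?S. (1 + \<bar>real_of_int k\<bar>) powr (2 * s) * (norm (fourier_coeff (\<lambda>x. of_real (f x)) k))\<^sup>2) \<le>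
        (\<Sum>k\<in>?S. (4 * 2 ^ j) powr (2 * s) * (norm (fourier_coeff (\<lambda>x. of_real (f x)) k))\<^sup>2)"
    proof (intro sum_mono mult_right_mono powr_mono2)
      fix k :: int assume "k \<in> ?S"
      then have "real_of_int \<bar>k\<bar> < real_of_int (2 ^ Suc j)" by (simp only: of_int_less_iff mem_Collect_eq)
      then have "\<bar>real_of_int k\<bar> < 2 * 2 ^ j" by simp
      moreover have "(1::real) \<le> 2 ^ j" by simp
      ultimately show "1 + \<bar>real_of_int k\<bar> \<le> 4 * 2 ^ j" by linarith
    qed (use s in auto)
    also have "\<dots> = (4 * 2 ^ j) powr (2 * s) * (\<Sum>k\<in>?S. (norm (fourier_coeff (\<lambda>x. of_real (f x)) k))\<^sup>2)"
      by (simp add: sum_distrib_left)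
    also have "\<dots> \<le> (4 * 2 ^ j) powr (2 * s) * (12 * C * h powr \<gamma>)"
      unfolding \<gamma>_def
      by (intro mult_left_mono dyadic_block_le[OF cont per hoelder C a h_def h(3)] cover h(1,2)) auto
    also have "h powr \<gamma> = (pi / 2) powr \<gamma> * 2 powr (- (real j * \<gamma>))"
    proof -
      have "h = (pi / 2) * 2 powr (- real j)"
        by (simp add: h_def powr_minus_divide powr_realpow)
      then have "h powr \<gamma> = (pi / 2) powr \<gamma> * (2 powr (- real j)) powr \<gamma>"
        by (simp only: powr_mult)
      then show ?thesis by (simp add: powr_powr)
    qed
    also have "(4 * 2 ^ j) powr (2 * s) = 4 powr (2 * s) * 2 powr (real j * (2 * s))"
      unfolding pow[symmetric] by (simp add: powr_mult powr_powr)
    also have "4 powr (2 * s) * 2 powr (real j * (2 * s)) * (12 * C * ((pi / 2) powr \<gamma> * 2 powr (- (real j * \<gamma>)))) =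
        K * (2 powr (real j * (2 * s)) * 2 powr (- (real j * \<gamma>)))"
      unfolding K_def by (simp only: mult_ac)
    also have "2 powr (real j * (2 * s)) * 2 powr (- (real j * \<gamma>)) = q ^ j"
      unfolding q_def powr_add[symmetric] by (subst powr_power) (simp_all add: algebra_simps)
    finally show "(\<Sum>k\<in>?S. (1 + \<bar>real_of_int k\<bar>) powr (2 * s) *
        (norm (fourier_coeff (\<lambda>x. of_real (f x)) k))\<^sup>2) \<le> K * q ^ j" .
  qed simp
qed

text \<open>A dimension below some \<open>d < 5/2 - 2 r\<^sub>0\<close> would leave a gap between \<open>2 r\<^sub>0\<close> and \<open>2 + a - d\<close> for \<open>a\<close> close to \<open>1/2\<close>,
  hence more than \<open>r\<^sub>0\<close> derivatives in \<open>L\<^sup>2\<close>.\<close>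

lemma graph_dim_between:
  fixes f :: "real \<Rightarrow> real"
  assumes cont: "continuous_on UNIV f" and per: "\<And>x. f (x + 2 * pi) = f x"
    and hoelder: "\<And>b. 1/2 < b \<Longrightarrow> b < 1 \<Longrightarrow>
      \<exists>C\<ge>0. \<forall>x h. 0 < h \<longrightarrow> h \<le> 1 \<longrightarrow> \<bar>f (x + h) - f x\<bar> \<le> C * h powr (1 - b)"
    and r0: "0 \<le> r0"
    and irregular: "\<And>n::nat. \<not> (\<lambda>k. (1 + \<bar>real_of_int k\<bar>) powr (2 * (r0 + 1 / real (Suc n))) *
      (norm (fourier_coeff (\<lambda>x. of_real (f x)) k))\<^sup>2) summable_on UNIV"
  shows "upper_minkowski_dim (torus_graph f) \<in> {ereal (5/2 - 2 * r0)..ereal (3/2)}"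
proof -
  have "upper_minkowski_dim (torus_graph f) \<le> ereal (3/2)"
  proof (rule ereal_le_epsilon2)
    fix e :: real assume e: "0 < e"
    define b where "b = 1/2 + min e (1/4)"
    have b: "1/2 < b" "b < 1" "b \<le> 1/2 + e" using e by (auto simp: b_def min_def)
    obtain C where C: "0 \<le> C" "\<And>x h. 0 < h \<Longrightarrow> h \<le> 1 \<Longrightarrow> \<bar>f (x + h) - f x\<bar> \<le> C * h powr (1 - b)"
      using hoelder[OF b(1,2)] by blast
    have "upper_minkowski_dim (torus_graph f) \<le> ereal (2 - (1 - b))"
      using b C by (intro hoelder_graph_dim_le) auto
    also have "\<dots> \<le> ereal (3/2) + ereal e" using b by simp
    finally show "upper_minkowski_dim (torus_graph f) \<le> ereal (3/2) + ereal e" .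
  qed
  moreover have "ereal (5/2 - 2 * r0) \<le> upper_minkowski_dim (torus_graph f)"
  proof (rule ccontr)
    assume "\<not> ereal (5/2 - 2 * r0) \<le> upper_minkowski_dim (torus_graph f)"
    then have "upper_minkowski_dim (torus_graph f) < ereal (5/2 - 2 * r0)" by (simp only: not_le)
    then obtain d where d: "upper_minkowski_dim (torus_graph f) < ereal d" "d < 5/2 - 2 * r0"
      using ereal_dense2[of "upper_minkowski_dim (torus_graph f)" "ereal (5/2 - 2 * r0)"] by auto
    define gap where "gap = 5/2 - 2 * r0 - d"
    have gap: "0 < gap" using d by (simp add: gap_def)
    \<comment> \<open>at most half of the gap is lost to the Hoelder exponent \<open>1 - b\<close>, less than half to \<open>2 / Suc n\<close>\<close>
    define b where "b = 1/2 + min (gap / 2) (1/4)"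
    have b: "1/2 < b" "b < 1" "b \<le> 1/2 + gap / 2" using gap by (auto simp: b_def min_def)
    obtain C where C: "0 \<le> C" "\<And>x h. 0 < h \<Longrightarrow> h \<le> 1 \<Longrightarrow> \<bar>f (x + h) - f x\<bar> \<le> C * h powr (1 - b)"
      using hoelder[OF b(1,2)] by blast
    obtain \<epsilon>0 where \<epsilon>0: "0 < \<epsilon>0"
      "\<And>\<epsilon>. 0 < \<epsilon> \<Longrightarrow> \<epsilon> < \<epsilon>0 \<Longrightarrow> real (covering_number (torus_graph f) \<epsilon>) \<le> \<epsilon> powr (- d)"
      using upper_minkowski_dim_less_imp[OF d(1)] by blast
    obtain n where n: "inverse (real (Suc n)) < gap / 4"
      using reals_Archimedean[of "gap / 4"] gap by auto
    have "(\<lambda>k. (1 + \<bar>real_of_int k\<bar>) powr (2 * (r0 + 1 / real (Suc n))) *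
        (norm (fourier_coeff (\<lambda>x. of_real (f x)) k))\<^sup>2) summable_on UNIV"
    proof (rule small_covering_imp_sobolev[OF cont per C(2) C(1) _ _ \<epsilon>0])
      have "2 * (r0 + 1 / real (Suc n)) < 2 * r0 + gap / 2"
        using n unfolding inverse_eq_divide by (simp only: distrib_left)
      also have "\<dots> \<le> 2 + (1 - b) - d" using b unfolding gap_def by (simp add: field_simps)
      finally show "2 * (r0 + 1 / real (Suc n)) < 2 + (1 - b) - d" .
    qed (use b r0 in auto)
    then show False using irregular by blast
  qed
  ultimately show ?thesis by simp
qed

section \<open>Real and imaginary parts of the solution\<close>

lemma fourier_coeff_cnj:
  "fourier_coeff (\<lambda>x. cnj (u x)) k = cnj (fourier_coeff u (- k))"
proof -
  have "(LINT x:{0..2*pi}|lebesgue. cnj (u x) * character (- k) x) =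
      (LINT x:{0..2*pi}|lebesgue. cnj (u x * character k x))"
    by (simp add: cnj_character)
  also have "\<dots> = cnj (LINT x:{0..2*pi}|lebesgue. u x * character k x)"
    unfolding set_lebesgue_integral_def complex_cnj_scaleR[symmetric] by (rule Bochner_Integration.integral_cnj)
  finally show ?thesis by (simp add: fourier_coeff_eq)
qed

lemma fourier_coeff_linear:
  assumes "set_integrable lebesgue {0..2*pi} u" "set_integrable lebesgue {0..2*pi} v"
  shows "fourier_coeff (\<lambda>x. a * u x + b * v x) k = a * fourier_coeff u k + b * fourier_coeff v k"
proof -
  have "(LINT x:{0..2*pi}|lebesgue. (a * u x + b * v x) * character (- k) x) =
      (LINT x:{0..2*pi}|lebesgue. a * (u x * character (- k) x) + b * (v x * character (- k) x))"
    by (simp add: algebra_simps)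
  also have "\<dots> = a * (LINT x:{0..2*pi}|lebesgue. u x * character (- k) x) +
      b * (LINT x:{0..2*pi}|lebesgue. v x * character (- k) x)"
    by (subst set_integral_add(2)) (simp_all add: set_integrable_mult_character assms)
  finally show ?thesis by (simp add: fourier_coeff_eq add_divide_distrib)
qed

context torus_bv
begin

lemma norm_fourier_coeff_Re_Im:
  assumes "weyl_bound t b" "b < 1"
  shows "(norm (fourier_coeff (\<lambda>x. of_real (Re (evolution t x))) k))\<^sup>2 = 1/4 *
      (norm (time_factor t k * fourier_coeff g k + cnj (time_factor t k) * cnj (fourier_coeff g (- k))))\<^sup>2"
    and "(norm (fourier_coeff (\<lambda>x. of_real (Im (evolution t x))) k))\<^sup>2 = 1/4 *
      (norm (time_factor t k * fourier_coeff g k + cnj (time_factor t k) * - cnj (fourier_coeff g (- k))))\<^sup>2"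
proof -
  let ?u = "evolution t"
  have i: "set_integrable lebesgue {0..2*pi} ?u" "set_integrable lebesgue {0..2*pi} (\<lambda>x. cnj (?u x))"
    by (auto intro!: absolutely_integrable_continuous_real continuous_intros
        continuous_on_subset[OF continuous_evolution[OF assms]])
  have re: "(\<lambda>x. complex_of_real (Re (?u x))) = (\<lambda>x. (1/2) * ?u x + (1/2) * cnj (?u x))"
    by (auto simp: complex_eq_iff)
  have im: "(\<lambda>x. complex_of_real (Im (?u x))) = (\<lambda>x. (- \<i>/2) * ?u x + (\<i>/2) * cnj (?u x))"
    by (auto simp: complex_eq_iff)
  have cnj: "cnj (fourier_coeff ?u (- k)) = cnj (time_factor t k) * cnj (fourier_coeff g (- k))"
    by (simp add: fourier_coeff_evolution[OF assms])
  have "fourier_coeff (\<lambda>x. of_real (Re (?u x))) k =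
      (1/2) * (time_factor t k * fourier_coeff g k + cnj (time_factor t k) * cnj (fourier_coeff g (- k)))"
    unfolding re fourier_coeff_linear[OF i] fourier_coeff_cnj cnj fourier_coeff_evolution[OF assms]
    by (simp add: algebra_simps)
  then show "(norm (fourier_coeff (\<lambda>x. of_real (Re (?u x))) k))\<^sup>2 = 1/4 *
      (norm (time_factor t k * fourier_coeff g k + cnj (time_factor t k) * cnj (fourier_coeff g (- k))))\<^sup>2"
    by (simp only: norm_mult power_mult_distrib) (simp add: power_divide)
  have "fourier_coeff (\<lambda>x. of_real (Im (?u x))) k =
      (- \<i>/2) * (time_factor t k * fourier_coeff g k + cnj (time_factor t k) * - cnj (fourier_coeff g (- k)))"
    unfolding im fourier_coeff_linear[OF i] fourier_coeff_cnj cnj fourier_coeff_evolution[OF assms]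
    by (simp add: algebra_simps)
  then show "(norm (fourier_coeff (\<lambda>x. of_real (Im (?u x))) k))\<^sup>2 = 1/4 *
      (norm (time_factor t k * fourier_coeff g k + cnj (time_factor t k) * - cnj (fourier_coeff g (- k))))\<^sup>2"
    by (simp only: norm_mult power_mult_distrib) (simp add: power_divide norm_divide)
qed

text \<open>The coefficients of the real and imaginary parts have the form of the oscillating sums above, with
  \<open>\<beta>\<^sub>k\<close> the conjugate of plus or minus the coefficient of \<open>g\<close> at \<open>-k\<close>.\<close>

lemma AE_Re_Im_irregular:
  assumes "\<not> (\<lambda>k. (1 + \<bar>real_of_int k\<bar>) powr (2 * s) * (norm (fourier_coeff g k))\<^sup>2) summable_on UNIV"
  shows "AE t in lebesgue.
    \<not> (\<lambda>k. (1 + \<bar>real_of_int k\<bar>) powr (2 * s) *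
      (norm (fourier_coeff (\<lambda>x. of_real (Re (evolution t x))) k))\<^sup>2) summable_on UNIV \<and>
    \<not> (\<lambda>k. (1 + \<bar>real_of_int k\<bar>) powr (2 * s) *
      (norm (fourier_coeff (\<lambda>x. of_real (Im (evolution t x))) k))\<^sup>2) summable_on UNIV"
proof -
  let ?w = "\<lambda>k::int. (1 + \<bar>real_of_int k\<bar>) powr (2 * s)"
  have div: "\<not> (\<lambda>k. ?w k * ((norm (fourier_coeff g k))\<^sup>2 + (norm (\<beta> k))\<^sup>2)) summable_on UNIV"
    for \<beta> :: "int \<Rightarrow> complex"
  proof
    assume "(\<lambda>k. ?w k * ((norm (fourier_coeff g k))\<^sup>2 + (norm (\<beta> k))\<^sup>2)) summable_on UNIV"
    then have "(\<lambda>k. ?w k * (norm (fourier_coeff g k))\<^sup>2) summable_on UNIV"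
      by (rule summable_on_comparison_test) (auto intro!: mult_left_mono)
    then show False using assms by contradiction
  qed
  have w0: "0 \<le> ?w k" for k by simp
  have scale: "(\<lambda>k. ?w k * (norm (y k))\<^sup>2) summable_on UNIV"
    if "(\<lambda>k. ?w k * z k) summable_on UNIV" "\<And>k. z k = 1/4 * (norm (y k))\<^sup>2"
    for z and y :: "int \<Rightarrow> complex"
  proof -
    have "(\<lambda>k. 4 * (?w k * z k)) summable_on UNIV" by (rule summable_on_cmult_right[OF that(1)])
    then show ?thesis by (simp add: that(2))
  qed
  show ?thesis
    using AE_weyl_bound AE_oscillating_sum_diverges[OF w0 div[of "\<lambda>k. cnj (fourier_coeff g (- k))"]]
      AE_oscillating_sum_diverges[OF w0 div[of "\<lambda>k. - cnj (fourier_coeff g (- k))"]]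
  proof eventually_elim
    case (elim t)
    have w: "weyl_bound t (3/4)" using elim(1) by simp
    show ?case
      using scale[OF _ norm_fourier_coeff_Re_Im(1)[OF w]] scale[OF _ norm_fourier_coeff_Re_Im(2)[OF w]]
        elim(2,3) by auto
  qed
qed

lemma AE_graph_dims:
  assumes r0: "0 \<le> r0" and irregular: "\<And>\<epsilon>. 0 < \<epsilon> \<Longrightarrow> g \<notin> sobolev_torus (r0 + \<epsilon>)"
  shows "AE t in lebesgue. \<exists>u \<in> schroedinger_evolution t g. continuous_on UNIV u \<and>
    upper_minkowski_dim (torus_graph (\<lambda>x. Re (u x))) \<in> {ereal (5/2 - 2 * r0)..ereal (3/2)} \<and>
    upper_minkowski_dim (torus_graph (\<lambda>x. Im (u x))) \<in> {ereal (5/2 - 2 * r0)..ereal (3/2)}"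
proof -
  have "\<not> (\<lambda>k. (1 + \<bar>real_of_int k\<bar>) powr (2 * (r0 + 1 / real (Suc n))) *
      (norm (fourier_coeff g k))\<^sup>2) summable_on UNIV" for n :: nat
    using irregular[of "1 / real (Suc n)"] g_L2 unfolding sobolev_torus_def by simp
  then have "AE t in lebesgue. \<forall>n::nat.
    \<not> (\<lambda>k. (1 + \<bar>real_of_int k\<bar>) powr (2 * (r0 + 1 / real (Suc n))) *
      (norm (fourier_coeff (\<lambda>x. of_real (Re (evolution t x))) k))\<^sup>2) summable_on UNIV \<and>
    \<not> (\<lambda>k. (1 + \<bar>real_of_int k\<bar>) powr (2 * (r0 + 1 / real (Suc n))) *
      (norm (fourier_coeff (\<lambda>x. of_real (Im (evolution t x))) k))\<^sup>2) summable_on UNIV"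
    unfolding AE_all_countable by (intro allI AE_Re_Im_irregular)
  then show ?thesis using AE_weyl_bound
  proof eventually_elim
    case (elim t)
    have w: "weyl_bound t (3/4)" using elim(2) by simp
    have cont: "continuous_on UNIV (evolution t)" by (rule continuous_evolution[OF w]) simp
    have hoelder: "\<exists>C\<ge>0. \<forall>x h. 0 < h \<longrightarrow> h \<le> 1 \<longrightarrow> norm (evolution t (x + h) - evolution t x) \<le> C * h powr (1 - b)"
      if "1/2 < b" "b < 1" for b
    proof -
      have "weyl_bound t b" "0 \<le> b" using elim(2) that by auto
      from evolution_hoelder[OF this that(2)] show ?thesis by metis
    qed
    have "upper_minkowski_dim (torus_graph (\<lambda>x. Re (evolution t x))) \<in> {ereal (5/2 - 2 * r0)..ereal (3/2)}"
    proof (rule graph_dim_between[OF _ _ _ r0])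
      fix b :: real assume "1/2 < b" "b < 1"
      then show "\<exists>C\<ge>0. \<forall>x h. 0 < h \<longrightarrow> h \<le> 1 \<longrightarrow> \<bar>Re (evolution t (x + h)) - Re (evolution t x)\<bar> \<le> C * h powr (1 - b)"
        using hoelder abs_Re_le_cmod by (metis minus_complex.simps(1) order_trans)
    qed (use elim(1) in \<open>auto intro!: continuous_intros cont simp: evolution_periodic\<close>)
    moreover have "upper_minkowski_dim (torus_graph (\<lambda>x. Im (evolution t x))) \<in> {ereal (5/2 - 2 * r0)..ereal (3/2)}"
    proof (rule graph_dim_between[OF _ _ _ r0])
      fix b :: real assume "1/2 < b" "b < 1"
      then show "\<exists>C\<ge>0. \<forall>x h. 0 < h \<longrightarrow> h \<le> 1 \<longrightarrow> \<bar>Im (evolution t (x + h)) - Im (evolution t x)\<bar> \<le> C * h powr (1 - b)"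
        using hoelder abs_Im_le_cmod by (metis minus_complex.simps(2) order_trans)
    qed (use elim(1) in \<open>auto intro!: continuous_intros cont simp: evolution_periodic\<close>)
    moreover have "evolution t \<in> schroedinger_evolution t g"
      by (rule evolution_in_schroedinger_evolution[OF w]) simp
    ultimately show ?case using cont by blast
  qed
qed

lemma AE_continuous_evolution:
  "AE t in lebesgue. \<exists>u \<in> schroedinger_evolution t g. continuous_on UNIV u"
  using AE_weyl_bound
proof eventually_elim
  case (elim t)
  then have w: "weyl_bound t (3/4)" by simp
  show ?case
    using continuous_evolution[OF w] evolution_in_schroedinger_evolution[OF w] by auto
qed

end

theorem theorem3p1:
  fixes g :: "real \<Rightarrow> complex"
  assumes "torus_fun g" and "bounded_variation_on 0 (2 * pi) g"
  shows "(AE t in lebesgue. \<exists>u \<in> schroedinger_evolution t g. continuous_on UNIV u) \<and>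
    (\<forall>r0 \<in> {1/2..<3/4}. g \<notin> (\<Union>\<epsilon>\<in>{0<..}. sobolev_torus (r0 + \<epsilon>)) \<longrightarrow>
       (AE t in lebesgue. \<exists>u \<in> schroedinger_evolution t g. continuous_on UNIV u \<and>
          upper_minkowski_dim (torus_graph (\<lambda>x. Re (u x))) \<in> {ereal (5/2 - 2 * r0)..ereal (3/2)} \<and>
          upper_minkowski_dim (torus_graph (\<lambda>x. Im (u x))) \<in> {ereal (5/2 - 2 * r0)..ereal (3/2)})) \<and>
    (g \<notin> (\<Union>\<epsilon>\<in>{0<..}. sobolev_torus (1/2 + \<epsilon>)) \<longrightarrow>
       (AE t in lebesgue. \<exists>u \<in> schroedinger_evolution t g. continuous_on UNIV u \<and>
          upper_minkowski_dim (torus_graph (\<lambda>x. Re (u x))) = ereal (3/2) \<and>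
          upper_minkowski_dim (torus_graph (\<lambda>x. Im (u x))) = ereal (3/2)))"
proof -
  obtain V :: "real \<Rightarrow> real"
    where V: "\<And>x y. 0 \<le> x \<Longrightarrow> x \<le> y \<Longrightarrow> y \<le> 2 * pi \<Longrightarrow> norm (g y - g x) \<le> V y - V x"
    using bounded_variation_on_dominated[OF assms(2)] by blast
  interpret torus_bv g V
    by unfold_locales (use assms(1) V in auto)
  have dims: "AE t in lebesgue. \<exists>u \<in> schroedinger_evolution t g. continuous_on UNIV u \<and>
      upper_minkowski_dim (torus_graph (\<lambda>x. Re (u x))) \<in> {ereal (5/2 - 2 * r0)..ereal (3/2)} \<and>
      upper_minkowski_dim (torus_graph (\<lambda>x. Im (u x))) \<in> {ereal (5/2 - 2 * r0)..ereal (3/2)}"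
    if "1/2 \<le> r0" "g \<notin> (\<Union>\<epsilon>\<in>{0<..}. sobolev_torus (r0 + \<epsilon>))" for r0
    using that by (intro AE_graph_dims) auto
  \<comment> \<open>for \<open>r\<^sub>0 = 1/2\<close> the interval of possible dimensions is a single point\<close>
  have "{ereal (5/2 - 2 * (1/2))..ereal (3/2)} = {ereal (3/2)}" by simp
  then show ?thesis
    using AE_continuous_evolution dims dims[of "1/2"] by simp
qed

end
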